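(* For all integers $n \geq 2$ and $\ell\geq 0$, we have $$C_{n,\ell} = \sum_{k=0}^{\ell-1} (-1)^{k+\ell-1} \left[\!\left[ \begin{matrix} k+\ell-1\\ k \end{matrix} \right]\!\right] \genfrac{\lbrace}{\rbrace}{0pt}{}{n-1+k}{k+\ell}.$$
   Context: A series extension of a graph is a graph obtained by subdividing an edge; a parallel extension is a graph obtained by adding a new edge parallel to an existing one. A graph (loops and multiple edges allowed) is series-parallel if it can be constructed from a 2-cycle (two vertices joined by two parallel edges) by a (possibly empty) sequence of series and parallel extensions; by convention, a single edge (non-loop) and a single loop are also series-parallel graphs. A series-parallel matroid is the (cycle/graphic) matroid associated with a series-parallel graph. The empty matroid is not a series-parallel matroid. $[n]=\{1,\ldots,n\}$. $C_{n,k}$ denotes the number of series-parallel matroids with ground set $[n]$ and rank $k$ (counted as matroids on the labelled set $[n]$, not up to isomorphism and not as graphs). $\left[\!\left[ \begin{matrix} n\\ k \end{matrix} \right]\!\right]$ is the unsigned associated Stirling number of the first kind: the number of derangements (fixed-point-free permutations) of $[n]$ with exactly $k$ cycles; it equals $1$ for $n=k=0$. $\genfrac{\lbrace}{\rbrace}{0pt}{}{n}{k}$ is the Stirling number of the second kind: the number of partitions of $[n]$ into $k$ nonempty parts. Empty sums are $0$. *)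

theory Defs
  imports "HOL-Combinatorics.Combinatorics"
begin

section \<open>Multigraphs\<close>

text \<open>
  Undirected graphs with named edges; \<open>ends G e\<close> is the set of end vertices of the edge \<open>e\<close>, a
  singleton if \<open>e\<close> is a loop.  The values of \<open>ends G\<close> outside of \<open>edges G\<close> carry no meaning.
\<close>

record ('v, 'e) multigraph =
  verts :: "'v set"
  edges :: "'e set"
  ends :: "'e \<Rightarrow> 'v set"

definition two_cycle :: "('v, 'e) multigraph \<Rightarrow> bool" where
  "two_cycle G \<longleftrightarrow> (\<exists>u v e f. u \<noteq> v \<and> e \<noteq> f \<and> verts G = {u, v} \<and> edges G = {e, f} \<and>
     ends G e = {u, v} \<and> ends G f = {u, v})"

definition single_edge :: "('v, 'e) multigraph \<Rightarrow> bool" where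
  "single_edge G \<longleftrightarrow> (\<exists>u v e. u \<noteq> v \<and> verts G = {u, v} \<and> edges G = {e} \<and> ends G e = {u, v})"

definition single_loop :: "('v, 'e) multigraph \<Rightarrow> bool" where
  "single_loop G \<longleftrightarrow> (\<exists>v e. verts G = {v} \<and> edges G = {e} \<and> ends G e = {v})"

text \<open>
  Subdividing \<open>e\<close> with a new vertex \<open>w\<close>: one of the two halves keeps the name \<open>e\<close>, the other half
  gets a fresh name \<open>f\<close>.  As \<open>{u, v} = {v, u}\<close>, either half may be the one that keeps its name.
\<close>

definition series_extension :: "('v, 'e) multigraph \<Rightarrow> ('v, 'e) multigraph \<Rightarrow> bool" where
  "series_extension G H \<longleftrightarrow> (\<exists>e f u v w. e \<in> edges G \<and> ends G e = {u, v} \<and>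
     w \<notin> verts G \<and> f \<notin> edges G \<and>
     H = \<lparr>verts = insert w (verts G), edges = insert f (edges G),
          ends = (ends G)(e := {u, w}, f := {w, v})\<rparr>)"

definition parallel_extension :: "('v, 'e) multigraph \<Rightarrow> ('v, 'e) multigraph \<Rightarrow> bool" where
  "parallel_extension G H \<longleftrightarrow> (\<exists>e f. e \<in> edges G \<and> f \<notin> edges G \<and>
     H = \<lparr>verts = verts G, edges = insert f (edges G), ends = (ends G)(f := ends G e)\<rparr>)"

text \<open>
  The single edge and the single loop are series-parallel by convention only: no extensions are
  applied to them.
\<close>

definition series_parallel_graph :: "('v, 'e) multigraph \<Rightarrow> bool" where
  "series_parallel_graph G \<longleftrightarrow>
     (\<exists>G0. two_cycle G0 \<and> (\<lambda>H K. series_extension H K \<or> parallel_extension H K)\<^sup>*\<^sup>* G0 G) \<or>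
     single_edge G \<or> single_loop G"

text \<open>
  \<open>C\<close> is the edge set of a cycle visiting the distinct vertices \<open>vs\<close> along the distinct edges \<open>es\<close>.
  A loop is a cycle of length 1, a pair of parallel edges a cycle of length 2.
\<close>

definition is_cycle :: "('v, 'e) multigraph \<Rightarrow> 'e set \<Rightarrow> bool" where
  "is_cycle G C \<longleftrightarrow> (\<exists>vs es. es \<noteq> [] \<and> length vs = length es \<and> distinct vs \<and> distinct es \<and>
     set vs \<subseteq> verts G \<and> set es \<subseteq> edges G \<and> C = set es \<and>
     (\<forall>i < length es. ends G (es ! i) = {vs ! i, vs ! (Suc i mod length vs)}))"


section \<open>Series-parallel matroids\<close>

text \<open>
  A matroid is given by its ground set and its independent sets.  The matroid axioms are not part
  of the type; the only matroids considered below are cycle matroids.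
\<close>

record 'e matroid =
  ground :: "'e set"
  indep :: "'e set set"

definition rank :: "'e matroid \<Rightarrow> nat" where
  "rank M = Max (card ` indep M)"

definition cycle_matroid :: "('v, 'e) multigraph \<Rightarrow> 'e matroid" where
  "cycle_matroid G =
     \<lparr>ground = edges G, indep = {I. I \<subseteq> edges G \<and> (\<forall>C. is_cycle G C \<longrightarrow> \<not> C \<subseteq> I)}\<rparr>"

text \<open>
  Series-parallel graphs are finite, so taking natural numbers as vertices is no restriction.
\<close>

definition series_parallel_matroid :: "'e matroid \<Rightarrow> bool" where
  "series_parallel_matroid M \<longleftrightarrow>
     (\<exists>G :: (nat, 'e) multigraph. series_parallel_graph G \<and> M = cycle_matroid G)"

definition num_sp_matroids :: "nat \<Rightarrow> nat \<Rightarrow> nat" where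
  "num_sp_matroids n k =
     card {M :: nat matroid. series_parallel_matroid M \<and> ground M = {1..n} \<and> rank M = k}"


section \<open>Associated Stirling numbers of the first kind\<close>

text \<open>
  The cycles of a permutation \<open>p\<close> of \<open>{1..n}\<close> correspond to the orbits of \<open>p\<close> on \<open>{1..n}\<close>.
  Stirling numbers of the second kind are \<^const>\<open>Stirling\<close> in the library (as opposed to
  \<^const>\<open>stirling\<close>, the first kind).
\<close>

definition assoc_stirling :: "nat \<Rightarrow> nat \<Rightarrow> nat" where
  "assoc_stirling n k =
     card {p. p permutes {1..n} \<and> (\<forall>i\<in>{1..n}. p i \<noteq> i) \<and> card (orbit p ` {1..n}) = k}"

end

theory Submission
  imports Defs "HOL-Computational_Algebra.Computational_Algebra"
begin

text \<open>
  Fix a root element \<open>r\<close>.  A series-parallel matroid on \<open>E \<union> {r}\<close> is given by a two-terminal series-parallel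
  network with edge set \<open>E\<close>, i.e. by a binary tree of series and parallel compositions, and it determines and
  is determined by the read-once monotone function saying which sets of edges connect the terminals.

  Such functions factor uniquely into series-irreducible and, dually, into parallel-irreducible ones.  Hence, if
  \<open>N = y x + S + P\<close> is the exponential generating function of the networks (with \<open>y\<close> marking the rank, and \<open>S\<close>,
  \<open>P\<close> counting those of series and of parallel type), then \<open>S' = (N - S)' N\<close> and \<open>y P' = (N - P)' N\<close>.  With
  \<open>w = (N - P) / y\<close> these equations integrate to \<open>N = y (exp w - 1)\<close> and \<open>w = x + (N - ln (1 + N)) / y\<close>, and
  Lagrange inversion gives the formula: powers of \<open>exp - 1\<close> produce the Stirling numbers of the second kind, powers
  of \<open>t - ln (1 + t)\<close> the associated Stirling numbers of the first kind.
\<close>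

section \<open>Cycle matroids of series-parallel graphs\<close>

text \<open>Many trees give the same matroid, since composition is associative and commutative. So
  distinct values of \<open>conn\<close> are counted, and the irreducible factor containing a marked
  label is split off; marking is differentiation, hence the product equations. They express that a
  network is a nonempty set of irreducible factors: in series ranks add and
  \<open>N = exp (N - S) - 1\<close>; in parallel \<open>j\<close> factors lose \<open>j - 1\<close>
  in rank, so each factor carries \<open>1 / y\<close> and the whole a factor \<open>y\<close>. This
  is the origin of \<open>w\<close> and of \<open>N = y (exp w - 1)\<close>. The parallel equation
  is the dual of the series one under \<open>y -> 1 / y\<close>, which is why \<open>y\<close> is a
  fixed nonzero real rather than an indeterminate; the ranks are separated at the end by letting
  \<open>y\<close> vary. Together the equations make \<open>w\<close> a fixed point of
  \<open>w = x + phi(w)\<close>, where \<open>phi\<close> has no constant and no linear term, so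
  that inversion yields a finite sum over powers of \<open>phi\<close>. On the graph side the
  vertices have to be eliminated: cycles given by vertex sequences are awkward to follow through a
  subdivision, whereas edge sets of even degree change by a simple substitution.\<close>

definition edge_degree :: "('v, 'e) multigraph \<Rightarrow> 'e set \<Rightarrow> 'v \<Rightarrow> nat" where
  "edge_degree G D x = (\<Sum>d\<in>D. if x \<in> ends G d then 1 else 0)"

text \<open>The members of the cycle space over the two-element field.\<close>

definition even_sets :: "('v, 'e) multigraph \<Rightarrow> 'e set set" where
  "even_sets G = {D. D \<subseteq> edges G \<and> (\<forall>x. even (edge_degree G D x))}"

text \<open>The invariant of graphs grown from a 2-cycle. A loop would contribute 1 instead of 2 to
  \<open>edge_degree\<close>, so parity describes the cycle space only in the absence of
  loops.\<close>

definition loopless :: "('v, 'e) multigraph \<Rightarrow> bool" where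
  "loopless G \<longleftrightarrow> finite (verts G) \<and> finite (edges G) \<and>
     (\<forall>e\<in>edges G. ends G e \<subseteq> verts G \<and> card (ends G e) = 2)"

text \<open>Every edge of the cycle has a first and a second end, and the cyclic shift of indices
  turns the sum over second ends into the sum over first ends. Each degree is therefore twice a
  number.\<close>

lemma is_cycle_even:
  assumes "loopless G" "is_cycle G C"
  shows "C \<in> even_sets G" "C \<noteq> {}"
proof -
  obtain vs es where *: "es \<noteq> []" "length vs = length es" "distinct vs" "distinct es"
    "set es \<subseteq> edges G" "C = set es"
    "\<And>i. i < length es \<Longrightarrow> ends G (es ! i) = {vs ! i, vs ! (Suc i mod length vs)}"
    using assms(2) unfolding is_cycle_def by blast
  let ?n = "length es"
  have n: "?n > 0" using * by simp
  have "even (edge_degree G C x)" for x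
  proof -
    have "edge_degree G C x = (\<Sum>i<?n. if x \<in> ends G (es ! i) then 1 else 0)"
      unfolding edge_degree_def \<open>C = set es\<close>
      by (rule sum.reindex_bij_betw[symmetric, OF bij_betw_nth]) (use * in auto)
    also have "\<dots> = (\<Sum>i<?n. (if x = vs ! i then 1 else 0) + (if x = vs ! (Suc i mod ?n) then 1 else 0))"
    proof (rule sum.cong)
      fix i assume "i \<in> {..<?n}"
      then have i: "i < ?n" by simp
      then have "es ! i \<in> edges G" using *(5) by auto
      then have "card (ends G (es ! i)) = 2" using assms(1) by (auto simp: loopless_def)
      then have "vs ! i \<noteq> vs ! (Suc i mod ?n)" using *(7)[OF i] *(2) by auto
      then show "(if x \<in> ends G (es ! i) then 1 else 0) =
        (if x = vs ! i then 1 else 0) + (if x = vs ! (Suc i mod ?n) then 1 else (0::nat))"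
        using *(7)[OF i] *(2) by auto
    qed simp
    also have "\<dots> = (\<Sum>i<?n. if x = vs ! i then 1 else 0) + (\<Sum>i<?n. if x = vs ! (Suc i mod ?n) then 1 else 0)"
      by (rule sum.distrib)
    also have "(\<Sum>i<?n. if x = vs ! (Suc i mod ?n) then 1 else 0) = (\<Sum>i<?n. if x = vs ! i then 1 else (0::nat))"
    proof (rule sum.reindex_bij_betw)
      have "inj_on (\<lambda>i. Suc i mod ?n) {..<?n}"
      proof (rule inj_onI)
        fix i j assume "i \<in> {..<?n}" "j \<in> {..<?n}" "Suc i mod ?n = Suc j mod ?n"
        then show "i = j" by (auto simp: mod_Suc split: if_splits)
      qed
      moreover have "(\<lambda>i. Suc i mod ?n) ` {..<?n} \<subseteq> {..<?n}" using n by auto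
      ultimately show "bij_betw (\<lambda>i. Suc i mod ?n) {..<?n} {..<?n}"
        by (simp add: bij_betw_def endo_inj_surj)
    qed
    finally show ?thesis by simp
  qed
  then show "C \<in> even_sets G" "C \<noteq> {}" using * by (auto simp: even_sets_def)
qed

text \<open>At the far end of a longest path an even set has a second edge, which leads back to the path.\<close>

lemma even_set_contains_cycle:
  assumes G: "loopless G" and D: "D \<in> even_sets G" "D \<noteq> {}"
  shows "\<exists>C. is_cycle G C \<and> C \<subseteq> D"
proof -
  define path where "path k v e \<longleftrightarrow> inj_on v {..k} \<and> (\<forall>i\<le>k. v i \<in> verts G) \<and>
    (\<forall>i<k. e i \<in> D \<and> ends G (e i) = {v i, v (Suc i)})" for k :: nat and v :: "nat \<Rightarrow> 'a" and e :: "nat \<Rightarrow> 'b"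
  have DG: "D \<subseteq> edges G" and fD: "finite D"
    using D G finite_subset by (auto simp: even_sets_def loopless_def)
  have two: "\<exists>y. ends G d = {x, y} \<and> x \<noteq> y \<and> x \<in> verts G \<and> y \<in> verts G" if "d \<in> D" "x \<in> ends G d" for d x
  proof -
    have "card (ends G d) = 2" "ends G d \<subseteq> verts G" using that DG G by (auto simp: loopless_def)
    then show ?thesis using that(2) by (fastforce simp: card_2_iff)
  qed
  obtain d0 where d0: "d0 \<in> D" using D by blast
  then have "card (ends G d0) = 2" using DG G by (auto simp: loopless_def)
  then obtain x0 x1 where x0: "ends G d0 = {x0, x1}" "x0 \<noteq> x1" by (auto simp: card_2_iff)
  have "x0 \<in> verts G" "x1 \<in> verts G" using two[OF d0] x0 by auto
  then have "path 1 (\<lambda>i. if i = 0 then x0 else x1) (\<lambda>_. d0)"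
    using x0 d0 unfolding path_def by (auto simp: inj_on_def)
  then have ex1: "\<exists>v e. path 1 v e" by blast
  have bound: "k \<le> card (verts G)" if "\<exists>v e. path k v e" for k
  proof -
    from that obtain v e where "path k v e" by blast
    then have "inj_on v {..k}" "v ` {..k} \<subseteq> verts G" by (auto simp: path_def)
    then have "card {..k} \<le> card (verts G)" using G card_inj_on_le by (metis loopless_def)
    then show ?thesis by simp
  qed
  define k where "k = (GREATEST k. \<exists>v e. path k v e)"
  have "\<exists>v e. path k v e" unfolding k_def by (rule GreatestI_nat[where b = "card (verts G)"]) (use ex1 bound in auto)
  then obtain v e where p: "path k v e" by blast
  have k1: "1 \<le> k" unfolding k_def by (rule Greatest_le_nat[where b = "card (verts G)"]) (use ex1 bound in auto)
  have kmax: "\<not> path (Suc k) v' e'" for v' e'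
  proof
    assume "path (Suc k) v' e'"
    then have "Suc k \<le> k" unfolding k_def
      by (intro Greatest_le_nat[where b = "card (verts G)"]) (use bound in auto)
    then show False by simp
  qed
  have inj: "inj_on v {..k}" and pe: "\<And>i. i < k \<Longrightarrow> e i \<in> D \<and> ends G (e i) = {v i, v (Suc i)}"
    and vV: "\<And>i. i \<le> k \<Longrightarrow> v i \<in> verts G"
    using p unfolding path_def by auto
  let ?l = "e (k - 1)"
  have l: "?l \<in> D" "v k \<in> ends G ?l" using pe[of "k - 1"] k1 by auto
  have "edge_degree G D (v k) = 1 + edge_degree G (D - {?l}) (v k)"
    unfolding edge_degree_def
    using sum.remove[OF fD l(1), of "\<lambda>d. if v k \<in> ends G d then 1 else (0::nat)"] l(2) by simp
  then have "edge_degree G (D - {?l}) (v k) \<noteq> 0" using D(1)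
    by (metis (no_types, lifting) even_sets_def mem_Collect_eq add.right_neutral odd_one)
  then have "\<exists>d\<in>D - {?l}. v k \<in> ends G d"
    by (rule contrapos_np) (auto simp: edge_degree_def intro: sum.neutral)
  then obtain d where d: "d \<in> D" "d \<noteq> ?l" "v k \<in> ends G d" by blast
  obtain x where x: "ends G d = {v k, x}" "v k \<noteq> x" "x \<in> verts G" using two[OF d(1,3)] by blast
  have "x \<in> v ` {..k}"
  proof (rule ccontr)
    assume nx: "x \<notin> v ` {..k}"
    have "path (Suc k) (v(Suc k := x)) (e(k := d))"
      unfolding path_def
    proof (intro conjI allI impI)
      have "inj_on (v(Suc k := x)) {..k}" using inj nx by (rule inj_on_fun_updI)
      moreover have "v(Suc k := x) ` {..k} = v ` {..k}" by auto
      ultimately show "inj_on (v(Suc k := x)) {..Suc k}" using nx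
        unfolding atMost_Suc by (subst inj_on_insert) simp
      fix i
      show "(v(Suc k := x)) i \<in> verts G" if "i \<le> Suc k" using that vV x by auto
      show "(e(k := d)) i \<in> D" "ends G ((e(k := d)) i) = {(v(Suc k := x)) i, (v(Suc k := x)) (Suc i)}"
        if "i < Suc k" using that pe[of i] d x by (cases "i = k"; auto)+
    qed
    then show False using kmax by blast
  qed
  then obtain j where j: "j < k" "x = v j" using x by (metis atMost_iff imageE le_neq_implies_less)
  \<comment> \<open>The path uses \<open>e 0\<close> up to \<open>e (k - 1)\<close>; the free slot
    \<open>k\<close> takes the edge \<open>d\<close> that closes the cycle from \<open>v k\<close>
    back to \<open>v j\<close>.\<close>
  define e' where "e' = e(k := d)"
  let ?vs = "map v [j..<Suc k]" and ?es = "map e' [j..<Suc k]"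
  have "is_cycle G (set ?es)"
    unfolding is_cycle_def
  proof (intro exI conjI)
    show "?es \<noteq> []" "length ?vs = length ?es" using j by auto
    show "distinct ?vs" unfolding distinct_map
      using inj by (auto simp: inj_on_def)
    have ee: "e i \<noteq> e i'" if "i < k" "i' < k" "i \<noteq> i'" for i i'
    proof
      assume "e i = e i'"
      then have "{v i, v (Suc i)} = {v i', v (Suc i')}" using pe that by metis
      then have "{i, Suc i} = {i', Suc i'}"
        using that inj inj_on_image_eq_iff[OF inj, of "{i, Suc i}" "{i', Suc i'}"] by auto
      then show False using that by (auto simp: doubleton_eq_iff)
    qed
    \<comment> \<open>Equal ends would force \<open>i = k - 1\<close>, and \<open>d\<close> was
      chosen different from that last edge of the path.\<close>
    have de: "e i \<noteq> d" if "i < k" for i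
    proof
      assume "e i = d"
      then have "{v i, v (Suc i)} = {v k, v j}" using pe[OF that] x j by auto
      then have "{i, Suc i} = {k, j}"
        using that j inj_on_image_eq_iff[OF inj, of "{i, Suc i}" "{k, j}"] by auto
      then have "i = k - 1" using that by (auto simp: doubleton_eq_iff)
      then show False using \<open>e i = d\<close> d by simp
    qed
    show "distinct ?es" unfolding distinct_map
    proof
      show "inj_on e' (set [j..<Suc k])"
      proof (rule inj_onI)
        fix a b assume "a \<in> set [j..<Suc k]" "b \<in> set [j..<Suc k]" "e' a = e' b"
        then show "a = b" using ee[of a b] de[of a] de[of b] unfolding e'_def
          by (auto split: if_splits)
      qed
    qed simp
    show "set ?vs \<subseteq> verts G" using vV by auto
    show "set ?es \<subseteq> edges G" using pe d DG by (fastforce simp: e'_def)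
    show "\<forall>i<length ?es. ends G (?es ! i) = {?vs ! i, ?vs ! (Suc i mod length ?vs)}"
    proof (intro allI impI)
      fix i assume "i < length ?es"
      then have i: "i < Suc k - j" by (simp del: upt_Suc)
      show "ends G (?es ! i) = {?vs ! i, ?vs ! (Suc i mod length ?vs)}"
      proof (cases "Suc i = Suc k - j")
        case True
        then have "j + i = k" using i j by simp
        then show ?thesis using True i j x by (simp add: e'_def del: upt_Suc)
      next
        case False
        then have "Suc i < Suc k - j" "j + i < k" using i j by auto
        then show ?thesis using j pe[of "j + i"] by (simp add: e'_def del: upt_Suc)
      qed
    qed
  qed simp
  moreover have "set ?es \<subseteq> D" using pe d by (fastforce simp: e'_def)
  ultimately show ?thesis by blast
qed

text \<open>Cycles are nonempty even sets, and every nonempty even set contains a cycle, so both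
  families forbid the same subsets. From here on only even sets are followed through the
  extensions.\<close>

lemma indep_cycle_matroid:
  assumes "loopless G"
  shows "indep (cycle_matroid G) = {I. I \<subseteq> edges G \<and> (\<forall>D\<in>even_sets G. D \<subseteq> I \<longrightarrow> D = {})}"
proof -
  have "(\<forall>C. is_cycle G C \<longrightarrow> \<not> C \<subseteq> I) \<longleftrightarrow> (\<forall>D\<in>even_sets G. D \<subseteq> I \<longrightarrow> D = {})" for I
  proof
    assume l: "\<forall>C. is_cycle G C \<longrightarrow> \<not> C \<subseteq> I"
    show "\<forall>D\<in>even_sets G. D \<subseteq> I \<longrightarrow> D = {}"
    proof (intro ballI impI, rule ccontr)
      fix D assume D: "D \<in> even_sets G" "D \<subseteq> I" "D \<noteq> {}"
      obtain C where "is_cycle G C" "C \<subseteq> D" using even_set_contains_cycle[OF assms D(1,3)] by blast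
      then show False using l D(2) by (metis subset_trans)
    qed
  next
    assume r: "\<forall>D\<in>even_sets G. D \<subseteq> I \<longrightarrow> D = {}"
    show "\<forall>C. is_cycle G C \<longrightarrow> \<not> C \<subseteq> I" using r is_cycle_even[OF assms] by metis
  qed
  then show ?thesis by (simp add: cycle_matroid_def)
qed

text \<open>The pair \<open>{e, f}\<close> is a circuit, and \<open>f\<close> may stand in for
  \<open>e\<close>.\<close>

definition parallel_indep :: "'e set set \<Rightarrow> 'e \<Rightarrow> 'e \<Rightarrow> 'e set set" where
  "parallel_indep \<I> e f = {I. if f \<in> I then e \<notin> I \<and> insert e (I - {f}) \<in> \<I> else I \<in> \<I>}"

text \<open>Contracting \<open>f\<close> undoes the subdivision, which gives the first case;
  deleting \<open>f\<close> turns \<open>e\<close> into a coloop, which gives the second.\<close>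

definition series_indep :: "'e set set \<Rightarrow> 'e \<Rightarrow> 'e \<Rightarrow> 'e set set" where
  "series_indep \<I> e f = {I. if f \<in> I then I - {f} \<in> \<I> else I - {e} \<in> \<I>}"

section \<open>Even sets and independent sets under parallel and series extension\<close>

lemma loopless_parallel_extension:
  assumes "loopless G" "e \<in> edges G"
  shows "loopless \<lparr>verts = verts G, edges = insert f (edges G), ends = (ends G)(f := ends G e)\<rparr>"
  using assms by (auto simp: loopless_def)

text \<open>The edges \<open>e\<close> and \<open>f\<close> have the same incidence vector. Over the
  two-element field they cancel if both are present, and a lone \<open>f\<close> can be exchanged
  for \<open>e\<close>.\<close>

lemma even_sets_parallel_extension:
  assumes G: "loopless G" and e: "e \<in> edges G" "f \<notin> edges G"
    and H: "H = \<lparr>verts = verts G, edges = insert f (edges G), ends = (ends G)(f := ends G e)\<rparr>"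
  shows "D \<in> even_sets H \<longleftrightarrow>
    (if f \<in> D then if e \<in> D then D - {f} - {e} \<in> even_sets G else insert e (D - {f}) \<in> even_sets G
     else D \<in> even_sets G)"
proof (cases "D \<subseteq> insert f (edges G)")
  case False
  then show ?thesis using e by (auto simp: even_sets_def H)
next
  case True
  then have fin: "finite D" using G by (meson finite_insert finite_subset loopless_def)
  have ef: "e \<noteq> f" using e by auto
  have deg: "edge_degree H X x = edge_degree G X x" if "f \<notin> X" for X x
    unfolding edge_degree_def H by (rule sum.cong) (use that in auto)
  have rem: "edge_degree K X x = (if x \<in> ends K d then 1 else 0) + edge_degree K (X - {d}) x"
    if "d \<in> X" "finite X" for K :: "('a, 'b) multigraph" and X d x
    unfolding edge_degree_def by (rule sum.remove[OF that(2,1)])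
  have endsf: "ends H f = ends G e" by (simp add: H)
  show ?thesis
  proof (cases "f \<in> D")
    case f: False
    then show ?thesis using True by (auto simp: even_sets_def H[symmetric] deg) (auto simp: H)
  next
    case f: True
    show ?thesis
    proof (cases "e \<in> D")
      case eD: True
      have "edge_degree H D x = 2 * (if x \<in> ends G e then 1 else 0) + edge_degree G (D - {f} - {e}) x" for x
        using rem[OF f fin, of H x] rem[of e "D - {f}" G x] eD ef fin deg[of "D - {f}" x] endsf by auto
      then have "even (edge_degree H D x) = even (edge_degree G (D - {f} - {e}) x)" for x by simp
      then show ?thesis using f eD True by (auto simp: even_sets_def) (auto simp: H)
    next
      case eD: False
      have "edge_degree H D x = edge_degree G (insert e (D - {f})) x" for x
        using rem[OF f fin, of H x] rem[of e "insert e (D - {f})" G x] eD ef fin deg[of "D - {f}" x] endsf by auto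
      then show ?thesis using f eD True e by (auto simp: even_sets_def) (auto simp: H)
    qed
  qed
qed

lemma indep_parallel_extension:
  assumes G: "loopless G" and e: "e \<in> edges G" "f \<notin> edges G"
    and H: "H = \<lparr>verts = verts G, edges = insert f (edges G), ends = (ends G)(f := ends G e)\<rparr>"
  shows "indep (cycle_matroid H) = parallel_indep (indep (cycle_matroid G)) e f"
proof -
  have ef: "e \<noteq> f" using e by auto
  have lH: "loopless H" unfolding H by (rule loopless_parallel_extension[OF G e(1)])
  have ev: "D \<in> even_sets H \<longleftrightarrow>
    (if f \<in> D then if e \<in> D then D - {f} - {e} \<in> even_sets G else insert e (D - {f}) \<in> even_sets G
     else D \<in> even_sets G)" for D
    by (rule even_sets_parallel_extension[OF G e H])
  have empty: "{} \<in> even_sets G" by (simp add: even_sets_def edge_degree_def)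
  have edH: "edges H = insert f (edges G)" by (simp add: H)
  have evG: "D \<subseteq> edges G" if "D \<in> even_sets G" for D using that by (simp add: even_sets_def)
  have "I \<in> indep (cycle_matroid H) \<longleftrightarrow> I \<in> parallel_indep (indep (cycle_matroid G)) e f" for I
  proof (cases "f \<in> I")
    case False
    then have "D \<in> even_sets H \<longleftrightarrow> D \<in> even_sets G" if "D \<subseteq> I" for D using ev[of D] that by auto
    then show ?thesis using False
      by (auto simp: indep_cycle_matroid[OF G] indep_cycle_matroid[OF lH] parallel_indep_def edH)
  next
    case f: True
    show ?thesis
    proof (cases "e \<in> I")
      case True
      \<comment> \<open>The doubled edge is itself an even set, so no independent set contains both
        \<open>e\<close> and \<open>f\<close>.\<close>
      have "{e, f} - {f} - {e} = {}" by auto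
      then have "{e, f} \<in> even_sets H" using ev[of "{e, f}"] empty by (metis insertCI)
      then show ?thesis using f True
        by (auto simp: indep_cycle_matroid[OF lH] parallel_indep_def intro!: bexI[of _ "{e, f}"])
    next
      case eI: False
      have "(\<forall>D\<in>even_sets H. D \<subseteq> I \<longrightarrow> D = {}) \<longleftrightarrow>
            (\<forall>D\<in>even_sets G. D \<subseteq> insert e (I - {f}) \<longrightarrow> D = {})" (is "?l \<longleftrightarrow> ?r")
      proof
        assume l: ?l
        show ?r
        proof (intro ballI impI)
          fix D assume D: "D \<in> even_sets G" "D \<subseteq> insert e (I - {f})"
          have fD: "f \<notin> D" using evG[OF D(1)] e by auto
          show "D = {}"
          proof (cases "e \<in> D")
            case False
            then show ?thesis using l ev[of D] D fD by auto
          next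
            case True
            have "insert e (insert f (D - {e}) - {f}) = D" using True fD ef by auto
            then have "insert f (D - {e}) \<in> even_sets H" using ev[of "insert f (D - {e})"] D ef by auto
            moreover have "insert f (D - {e}) \<subseteq> I" using D f by auto
            ultimately show ?thesis using l by auto
          qed
        qed
      next
        assume r: ?r
        show ?l
        proof (intro ballI impI)
          fix D assume D: "D \<in> even_sets H" "D \<subseteq> I"
          then have "e \<notin> D" using eI by auto
          show "D = {}"
          proof (cases "f \<in> D")
            case True
            then have "insert e (D - {f}) \<in> even_sets G" using ev[of D] D \<open>e \<notin> D\<close> by auto
            moreover have "insert e (D - {f}) \<subseteq> insert e (I - {f})" using D by auto
            ultimately show ?thesis using r by blast
          next
            case False
            then have "D \<in> even_sets G" using ev[of D] D by auto
            moreover have "D \<subseteq> insert e (I - {f})" using D False by auto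
            ultimately show ?thesis using r by blast
          qed
        qed
      qed
      moreover have "I \<subseteq> edges H \<longleftrightarrow> insert e (I - {f}) \<subseteq> edges G" using e by (auto simp: H)
      ultimately show ?thesis using f eI
        by (auto simp: indep_cycle_matroid[OF G] indep_cycle_matroid[OF lH] parallel_indep_def)
    qed
  qed
  then show ?thesis by blast
qed

lemma loopless_series_extension:
  assumes "loopless G" "e \<in> edges G" "ends G e = {u, v}" "w \<notin> verts G" 
  shows "loopless \<lparr>verts = insert w (verts G), edges = insert f (edges G), ends = (ends G)(e := {u, w}, f := {w, v})\<rparr>"
proof -
  have "u \<in> verts G" "v \<in> verts G" using assms by (auto simp: loopless_def)
  then have "u \<noteq> w" "v \<noteq> w" using assms by auto
  then show ?thesis using assms \<open>u \<in> verts G\<close> \<open>v \<in> verts G\<close> by (fastforce simp: loopless_def)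
qed

text \<open>Only \<open>e\<close> and \<open>f\<close> meet the new vertex \<open>w\<close>, so
  evenness at \<open>w\<close> means both or neither. If both are present, their ends at
  \<open>w\<close> cancel and what remains is the contribution of the old edge
  \<open>e\<close>.\<close>

lemma even_sets_series_extension:
  assumes G: "loopless G" and e: "e \<in> edges G" "ends G e = {u, v}" "w \<notin> verts G" "f \<notin> edges G"
    and H: "H = \<lparr>verts = insert w (verts G), edges = insert f (edges G),
          ends = (ends G)(e := {u, w}, f := {w, v})\<rparr>"
  shows "D \<in> even_sets H \<longleftrightarrow> (e \<in> D \<longleftrightarrow> f \<in> D) \<and> D - {f} \<in> even_sets G"
proof (cases "D \<subseteq> insert f (edges G)")
  case False
  then show ?thesis using e by (auto simp: even_sets_def H)
next
  case True
  then have fin: "finite D" using G by (meson finite_insert finite_subset loopless_def)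
  have ef: "e \<noteq> f" using e by auto
  have "u \<in> verts G" "v \<in> verts G" "card {u, v} = 2" using G e by (auto simp: loopless_def)
  then have uvw: "u \<noteq> w" "v \<noteq> w" "u \<noteq> v" using e by auto
  have deg: "edge_degree H X x = edge_degree G X x" if "f \<notin> X" "e \<notin> X" for X x
    unfolding edge_degree_def H by (rule sum.cong) (use that in auto)
  have rem: "edge_degree K X x = (if x \<in> ends K d then 1 else 0) + edge_degree K (X - {d}) x"
    if "d \<in> X" "finite X" for K :: "('a, 'b) multigraph" and X d x
    unfolding edge_degree_def by (rule sum.remove[OF that(2,1)])
  have endsH: "ends H f = {w, v}" "ends H e = {u, w}" using ef by (auto simp: H)
  have w0: "edge_degree G X w = 0" if "X \<subseteq> edges G" for X
  proof -
    have "w \<notin> ends G d" if "d \<in> X" for d using \<open>X \<subseteq> edges G\<close> that G e by (auto simp: loopless_def)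
    then show ?thesis by (simp add: edge_degree_def)
  qed
  have DefG: "D - {f} - {e} \<subseteq> edges G" using True by auto
  have iff: "e \<in> D \<longleftrightarrow> f \<in> D" if "even (edge_degree H D w)"
  proof (rule ccontr)
    assume "\<not> ?thesis"
    then consider "e \<in> D" "f \<notin> D" | "e \<notin> D" "f \<in> D" by auto
    then have "edge_degree H D w = 1"
    proof cases
      case 1
      then show ?thesis using rem[OF 1(1) fin, of H w] deg[of "D - {e}" w] w0[of "D - {e}"] True endsH by auto
    next
      case 2
      then show ?thesis using rem[OF 2(2) fin, of H w] deg[of "D - {f}" w] w0[of "D - {f}"] True endsH by auto
    qed
    then show False using that by simp
  qed
  have main: "(\<forall>x. even (edge_degree H D x)) \<longleftrightarrow> (\<forall>x. even (edge_degree G (D - {f}) x))"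
    if ef_iff: "e \<in> D \<longleftrightarrow> f \<in> D"
  proof (cases "f \<in> D")
    case False
    then show ?thesis using ef_iff deg[of D] by simp
  next
    case f: True
    then have eD: "e \<in> D" using ef_iff by simp
    have H': "edge_degree H D x = (if x \<in> {w, v} then 1 else 0) + ((if x \<in> {u, w} then 1 else 0)
      + edge_degree G (D - {f} - {e}) x)" for x
      using rem[OF f fin, of H x] rem[of e "D - {f}" H x] eD ef fin deg[of "D - {f} - {e}" x] endsH by auto
    have G': "edge_degree G (D - {f}) x = (if x \<in> {u, v} then 1 else 0) + edge_degree G (D - {f} - {e}) x" for x
      using rem[of e "D - {f}" G x] eD ef fin e by auto
    have "even (edge_degree H D x) \<longleftrightarrow> even (edge_degree G (D - {f}) x)" for x
    proof (cases "x = w")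
      case True
      then show ?thesis using H'[of x] G'[of x] w0[OF DefG] uvw by auto
    next
      case False
      then show ?thesis using H'[of x] G'[of x] uvw by auto
    qed
    then show ?thesis by simp
  qed
  show ?thesis using iff main True e by (auto simp: even_sets_def) (auto simp: H)
qed

lemma indep_series_extension:
  assumes G: "loopless G" and e: "e \<in> edges G" "ends G e = {u, v}" "w \<notin> verts G" "f \<notin> edges G"
    and H: "H = \<lparr>verts = insert w (verts G), edges = insert f (edges G),
          ends = (ends G)(e := {u, w}, f := {w, v})\<rparr>"
  shows "indep (cycle_matroid H) = series_indep (indep (cycle_matroid G)) e f"
proof -
  have ef: "e \<noteq> f" using e by auto
  have lH: "loopless H" unfolding H by (rule loopless_series_extension[OF G e(1-3)])
  have ev: "D \<in> even_sets H \<longleftrightarrow> (e \<in> D \<longleftrightarrow> f \<in> D) \<and> D - {f} \<in> even_sets G" for D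
    by (rule even_sets_series_extension[OF G e H])
  have evG: "D \<subseteq> edges G" if "D \<in> even_sets G" for D using that by (simp add: even_sets_def)
  have edH: "edges H = insert f (edges G)" by (simp add: H)
  have "I \<in> indep (cycle_matroid H) \<longleftrightarrow> I \<in> series_indep (indep (cycle_matroid G)) e f" for I
  proof (cases "f \<in> I")
    case f: True
    have "(\<forall>D\<in>even_sets H. D \<subseteq> I \<longrightarrow> D = {}) \<longleftrightarrow>
          (\<forall>D\<in>even_sets G. D \<subseteq> I - {f} \<longrightarrow> D = {})" (is "?l \<longleftrightarrow> ?r")
    proof
      assume l: ?l
      show ?r
      proof (intro ballI impI)
        fix D assume D: "D \<in> even_sets G" "D \<subseteq> I - {f}"
        \<comment> \<open>An even set of \<open>G\<close> lifts to \<open>H\<close> by adding the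
          second half \<open>f\<close> whenever it uses \<open>e\<close>.\<close>
        let ?D = "if e \<in> D then insert f D else D"
        have "?D - {f} = D" using D by auto
        then have "?D \<in> even_sets H" using ev[of ?D] D ef by auto
        moreover have "?D \<subseteq> I" using D f by auto
        ultimately have "?D = {}" using l by blast
        then show "D = {}" by (auto split: if_splits)
      qed
    next
      assume r: ?r
      show ?l
      proof (intro ballI impI)
        fix D assume D: "D \<in> even_sets H" "D \<subseteq> I"
        have D1: "e \<in> D \<longleftrightarrow> f \<in> D" "D - {f} \<in> even_sets G" using ev[of D] D(1) by simp_all
        have "D - {f} \<subseteq> I - {f}" using D(2) by blast
        then have "D - {f} = {}" using bspec[OF r D1(2)] by simp
        then have "D = {} \<or> D = {f}" by blast
        then show "D = {}" using D1(1) ef by blast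
      qed
    qed
    moreover have "I \<subseteq> edges H \<longleftrightarrow> I - {f} \<subseteq> edges G" by (auto simp: edH)
    ultimately show ?thesis using f
      by (simp add: indep_cycle_matroid[OF G] indep_cycle_matroid[OF lH] series_indep_def)
  next
    case f: False
    have "(\<forall>D\<in>even_sets H. D \<subseteq> I \<longrightarrow> D = {}) \<longleftrightarrow>
          (\<forall>D\<in>even_sets G. D \<subseteq> I - {e} \<longrightarrow> D = {})" (is "?l \<longleftrightarrow> ?r")
    proof
      assume l: ?l
      show ?r
      proof (intro ballI impI)
        fix D assume D: "D \<in> even_sets G" "D \<subseteq> I - {e}"
        then have "D - {f} = D" "f \<notin> D" using evG[of D] e by auto
        then have "D \<in> even_sets H" using ev[of D] D by auto
        then show "D = {}" using l D by blast
      qed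
    next
      assume r: ?r
      show ?l
      proof (intro ballI impI)
        fix D assume D: "D \<in> even_sets H" "D \<subseteq> I"
        then have "f \<notin> D" "e \<notin> D" "D - {f} = D" using f ev[of D] by auto
        then show "D = {}" using r D ev[of D] by auto
      qed
    qed
    moreover have "I \<subseteq> edges H \<longleftrightarrow> I - {e} \<subseteq> edges G" using f e by (auto simp: edH)
    ultimately show ?thesis using f
      by (simp add: indep_cycle_matroid[OF G] indep_cycle_matroid[OF lH] series_indep_def)
  qed
  then show ?thesis by blast
qed


text \<open>Extensions acting on independence systems alone, without vertices. The index
  \<open>k\<close> counts one plus the number of series steps and turns out to be the rank; the
  ground set is carried along to say which \<open>f\<close> are new.\<close>

inductive sp_indep :: "'e set \<Rightarrow> 'e set set \<Rightarrow> nat \<Rightarrow> bool" where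
  base: "a \<noteq> b \<Longrightarrow> sp_indep {a, b} (Pow {a, b} - {{a, b}}) 1"
| par: "sp_indep E \<I> k \<Longrightarrow> e \<in> E \<Longrightarrow> f \<notin> E \<Longrightarrow> sp_indep (insert f E) (parallel_indep \<I> e f) k"
| ser: "sp_indep E \<I> k \<Longrightarrow> e \<in> E \<Longrightarrow> f \<notin> E \<Longrightarrow> sp_indep (insert f E) (series_indep \<I> e f) (Suc k)"

lemma sp_indep_finite: "sp_indep E \<I> k \<Longrightarrow> finite E"
  by (induction rule: sp_indep.induct) auto

lemma sp_indep_subset: "sp_indep E \<I> k \<Longrightarrow> I \<in> \<I> \<Longrightarrow> I \<subseteq> E"
proof (induction arbitrary: I rule: sp_indep.induct)
  case (par E \<I> k e f)
  then have "I - {f} \<subseteq> E"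
    using par.IH[of I] par.IH[of "insert e (I - {f})"] by (auto simp: parallel_indep_def split: if_splits)
  then show ?case by blast
next
  case (ser E \<I> k e f)
  then have "I - {e, f} \<subseteq> E"
    using ser.IH[of "I - {e}"] ser.IH[of "I - {f}"] by (auto simp: series_indep_def split: if_splits)
  then show ?case using ser by blast
qed auto

text \<open>In a parallel step, exchanging \<open>f\<close> for \<open>e\<close> preserves
  cardinality. In a series step, \<open>f\<close> can be added to any old independent set, and
  conversely removing one suitable element of a new independent set gives an old one.\<close>

lemma sp_indep_rank:
  assumes "sp_indep E \<I> k"
  shows "(\<exists>I\<in>\<I>. card I = k) \<and> (\<forall>I\<in>\<I>. card I \<le> k)"
  using assms
proof (induction rule: sp_indep.induct)
  case (base a b)
  have "card I \<le> 1" if "I \<in> Pow {a, b} - {{a, b}}" for I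
  proof -
    have "I \<subset> {a, b}" using that by (simp add: psubset_eq)
    then have "card I < card {a, b}" by (intro psubset_card_mono) simp_all
    then show ?thesis using base by simp
  qed
  moreover have "{a} \<in> Pow {a, b} - {{a, b}}" using base by simp
  moreover have "card {a} = 1" by simp
  ultimately show ?case by metis
next
  case (par E \<I> k e f)
  have fin: "finite I" "f \<notin> I" if "I \<in> \<I>" for I
    using sp_indep_subset[OF par(1) that] sp_indep_finite[OF par(1)] par(3) finite_subset by auto
  from par obtain I where "I \<in> \<I>" "card I = k" by blast
  moreover from this have "I \<in> parallel_indep \<I> e f" using fin by (auto simp: parallel_indep_def)
  moreover have "card J \<le> k" if "J \<in> parallel_indep \<I> e f" for J
  proof (cases "f \<in> J")
    case True
    then have J: "e \<notin> J" "insert e (J - {f}) \<in> \<I>" using that by (auto simp: parallel_indep_def)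
    then have "finite (J - {f})" using fin by (metis finite_insert)
    then have "card (insert e (J - {f})) = card J" using J True
      by (metis DiffD1 card.remove card_insert_disjoint finite_Diff_insert finite.emptyI Diff_empty)
    then show ?thesis using J par by auto
  next
    case False
    then show ?thesis using that par by (auto simp: parallel_indep_def)
  qed
  ultimately show ?case by blast
next
  case (ser E \<I> k e f)
  have fin: "finite I" "f \<notin> I" if "I \<in> \<I>" for I
    using sp_indep_subset[OF ser(1) that] sp_indep_finite[OF ser(1)] ser(3) finite_subset by auto
  from ser obtain I where I: "I \<in> \<I>" "card I = k" by blast
  then have "insert f I \<in> series_indep \<I> e f" "card (insert f I) = Suc k"
    using fin by (auto simp: series_indep_def)
  moreover have "card J \<le> Suc k" if "J \<in> series_indep \<I> e f" for J
  proof -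
    from that obtain x where x: "J - {x} \<in> \<I>" by (auto simp: series_indep_def split: if_splits)
    have "card J \<le> Suc (card (J - {x}))" by (auto simp: card_Diff_singleton_if)
    then show ?thesis using ser x by (meson Suc_le_mono le_trans)
  qed
  ultimately show ?case by blast
qed

lemma indep_two_cycle:
  assumes G: "u \<noteq> v" "e \<noteq> f" "verts G = {u, v}" "edges G = {e, f}" "ends G e = {u, v}" "ends G f = {u, v}"
  shows "loopless G" "indep (cycle_matroid G) = Pow {e, f} - {{e, f}}"
proof -
  show l: "loopless G" using G by (auto simp: loopless_def)
  have "D \<in> even_sets G \<longleftrightarrow> D = {} \<or> D = {e, f}" for D
  proof
    assume D: "D \<in> even_sets G"
    then have "D \<in> Pow {e, f}" by (auto simp: even_sets_def G)
    then have "D = {} \<or> D = {e} \<or> D = {f} \<or> D = {e, f}" unfolding Pow_insert Pow_empty by blast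
    moreover have "edge_degree G {e} u = 1" "edge_degree G {f} u = 1"
      by (simp_all add: edge_degree_def G(5,6))
    moreover have "even (edge_degree G D u)" using D by (simp add: even_sets_def)
    ultimately show "D = {} \<or> D = {e, f}" by (metis odd_one)
  next
    assume "D = {} \<or> D = {e, f}"
    moreover have "edge_degree G {e, f} x = (if x \<in> {u, v} then 2 else 0)" for x
      using G(2) by (simp add: edge_degree_def G(5,6))
    moreover have "edge_degree G {} x = 0" for x by (simp add: edge_degree_def)
    ultimately show "D \<in> even_sets G" using G(4) by (auto simp: even_sets_def)
  qed
  then have "even_sets G = {{}, {e, f}}" by blast
  then have "indep (cycle_matroid G) = {I. I \<subseteq> {e, f} \<and> \<not> {e, f} \<subseteq> I}"
    unfolding indep_cycle_matroid[OF l] G(4) by simp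
  also have "\<dots> = Pow S - {S}" if "S = {e, f}" for S
    unfolding that[symmetric] by blast
  finally show "indep (cycle_matroid G) = Pow {e, f} - {{e, f}}" by simp
qed

abbreviation sp_extension :: "('v, 'e) multigraph \<Rightarrow> ('v, 'e) multigraph \<Rightarrow> bool" where
  "sp_extension \<equiv> \<lambda>H K. series_extension H K \<or> parallel_extension H K"

lemma sp_extension_indep:
  assumes "loopless G" "sp_indep (edges G) (indep (cycle_matroid G)) k" "sp_extension G H"
  shows "loopless H \<and> (\<exists>k. sp_indep (edges H) (indep (cycle_matroid H)) k)"
  using assms(3)
proof
  assume "series_extension G H"
  then obtain e f u v w where e: "e \<in> edges G" "ends G e = {u, v}" "w \<notin> verts G" "f \<notin> edges G"
    and H: "H = \<lparr>verts = insert w (verts G), edges = insert f (edges G),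
          ends = (ends G)(e := {u, w}, f := {w, v})\<rparr>"
    unfolding series_extension_def by blast
  have "edges H = insert f (edges G)" by (simp add: H)
  then show ?thesis
    using loopless_series_extension[OF assms(1) e(1-3)] indep_series_extension[OF assms(1) e H]
      sp_indep.ser[OF assms(2) e(1,4)] by (metis H)
next
  assume "parallel_extension G H"
  then obtain e f where e: "e \<in> edges G" "f \<notin> edges G"
    and H: "H = \<lparr>verts = verts G, edges = insert f (edges G), ends = (ends G)(f := ends G e)\<rparr>"
    unfolding parallel_extension_def by blast
  have "edges H = insert f (edges G)" by (simp add: H)
  then show ?thesis
    using loopless_parallel_extension[OF assms(1) e(1)] indep_parallel_extension[OF assms(1) e H]
      sp_indep.par[OF assms(2) e] by (metis H)
qed

lemma sp_graph_imp_sp_indep: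
  assumes "series_parallel_graph G" "2 \<le> card (edges G)"
  shows "\<exists>k. sp_indep (edges G) (indep (cycle_matroid G)) k"
proof -
  have "\<not> single_edge G" "\<not> single_loop G" using assms(2) by (auto simp: single_edge_def single_loop_def)
  then obtain G0 where G0: "two_cycle G0" "sp_extension\<^sup>*\<^sup>* G0 G"
    using assms(1) by (auto simp: series_parallel_graph_def)
  from G0(2) have "loopless G \<and> (\<exists>k. sp_indep (edges G) (indep (cycle_matroid G)) k)"
  proof (induction rule: rtranclp_induct)
    case base
    obtain u v e f where "u \<noteq> v" "e \<noteq> f" "verts G0 = {u, v}" "edges G0 = {e, f}"
      "ends G0 e = {u, v}" "ends G0 f = {u, v}"
      using G0(1) unfolding two_cycle_def by blast
    then show ?case using indep_two_cycle sp_indep.base by metis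
  next
    case (step H K)
    then show ?case using sp_extension_indep by blast
  qed
  then show ?thesis by blast
qed

lemma sp_indep_imp_sp_graph:
  assumes "sp_indep E \<I> k"
  shows "\<exists>G G0 :: (nat, 'a) multigraph. two_cycle G0 \<and> sp_extension\<^sup>*\<^sup>* G0 G \<and> loopless G \<and>
    edges G = E \<and> indep (cycle_matroid G) = \<I>"
  using assms
proof (induction rule: sp_indep.induct)
  case (base a b)
  define G where "G = \<lparr>verts = {0, 1 :: nat}, edges = {a, b}, ends = \<lambda>_. {0, 1}\<rparr>"
  have "two_cycle G"
    unfolding two_cycle_def
    by (rule exI[of _ 0], rule exI[of _ 1], rule exI[of _ a], rule exI[of _ b]) (use base in \<open>auto simp: G_def\<close>)
  moreover have "loopless G" "indep (cycle_matroid G) = Pow {a, b} - {{a, b}}"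
    by (rule indep_two_cycle[of 0 1]; use base in \<open>simp add: G_def\<close>)+
  ultimately show ?case by (intro exI[of _ G]) (simp add: G_def)
next
  case (par E \<I> k e f)
  then obtain G G0 :: "(nat, 'a) multigraph" where G: "two_cycle G0" "sp_extension\<^sup>*\<^sup>* G0 G" "loopless G"
    "edges G = E" "indep (cycle_matroid G) = \<I>" by blast
  let ?H = "\<lparr>verts = verts G, edges = insert f (edges G), ends = (ends G)(f := ends G e)\<rparr>"
  have ef: "e \<in> edges G" "f \<notin> edges G" using par G by auto
  then have "parallel_extension G ?H" unfolding parallel_extension_def by blast
  then have "sp_extension\<^sup>*\<^sup>* G0 ?H" using G(2) by (simp add: rtranclp.rtrancl_into_rtrancl)
  moreover have "loopless ?H" using loopless_parallel_extension[OF G(3) ef(1)] .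
  moreover have "edges ?H = insert f E" using G by simp
  moreover have "indep (cycle_matroid ?H) = parallel_indep \<I> e f"
    using indep_parallel_extension[OF G(3) ef refl] G(5) by simp
  ultimately show ?case using G(1) by blast
next
  case (ser E \<I> k e f)
  then obtain G G0 :: "(nat, 'a) multigraph" where G: "two_cycle G0" "sp_extension\<^sup>*\<^sup>* G0 G" "loopless G"
    "edges G = E" "indep (cycle_matroid G) = \<I>" by blast
  have ef: "e \<in> edges G" "f \<notin> edges G" using ser G by auto
  have "card (ends G e) = 2" "finite (verts G)" using G(3) ef by (auto simp: loopless_def)
  then obtain u v w where uvw: "ends G e = {u, v}" "w \<notin> verts G"
    by (meson card_2_iff ex_new_if_finite infinite_UNIV_nat)
  let ?H = "\<lparr>verts = insert w (verts G), edges = insert f (edges G), ends = (ends G)(e := {u, w}, f := {w, v})\<rparr>"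
  have "series_extension G ?H" unfolding series_extension_def using ef uvw by blast
  then have "sp_extension\<^sup>*\<^sup>* G0 ?H" using G(2) by (simp add: rtranclp.rtrancl_into_rtrancl)
  moreover have "loopless ?H" using loopless_series_extension[OF G(3) ef(1) uvw] .
  moreover have "edges ?H = insert f E" using G by simp
  moreover have "indep (cycle_matroid ?H) = series_indep \<I> e f"
    using indep_series_extension[OF G(3) ef(1) uvw ef(2) refl] G(5) by simp
  ultimately show ?case using G(1) by blast
qed

text \<open>A ground set of at least two elements excludes the single edge and the single loop, so
  the graph has grown from a 2-cycle.\<close>

theorem series_parallel_matroid_iff:
  assumes "2 \<le> card (ground M)"
  shows "series_parallel_matroid M \<longleftrightarrow> (\<exists>k. sp_indep (ground M) (indep M) k)"
proof
  assume "series_parallel_matroid M"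
  then obtain G :: "(nat, 'a) multigraph" where G: "series_parallel_graph G" "M = cycle_matroid G"
    unfolding series_parallel_matroid_def by blast
  then have "ground M = edges G" by (simp add: cycle_matroid_def)
  then show "\<exists>k. sp_indep (ground M) (indep M) k" using sp_graph_imp_sp_indep[OF G(1)] assms G(2) by simp
next
  assume "\<exists>k. sp_indep (ground M) (indep M) k"
  then obtain G G0 :: "(nat, 'a) multigraph" where G: "two_cycle G0" "sp_extension\<^sup>*\<^sup>* G0 G"
    "edges G = ground M" "indep (cycle_matroid G) = indep M"
    using sp_indep_imp_sp_graph by blast
  then have "M = cycle_matroid G" by (intro matroid.equality) (auto simp: cycle_matroid_def)
  then show "series_parallel_matroid M"
    using G unfolding series_parallel_matroid_def series_parallel_graph_def by blast
qed

lemma rank_sp_indep: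
  assumes "sp_indep (ground M) (indep M) k"
  shows "rank M = k"
proof -
  have "finite (indep M)" using sp_indep_subset[OF assms] sp_indep_finite[OF assms]
    by (meson PowI finite_Pow_iff finite_subset subsetI)
  then show ?thesis unfolding rank_def
    using sp_indep_rank[OF assms] by (intro Max_eqI) auto
qed

section \<open>Series-parallel trees\<close>

datatype (leaves: 'e) sptree = Leaf 'e | Ser "'e sptree" "'e sptree" | Par "'e sptree" "'e sptree"

primrec distinct_leaves :: "'e sptree \<Rightarrow> bool" where
  "distinct_leaves (Leaf e) \<longleftrightarrow> True"
| "distinct_leaves (Ser s t) \<longleftrightarrow> distinct_leaves s \<and> distinct_leaves t \<and> leaves s \<inter> leaves t = {}"
| "distinct_leaves (Par s t) \<longleftrightarrow> distinct_leaves s \<and> distinct_leaves t \<and> leaves s \<inter> leaves t = {}"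

text \<open>
  A tree describes a network with two terminals.  \<open>conn t I\<close>: the edges in \<open>I\<close> connect the terminals;
  \<open>acyc t I\<close>: they contain no cycle.  \<open>tree_rank t\<close> and \<open>tree_indep t r\<close> belong to the matroid
  obtained by joining the terminals by a further edge \<open>r\<close>.
\<close>

primrec conn :: "'e sptree \<Rightarrow> 'e set \<Rightarrow> bool" where
  "conn (Leaf e) I \<longleftrightarrow> e \<in> I"
| "conn (Ser s t) I \<longleftrightarrow> conn s I \<and> conn t I"
| "conn (Par s t) I \<longleftrightarrow> conn s I \<or> conn t I"

primrec acyc :: "'e sptree \<Rightarrow> 'e set \<Rightarrow> bool" where
  "acyc (Leaf e) I \<longleftrightarrow> True"
| "acyc (Ser s t) I \<longleftrightarrow> acyc s I \<and> acyc t I"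
| "acyc (Par s t) I \<longleftrightarrow> acyc s I \<and> acyc t I \<and> \<not> (conn s I \<and> conn t I)"

primrec tree_rank :: "'e sptree \<Rightarrow> nat" where
  "tree_rank (Leaf e) = 1"
| "tree_rank (Ser s t) = tree_rank s + tree_rank t"
| "tree_rank (Par s t) = tree_rank s + tree_rank t - 1"

lemma finite_leaves [simp]: "finite (leaves t)"
  by (induction t) auto

lemma leaves_nonempty [simp]: "leaves t \<noteq> {}"
  by (induction t) auto

lemma tree_rank_pos [simp]: "0 < tree_rank t"
  by (induction t) auto

lemma tree_rank_le: "distinct_leaves t \<Longrightarrow> tree_rank t \<le> card (leaves t)"
  by (induction t) (auto simp: card_Un_disjoint)

lemma conn_cong: "leaves t \<inter> I = leaves t \<inter> J \<Longrightarrow> conn t I = conn t J"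
proof (induction t)
  case (Ser s t)
  have "leaves s \<inter> I = leaves s \<inter> J" "leaves t \<inter> I = leaves t \<inter> J" using Ser.prems by auto
  then show ?case using Ser by simp
next
  case (Par s t)
  have "leaves s \<inter> I = leaves s \<inter> J" "leaves t \<inter> I = leaves t \<inter> J" using Par.prems by auto
  then show ?case using Par by simp
qed auto

lemma acyc_cong: "leaves t \<inter> I = leaves t \<inter> J \<Longrightarrow> acyc t I = acyc t J"
proof (induction t)
  case (Ser s t)
  have "leaves s \<inter> I = leaves s \<inter> J" "leaves t \<inter> I = leaves t \<inter> J" using Ser.prems by auto
  then show ?case using Ser by simp
next
  case (Par s t)
  have *: "leaves s \<inter> I = leaves s \<inter> J" "leaves t \<inter> I = leaves t \<inter> J" using Par.prems by auto
  then show ?case using Par conn_cong[OF *(1)] conn_cong[OF *(2)] by simp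
qed auto

lemma conn_mono: "conn t I \<Longrightarrow> I \<subseteq> J \<Longrightarrow> conn t J"
  by (induction t) auto

lemma conn_leaves: "leaves t \<subseteq> I \<Longrightarrow> conn t I"
  by (induction t) auto

lemma not_conn_empty: "leaves t \<inter> I = {} \<Longrightarrow> \<not> conn t I"
  by (induction t) auto

lemma acyc_empty: "leaves t \<inter> I = {} \<Longrightarrow> acyc t I"
  by (induction t) (auto simp: Int_Un_distrib2 dest: not_conn_empty)

section \<open>Substitution of a network for an edge\<close>

primrec expand :: "'e \<Rightarrow> 'e sptree \<Rightarrow> 'e sptree \<Rightarrow> 'e sptree" where
  "expand e u (Leaf x) = (if x = e then u else Leaf x)"
| "expand e u (Ser s t) = Ser (expand e u s) (expand e u t)"
| "expand e u (Par s t) = Par (expand e u s) (expand e u t)"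

lemma expand_id: "e \<notin> leaves t \<Longrightarrow> expand e u t = t"
  by (induction t) auto

lemma leaves_expand: "leaves (expand e u t) = leaves t - {e} \<union> (if e \<in> leaves t then leaves u else {})"
  by (induction t) auto

lemma distinct_leaves_expand:
  "distinct_leaves t \<Longrightarrow> distinct_leaves u \<Longrightarrow> leaves u \<inter> leaves t \<subseteq> {e} \<Longrightarrow> distinct_leaves (expand e u t)"
proof (induction t)
  case (Ser s t)
  then have "leaves u \<inter> leaves s \<subseteq> {e}" "leaves u \<inter> leaves t \<subseteq> {e}" by auto
  then show ?case using Ser by (auto simp: leaves_expand)
next
  case (Par s t)
  then have "leaves u \<inter> leaves s \<subseteq> {e}" "leaves u \<inter> leaves t \<subseteq> {e}" by auto
  then show ?case using Par by (auto simp: leaves_expand)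
qed auto

text \<open>To the rest of the network the substituted part \<open>u\<close> looks like the single
  edge \<open>e\<close>, present exactly when \<open>u\<close> connects its terminals. With a
  two-leaf tree for \<open>u\<close> this is an extension at a non-root edge.\<close>

lemma conn_expand: "conn (expand e u t) I = conn t (if conn u I then insert e I else I - {e})"
  by (induction t) auto

lemma acyc_expand:
  "acyc (expand e u t) I \<longleftrightarrow>
    acyc t (if conn u I then insert e I else I - {e}) \<and> (e \<in> leaves t \<longrightarrow> acyc u I)"
  by (induction t) (auto simp: conn_expand)

lemma tree_rank_expand:
  "distinct_leaves t \<Longrightarrow> e \<in> leaves t \<Longrightarrow> tree_rank (expand e u t) = tree_rank t + tree_rank u - 1"
proof (induction t)
  case (Ser s t)
  have pos: "0 < tree_rank s" "0 < tree_rank t" "0 < tree_rank u" by auto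
  show ?case
  proof (cases "e \<in> leaves s")
    case True
    then have "e \<notin> leaves t" using Ser by auto
    then have "tree_rank (expand e u t) = tree_rank t" by (simp add: expand_id)
    moreover have "tree_rank (expand e u s) = tree_rank s + tree_rank u - 1" using Ser True by simp
    ultimately show ?thesis unfolding expand.simps tree_rank.simps using pos by linarith
  next
    case False
    then have "tree_rank (expand e u s) = tree_rank s" "tree_rank (expand e u t) = tree_rank t + tree_rank u - 1"
      using Ser by (auto simp: expand_id)
    then show ?thesis unfolding expand.simps tree_rank.simps using pos by linarith
  qed
next
  case (Par s t)
  have pos: "0 < tree_rank s" "0 < tree_rank t" "0 < tree_rank u" by auto
  show ?case
  proof (cases "e \<in> leaves s")
    case True
    then have "e \<notin> leaves t" using Par by auto
    then have "tree_rank (expand e u t) = tree_rank t" by (simp add: expand_id)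
    moreover have "tree_rank (expand e u s) = tree_rank s + tree_rank u - 1" using Par True by simp
    ultimately show ?thesis unfolding expand.simps tree_rank.simps using pos by linarith
  next
    case False
    then have "tree_rank (expand e u s) = tree_rank s" "tree_rank (expand e u t) = tree_rank t + tree_rank u - 1"
      using Par by (auto simp: expand_id)
    then show ?thesis unfolding expand.simps tree_rank.simps using pos by linarith
  qed
qed auto

definition tree_indep :: "'e sptree \<Rightarrow> 'e \<Rightarrow> 'e set set" where
  "tree_indep t r = {I. I \<subseteq> insert r (leaves t) \<and> acyc t I \<and> (r \<in> I \<longrightarrow> \<not> conn t I)}"

lemma tree_indep_expand_Par:
  assumes "e \<in> leaves t" "f \<notin> leaves t" "f \<noteq> r" "e \<noteq> r"
  shows "tree_indep (expand e (Par (Leaf e) (Leaf f)) t) r = parallel_indep (tree_indep t r) e f"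
proof -
  have ef: "e \<noteq> f" using assms by auto
  have sub: "I \<subseteq> insert r (leaves (expand e (Par (Leaf e) (Leaf f)) t)) \<longleftrightarrow> I \<subseteq> insert f (insert r (leaves t))" for I
    using assms by (auto simp: leaves_expand)
  have "I \<in> tree_indep (expand e (Par (Leaf e) (Leaf f)) t) r \<longleftrightarrow>
    I \<in> parallel_indep (tree_indep t r) e f" for I
  proof (cases "f \<in> I")
    case True
    have *: "leaves t \<inter> insert e I = leaves t \<inter> insert e (I - {f})" using assms by auto
    have "I \<subseteq> insert f (insert r (leaves t)) \<longleftrightarrow> insert e (I - {f}) \<subseteq> insert r (leaves t)" using assms by auto
    then show ?thesis
      using True assms conn_cong[OF *] acyc_cong[OF *] unfolding tree_indep_def parallel_indep_def mem_Collect_eq sub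
      by (auto simp: conn_expand acyc_expand)
  next
    case False
    have "I \<subseteq> insert f (insert r (leaves t)) \<longleftrightarrow> I \<subseteq> insert r (leaves t)" using False by auto
    then show ?thesis
      using False assms unfolding tree_indep_def parallel_indep_def mem_Collect_eq sub
      by (auto simp: conn_expand acyc_expand insert_absorb)
  qed
  then show ?thesis by blast
qed

lemma tree_indep_expand_Ser:
  assumes "e \<in> leaves t" "f \<notin> leaves t" "f \<noteq> r" "e \<noteq> r"
  shows "tree_indep (expand e (Ser (Leaf e) (Leaf f)) t) r = series_indep (tree_indep t r) e f"
proof -
  have ef: "e \<noteq> f" using assms by auto
  have sub: "I \<subseteq> insert r (leaves (expand e (Ser (Leaf e) (Leaf f)) t)) \<longleftrightarrow> I \<subseteq> insert f (insert r (leaves t))" for I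
    using assms by (auto simp: leaves_expand)
  have "I \<in> tree_indep (expand e (Ser (Leaf e) (Leaf f)) t) r \<longleftrightarrow>
    I \<in> series_indep (tree_indep t r) e f" for I
  proof (cases "f \<in> I")
    case True
    have *: "leaves t \<inter> I = leaves t \<inter> (I - {f})" using assms by auto
    have "I \<subseteq> insert f (insert r (leaves t)) \<longleftrightarrow> I - {f} \<subseteq> insert r (leaves t)" using assms by auto
    then show ?thesis
      using True assms conn_cong[OF *] acyc_cong[OF *] unfolding tree_indep_def series_indep_def mem_Collect_eq sub
      by (auto simp: conn_expand acyc_expand insert_absorb)
  next
    case False
    have "I \<subseteq> insert f (insert r (leaves t)) \<longleftrightarrow> I - {e} \<subseteq> insert r (leaves t)" using False assms by auto
    then show ?thesis
      using False assms unfolding tree_indep_def series_indep_def mem_Collect_eq sub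
      by (auto simp: conn_expand acyc_expand insert_absorb)
  qed
  then show ?thesis by blast
qed

text \<open>This is the extension of the root itself: one of \<open>e\<close>, \<open>f\<close>
  stays the root, the other becomes a branch beside the whole tree. Both choices of the root are
  covered, here and in the primed version, since \<open>sp_indep_imp_tree\<close> prescribes the
  root.\<close>

lemma tree_indep_Par:
  assumes "e \<notin> leaves t" "f \<notin> leaves t" "e \<noteq> f"
  shows "tree_indep (Par t (Leaf f)) e = parallel_indep (tree_indep t e) e f"
proof -
  have "I \<in> tree_indep (Par t (Leaf f)) e \<longleftrightarrow> I \<in> parallel_indep (tree_indep t e) e f" for I
  proof (cases "f \<in> I")
    case True
    have *: "leaves t \<inter> insert e (I - {f}) = leaves t \<inter> I" using assms by auto
    have "I \<subseteq> insert e (leaves (Par t (Leaf f))) \<longleftrightarrow> insert e (I - {f}) \<subseteq> insert e (leaves t)" using assms by auto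
    then show ?thesis using True assms conn_cong[OF *] acyc_cong[OF *]
      unfolding tree_indep_def parallel_indep_def mem_Collect_eq by auto
  next
    case False
    have "I \<subseteq> insert e (leaves (Par t (Leaf f))) \<longleftrightarrow> I \<subseteq> insert e (leaves t)" using False by auto
    then show ?thesis using False assms unfolding tree_indep_def parallel_indep_def mem_Collect_eq by auto
  qed
  then show ?thesis by blast
qed

lemma tree_indep_Par':
  assumes "e \<notin> leaves t" "f \<notin> leaves t" "e \<noteq> f"
  shows "tree_indep (Par t (Leaf e)) f = parallel_indep (tree_indep t e) e f"
proof -
  have "I \<in> tree_indep (Par t (Leaf e)) f \<longleftrightarrow> I \<in> parallel_indep (tree_indep t e) e f" for I
  proof (cases "f \<in> I")
    case True
    have *: "leaves t \<inter> insert e (I - {f}) = leaves t \<inter> I" using assms by auto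
    have "I \<subseteq> insert f (leaves (Par t (Leaf e))) \<longleftrightarrow> insert e (I - {f}) \<subseteq> insert e (leaves t)" using assms by auto
    then show ?thesis using True assms conn_cong[OF *] acyc_cong[OF *]
      unfolding tree_indep_def parallel_indep_def mem_Collect_eq by auto
  next
    case False
    have "I \<subseteq> insert f (leaves (Par t (Leaf e))) \<longleftrightarrow> I \<subseteq> insert e (leaves t)" using False by auto
    then show ?thesis using False assms unfolding tree_indep_def parallel_indep_def mem_Collect_eq by auto
  qed
  then show ?thesis by blast
qed

text \<open>When the root is subdivided, one half remains the root between the terminals and the
  other half prolongs the network in series.\<close>

lemma tree_indep_Ser:
  assumes "e \<notin> leaves t" "f \<notin> leaves t" "e \<noteq> f"
  shows "tree_indep (Ser t (Leaf f)) e = series_indep (tree_indep t e) e f"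
proof -
  have "I \<in> tree_indep (Ser t (Leaf f)) e \<longleftrightarrow> I \<in> series_indep (tree_indep t e) e f" for I
  proof (cases "f \<in> I")
    case True
    have *: "leaves t \<inter> (I - {f}) = leaves t \<inter> I" using assms by auto
    have "I \<subseteq> insert e (leaves (Ser t (Leaf f))) \<longleftrightarrow> I - {f} \<subseteq> insert e (leaves t)" using assms by auto
    then show ?thesis using True assms conn_cong[OF *] acyc_cong[OF *]
      unfolding tree_indep_def series_indep_def mem_Collect_eq by auto
  next
    case False
    have *: "leaves t \<inter> (I - {e}) = leaves t \<inter> I" using assms by auto
    have "I \<subseteq> insert e (leaves (Ser t (Leaf f))) \<longleftrightarrow> I - {e} \<subseteq> insert e (leaves t)" using False by auto
    then show ?thesis using False assms acyc_cong[OF *]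
      unfolding tree_indep_def series_indep_def mem_Collect_eq by auto
  qed
  then show ?thesis by blast
qed

lemma tree_indep_Ser':
  assumes "e \<notin> leaves t" "f \<notin> leaves t" "e \<noteq> f"
  shows "tree_indep (Ser t (Leaf e)) f = series_indep (tree_indep t e) e f"
proof -
  have "I \<in> tree_indep (Ser t (Leaf e)) f \<longleftrightarrow> I \<in> series_indep (tree_indep t e) e f" for I
  proof (cases "f \<in> I")
    case True
    have *: "leaves t \<inter> (I - {f}) = leaves t \<inter> I" using assms by auto
    have "I \<subseteq> insert f (leaves (Ser t (Leaf e))) \<longleftrightarrow> I - {f} \<subseteq> insert e (leaves t)" using assms by auto
    then show ?thesis using True assms conn_cong[OF *] acyc_cong[OF *]
      unfolding tree_indep_def series_indep_def mem_Collect_eq by auto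
  next
    case False
    have *: "leaves t \<inter> (I - {e}) = leaves t \<inter> I" using assms by auto
    have "I \<subseteq> insert f (leaves (Ser t (Leaf e))) \<longleftrightarrow> I - {e} \<subseteq> insert e (leaves t)" using False by auto
    then show ?thesis using False assms acyc_cong[OF *]
      unfolding tree_indep_def series_indep_def mem_Collect_eq by auto
  qed
  then show ?thesis by blast
qed

text \<open>The root must be arbitrary in the induction: if the extended or the new edge is the
  prescribed root, the induction hypothesis is used with root \<open>e\<close>, otherwise with root
  \<open>r\<close>.\<close>

lemma sp_indep_imp_tree:
  assumes "sp_indep E \<I> k" "r \<in> E"
  shows "\<exists>t. distinct_leaves t \<and> leaves t = E - {r} \<and> tree_indep t r = \<I> \<and> tree_rank t = k"
  using assms
proof (induction arbitrary: r rule: sp_indep.induct)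
  case (base a b)
  then obtain c where c: "{a, b} = {r, c}" "c \<noteq> r" by auto
  have "tree_indep (Leaf c) r = {I. I \<subseteq> {r, c} \<and> \<not> {r, c} \<subseteq> I}"
    by (auto simp: tree_indep_def)
  also have "\<dots> = Pow S - {S}" if "S = {r, c}" for S
    unfolding that[symmetric] by blast
  finally have "tree_indep (Leaf c) r = Pow {a, b} - {{a, b}}" using c by simp
  moreover have "leaves (Leaf c) = {a, b} - {r}" unfolding c(1) using c(2) by auto
  ultimately show ?case by (intro exI[of _ "Leaf c"]) simp
next
  case (par E \<I> k e f)
  show ?case
  proof (cases "r = e \<or> r = f")
    case True
    obtain t where t: "distinct_leaves t" "leaves t = E - {e}" "tree_indep t e = \<I>" "tree_rank t = k"
      using par.IH[OF par.hyps(2)] by blast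
    define g where "g = (if r = e then f else e)"
    have "tree_indep (Par t (Leaf g)) r = parallel_indep \<I> e f"
      using True tree_indep_Par[of e t f] tree_indep_Par'[of e t f] par.hyps t by (auto simp: g_def)
    moreover have "leaves (Par t (Leaf g)) = insert f E - {r}" "g \<notin> leaves t"
      using t par.hyps True by (auto simp: g_def)
    ultimately show ?thesis using t by (intro exI[of _ "Par t (Leaf g)"]) auto
  next
    case False
    then have r: "r \<in> E" "r \<noteq> e" "r \<noteq> f" using par.prems by auto
    obtain t where t: "distinct_leaves t" "leaves t = E - {r}" "tree_indep t r = \<I>" "tree_rank t = k"
      using par.IH[OF r(1)] by blast
    let ?u = "Par (Leaf e) (Leaf f)"
    have ef: "e \<in> leaves t" "f \<notin> leaves t" "e \<noteq> f" using t r par.hyps by auto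
    have "distinct_leaves (expand e ?u t)" using t ef by (intro distinct_leaves_expand) auto
    moreover have "leaves (expand e ?u t) = insert f E - {r}" using t ef r par.hyps by (auto simp: leaves_expand)
    moreover have "tree_rank (expand e ?u t) = k" using tree_rank_expand[OF t(1) ef(1)] t by simp
    moreover have "tree_indep (expand e ?u t) r = parallel_indep \<I> e f"
      using tree_indep_expand_Par[OF ef(1,2)] r t by auto
    ultimately show ?thesis by blast
  qed
next
  case (ser E \<I> k e f)
  show ?case
  proof (cases "r = e \<or> r = f")
    case True
    obtain t where t: "distinct_leaves t" "leaves t = E - {e}" "tree_indep t e = \<I>" "tree_rank t = k"
      using ser.IH[OF ser.hyps(2)] by blast
    define g where "g = (if r = e then f else e)"
    have "tree_indep (Ser t (Leaf g)) r = series_indep \<I> e f"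
      using True tree_indep_Ser[of e t f] tree_indep_Ser'[of e t f] ser.hyps t by (auto simp: g_def)
    moreover have "leaves (Ser t (Leaf g)) = insert f E - {r}" "g \<notin> leaves t"
      using t ser.hyps True by (auto simp: g_def)
    ultimately show ?thesis using t by (intro exI[of _ "Ser t (Leaf g)"]) auto
  next
    case False
    then have r: "r \<in> E" "r \<noteq> e" "r \<noteq> f" using ser.prems by auto
    obtain t where t: "distinct_leaves t" "leaves t = E - {r}" "tree_indep t r = \<I>" "tree_rank t = k"
      using ser.IH[OF r(1)] by blast
    let ?u = "Ser (Leaf e) (Leaf f)"
    have ef: "e \<in> leaves t" "f \<notin> leaves t" "e \<noteq> f" using t r ser.hyps by auto
    have "distinct_leaves (expand e ?u t)" using t ef by (intro distinct_leaves_expand) auto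
    moreover have "leaves (expand e ?u t) = insert f E - {r}" using t ef r ser.hyps by (auto simp: leaves_expand)
    moreover have "tree_rank (expand e ?u t) = Suc k" using tree_rank_expand[OF t(1) ef(1)] t by simp
    moreover have "tree_indep (expand e ?u t) r = series_indep \<I> e f"
      using tree_indep_expand_Ser[OF ef(1,2)] r t by auto
    ultimately show ?thesis by blast
  qed
qed

text \<open>Somewhere two leaves are siblings. Merging them into one leaf undoes an extension, which
  is how a tree is turned back into a derivation of \<open>sp_indep\<close>.\<close>

lemma cherry:
  assumes "distinct_leaves t" "\<And>e. t \<noteq> Leaf e"
  shows "\<exists>s e f. distinct_leaves s \<and> e \<in> leaves s \<and> f \<notin> leaves s \<and> leaves t = insert f (leaves s) \<and>
    (t = expand e (Ser (Leaf e) (Leaf f)) s \<or> t = expand e (Par (Leaf e) (Leaf f)) s)"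
  using assms
proof (induction t)
  case (Ser s t)
  consider e f where "s = Leaf e" "t = Leaf f" | "\<And>e. s \<noteq> Leaf e" | "\<And>e. t \<noteq> Leaf e" by metis
  then show ?case
  proof cases
    case 1
    then show ?thesis using Ser.prems by (intro exI[of _ "Leaf e"] exI[of _ e] exI[of _ f]) auto
  next
    case 2
    then obtain s' e f where s': "distinct_leaves s'" "e \<in> leaves s'" "f \<notin> leaves s'" "leaves s = insert f (leaves s')"
      "s = expand e (Ser (Leaf e) (Leaf f)) s' \<or> s = expand e (Par (Leaf e) (Leaf f)) s'"
      using Ser by auto
    have "e \<notin> leaves t" "f \<notin> leaves t" using s' Ser.prems by auto
    then show ?thesis using s' Ser.prems by (intro exI[of _ "Ser s' t"] exI[of _ e] exI[of _ f]) (auto simp: expand_id)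
  next
    case 3
    then obtain s' e f where s': "distinct_leaves s'" "e \<in> leaves s'" "f \<notin> leaves s'" "leaves t = insert f (leaves s')"
      "t = expand e (Ser (Leaf e) (Leaf f)) s' \<or> t = expand e (Par (Leaf e) (Leaf f)) s'"
      using Ser by auto
    have "e \<notin> leaves s" "f \<notin> leaves s" using s' Ser.prems by auto
    then show ?thesis using s' Ser.prems by (intro exI[of _ "Ser s s'"] exI[of _ e] exI[of _ f]) (auto simp: expand_id)
  qed
next
  case (Par s t)
  consider e f where "s = Leaf e" "t = Leaf f" | "\<And>e. s \<noteq> Leaf e" | "\<And>e. t \<noteq> Leaf e" by metis
  then show ?case
  proof cases
    case 1
    then show ?thesis using Par.prems by (intro exI[of _ "Leaf e"] exI[of _ e] exI[of _ f]) auto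
  next
    case 2
    then obtain s' e f where s': "distinct_leaves s'" "e \<in> leaves s'" "f \<notin> leaves s'" "leaves s = insert f (leaves s')"
      "s = expand e (Ser (Leaf e) (Leaf f)) s' \<or> s = expand e (Par (Leaf e) (Leaf f)) s'"
      using Par by auto
    have "e \<notin> leaves t" "f \<notin> leaves t" using s' Par.prems by auto
    then show ?thesis using s' Par.prems by (intro exI[of _ "Par s' t"] exI[of _ e] exI[of _ f]) (auto simp: expand_id)
  next
    case 3
    then obtain s' e f where s': "distinct_leaves s'" "e \<in> leaves s'" "f \<notin> leaves s'" "leaves t = insert f (leaves s')"
      "t = expand e (Ser (Leaf e) (Leaf f)) s' \<or> t = expand e (Par (Leaf e) (Leaf f)) s'"
      using Par by auto
    have "e \<notin> leaves s" "f \<notin> leaves s" using s' Par.prems by auto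
    then show ?thesis using s' Par.prems by (intro exI[of _ "Par s s'"] exI[of _ e] exI[of _ f]) (auto simp: expand_id)
  qed
qed auto

lemma tree_imp_sp_indep:
  assumes "distinct_leaves t" "r \<notin> leaves t"
  shows "sp_indep (insert r (leaves t)) (tree_indep t r) (tree_rank t)"
  using assms
proof (induction "card (leaves t)" arbitrary: t rule: less_induct)
  case less
  show ?case
  proof (cases "\<exists>e. t = Leaf e")
    case True
    then obtain e where e: "t = Leaf e" by blast
    then have "e \<noteq> r" using less.prems by auto
    have "tree_indep (Leaf e) r = {I. I \<subseteq> {r, e} \<and> \<not> {r, e} \<subseteq> I}"
      by (auto simp: tree_indep_def)
    also have "\<dots> = Pow S - {S}" if "S = {r, e}" for S
      unfolding that[symmetric] by blast
    finally have "tree_indep (Leaf e) r = Pow {r, e} - {{r, e}}" by simp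
    then show ?thesis using sp_indep.base[of r e] \<open>e \<noteq> r\<close> e by simp
  next
    case False
    then obtain s e f where s: "distinct_leaves s" "e \<in> leaves s" "f \<notin> leaves s" "leaves t = insert f (leaves s)"
      "t = expand e (Ser (Leaf e) (Leaf f)) s \<or> t = expand e (Par (Leaf e) (Leaf f)) s"
      using cherry[OF less.prems(1)] by blast
    have r: "r \<notin> leaves s" "f \<noteq> r" "e \<noteq> r" using less.prems s by auto
    have "card (leaves s) < card (leaves t)" using s by simp
    then have IH: "sp_indep (insert r (leaves s)) (tree_indep s r) (tree_rank s)"
      using less.hyps s(1) r by blast
    have E: "insert r (leaves t) = insert f (insert r (leaves s))" using s by auto
    from s(5) show ?thesis
    proof
      assume t: "t = expand e (Ser (Leaf e) (Leaf f)) s"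
      then have "tree_rank t = Suc (tree_rank s)" using tree_rank_expand[OF s(1,2)] by simp
      then show ?thesis using sp_indep.ser[OF IH, of e f] tree_indep_expand_Ser[OF s(2,3) r(2,3)] s r t
        unfolding E by simp
    next
      assume t: "t = expand e (Par (Leaf e) (Leaf f)) s"
      then have "tree_rank t = tree_rank s" using tree_rank_expand[OF s(1,2)] by simp
      then show ?thesis using sp_indep.par[OF IH, of e f] tree_indep_expand_Par[OF s(2,3) r(2,3)] s r t
        unfolding E by simp
    qed
  qed
qed

text \<open>The minimal connecting sets; they are determined by \<open>conn\<close>, and they determine \<open>acyc\<close>.\<close>

primrec paths :: "'e sptree \<Rightarrow> 'e set set" where
  "paths (Leaf e) = {{e}}"
| "paths (Ser s t) = {P \<union> Q | P Q. P \<in> paths s \<and> Q \<in> paths t}"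
| "paths (Par s t) = paths s \<union> paths t"

lemma paths_subset: "P \<in> paths t \<Longrightarrow> P \<subseteq> leaves t"
  by (induction t arbitrary: P) (fastforce)+

lemma paths_nonempty: "paths t \<noteq> {}" "{} \<notin> paths t"
  by (induction t) auto

lemma conn_iff_path: "conn t I \<longleftrightarrow> (\<exists>P\<in>paths t. P \<subseteq> I)"
proof (induction t)
  case (Ser s t)
  have "(\<exists>P\<in>paths (Ser s t). P \<subseteq> I) \<longleftrightarrow> (\<exists>P\<in>paths s. \<exists>Q\<in>paths t. P \<union> Q \<subseteq> I)" by auto
  also have "\<dots> \<longleftrightarrow> conn s I \<and> conn t I" unfolding Ser by blast
  finally show ?case by simp
qed auto

text \<open>The branches have disjoint leaves: an inclusion between paths of a series composition
  splits into inclusions in both branches, and in a parallel composition nonempty paths of different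
  branches are incomparable.\<close>

lemma paths_antichain:
  "distinct_leaves t \<Longrightarrow> P \<in> paths t \<Longrightarrow> Q \<in> paths t \<Longrightarrow> P \<subseteq> Q \<Longrightarrow> P = Q"
proof (induction t arbitrary: P Q)
  case (Ser s t)
  obtain P1 P2 where P: "P = P1 \<union> P2" "P1 \<in> paths s" "P2 \<in> paths t" using Ser.prems by auto
  obtain Q1 Q2 where Q: "Q = Q1 \<union> Q2" "Q1 \<in> paths s" "Q2 \<in> paths t" using Ser.prems by auto
  have "P1 \<subseteq> leaves s" "Q1 \<subseteq> leaves s" "P2 \<subseteq> leaves t" "Q2 \<subseteq> leaves t"
    using P Q paths_subset by metis+
  moreover have "leaves s \<inter> leaves t = {}" "P1 \<union> P2 \<subseteq> Q1 \<union> Q2" using Ser.prems(1,4) P(1) Q(1) by simp_all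
  ultimately have "P1 \<subseteq> Q1" "P2 \<subseteq> Q2" by blast+
  then have "P1 = Q1" "P2 = Q2" using Ser.IH Ser.prems(1) P(2,3) Q(2,3) by simp_all
  then show ?case using P(1) Q(1) by simp
next
  case (Par s t)
  have s: "X \<subseteq> leaves s" "X \<noteq> {}" if "X \<in> paths s" for X
    using that paths_subset[of X s] paths_nonempty[of s] by auto
  have t: "X \<subseteq> leaves t" "X \<noteq> {}" if "X \<in> paths t" for X
    using that paths_subset[of X t] paths_nonempty[of t] by auto
  have "P \<in> paths s \<and> Q \<in> paths s \<or> P \<in> paths t \<and> Q \<in> paths t"
  proof (rule ccontr)
    assume "\<not> ?thesis"
    then consider "P \<in> paths s" "Q \<in> paths t" | "P \<in> paths t" "Q \<in> paths s"
      using Par.prems(2,3) by auto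
    then have "P \<subseteq> leaves s \<inter> leaves t" "P \<noteq> {}"
      using s t Par.prems(4) by (cases; metis Int_subset_iff subset_trans)+
    moreover have "leaves s \<inter> leaves t = {}" using Par.prems(1) by simp
    ultimately show False by (metis subset_empty)
  qed
  then show ?case using Par.IH Par.prems(1,4) by auto
qed auto

lemma paths_minimal:
  assumes "distinct_leaves t"
  shows "P \<in> paths t \<longleftrightarrow> conn t P \<and> (\<forall>Q. Q \<subset> P \<longrightarrow> \<not> conn t Q)"
proof
  assume P: "P \<in> paths t"
  then have "conn t P" unfolding conn_iff_path by blast
  moreover have "\<not> conn t Q" if "Q \<subset> P" for Q
  proof
    assume "conn t Q"
    then obtain R where "R \<in> paths t" "R \<subseteq> Q" unfolding conn_iff_path by blast
    moreover from this have "R = P" using paths_antichain[OF assms _ P, of R] that by blast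
    ultimately show False using that by blast
  qed
  ultimately show "conn t P \<and> (\<forall>Q. Q \<subset> P \<longrightarrow> \<not> conn t Q)" by blast
next
  assume r: "conn t P \<and> (\<forall>Q. Q \<subset> P \<longrightarrow> \<not> conn t Q)"
  then obtain R where R: "R \<in> paths t" "R \<subseteq> P" unfolding conn_iff_path by blast
  then have "conn t R" unfolding conn_iff_path by blast
  then have "R = P" using r R(2) by blast
  then show "P \<in> paths t" using R(1) by simp
qed

text \<open>Every cycle of the network lies between two routes joining the terminals, so cycles are
  detected by symmetric differences of paths. This makes acyclicity a function of
  \<open>paths\<close>, hence of \<open>conn\<close>.\<close>

lemma acyc_iff_paths:
  "distinct_leaves t \<Longrightarrow> acyc t I \<longleftrightarrow> (\<forall>P\<in>paths t. \<forall>Q\<in>paths t. (P - Q) \<union> (Q - P) \<subseteq> I \<longrightarrow> P = Q)"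
proof (induction t)
  case (Ser s t)
  have IH: "acyc s I \<longleftrightarrow> (\<forall>P\<in>paths s. \<forall>Q\<in>paths s. (P - Q) \<union> (Q - P) \<subseteq> I \<longrightarrow> P = Q)"
    "acyc t I \<longleftrightarrow> (\<forall>P\<in>paths t. \<forall>Q\<in>paths t. (P - Q) \<union> (Q - P) \<subseteq> I \<longrightarrow> P = Q)"
    using Ser by auto
  have disj: "leaves s \<inter> leaves t = {}" using Ser.prems by simp
  show ?case
  proof
    assume "acyc (Ser s t) I"
    then have a: "acyc s I" "acyc t I" by auto
    show "\<forall>P\<in>paths (Ser s t). \<forall>Q\<in>paths (Ser s t). (P - Q) \<union> (Q - P) \<subseteq> I \<longrightarrow> P = Q"
    proof (intro ballI impI)
      fix P Q assume PQ: "P \<in> paths (Ser s t)" "Q \<in> paths (Ser s t)" "(P - Q) \<union> (Q - P) \<subseteq> I"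
      obtain P1 P2 where P: "P = P1 \<union> P2" "P1 \<in> paths s" "P2 \<in> paths t" using PQ by auto
      obtain Q1 Q2 where Q: "Q = Q1 \<union> Q2" "Q1 \<in> paths s" "Q2 \<in> paths t" using PQ by auto
      have "P1 \<subseteq> leaves s" "Q1 \<subseteq> leaves s" "P2 \<subseteq> leaves t" "Q2 \<subseteq> leaves t"
        using P Q paths_subset by metis+
      then have "(P1 - Q1) \<union> (Q1 - P1) \<subseteq> I" "(P2 - Q2) \<union> (Q2 - P2) \<subseteq> I"
        using disj PQ(3) P(1) Q(1) by blast+
      then have "P1 = Q1" "P2 = Q2" using a IH P Q by blast+
      then show "P = Q" using P Q by simp
    qed
  next
    assume r: "\<forall>P\<in>paths (Ser s t). \<forall>Q\<in>paths (Ser s t). (P - Q) \<union> (Q - P) \<subseteq> I \<longrightarrow> P = Q"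
    have "acyc s I" unfolding IH
    proof (intro ballI impI)
      fix P Q assume PQ: "P \<in> paths s" "Q \<in> paths s" "(P - Q) \<union> (Q - P) \<subseteq> I"
      \<comment> \<open>A common path \<open>R\<close> through the other branch cancels in the
        symmetric difference.\<close>
      obtain R where R: "R \<in> paths t" using paths_nonempty by blast
      have "P \<union> R \<in> paths (Ser s t)" "Q \<union> R \<in> paths (Ser s t)" using PQ R by auto
      moreover have "((P \<union> R) - (Q \<union> R)) \<union> ((Q \<union> R) - (P \<union> R)) \<subseteq> I" using PQ by blast
      ultimately have "P \<union> R = Q \<union> R" using r by blast
      then show "P = Q" using disj paths_subset[OF PQ(1)] paths_subset[OF PQ(2)] paths_subset[OF R] by blast
    qed
    moreover have "acyc t I" unfolding IH
    proof (intro ballI impI)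
      fix P Q assume PQ: "P \<in> paths t" "Q \<in> paths t" "(P - Q) \<union> (Q - P) \<subseteq> I"
      obtain R where R: "R \<in> paths s" using paths_nonempty by blast
      have "R \<union> P \<in> paths (Ser s t)" "R \<union> Q \<in> paths (Ser s t)" using PQ R by auto
      moreover have "((R \<union> P) - (R \<union> Q)) \<union> ((R \<union> Q) - (R \<union> P)) \<subseteq> I" using PQ by blast
      ultimately have "R \<union> P = R \<union> Q" using r by blast
      then show "P = Q" using disj paths_subset[OF PQ(1)] paths_subset[OF PQ(2)] paths_subset[OF R] by blast
    qed
    ultimately show "acyc (Ser s t) I" by simp
  qed
next
  case (Par s t)
  have IH: "acyc s I \<longleftrightarrow> (\<forall>P\<in>paths s. \<forall>Q\<in>paths s. (P - Q) \<union> (Q - P) \<subseteq> I \<longrightarrow> P = Q)"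
    "acyc t I \<longleftrightarrow> (\<forall>P\<in>paths t. \<forall>Q\<in>paths t. (P - Q) \<union> (Q - P) \<subseteq> I \<longrightarrow> P = Q)"
    using Par by auto
  have disj: "P \<inter> Q = {} \<and> P \<noteq> Q" if "P \<in> paths s" "Q \<in> paths t" for P Q
  proof -
    have "leaves s \<inter> leaves t = {}" using Par.prems by simp
    then have "P \<inter> Q = {}" using paths_subset[OF that(1)] paths_subset[OF that(2)] by blast
    moreover have "P \<noteq> {}" using that paths_nonempty(2) by metis
    ultimately show ?thesis by auto
  qed
  \<comment> \<open>Paths of different branches are disjoint, so their symmetric difference is their
    union; it lies in \<open>I\<close> for some choice exactly when both branches are connected by
    \<open>I\<close>.\<close>
  have "conn s I \<and> conn t I \<longleftrightarrow> (\<exists>P\<in>paths s. \<exists>Q\<in>paths t. P \<union> Q \<subseteq> I)" unfolding conn_iff_path by blast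
  also have "\<dots> \<longleftrightarrow> (\<exists>P\<in>paths s. \<exists>Q\<in>paths t. (P - Q) \<union> (Q - P) \<subseteq> I)"
    by (intro bex_cong refl) (metis disj Diff_triv Int_commute)
  finally have c: "conn s I \<and> conn t I \<longleftrightarrow> (\<exists>P\<in>paths s. \<exists>Q\<in>paths t. (P - Q) \<union> (Q - P) \<subseteq> I)" .
  show ?case unfolding acyc.simps paths.simps IH c ball_Un
    using disj by (auto simp: Un_commute) 
qed simp

lemma acyc_cong_conn:
  assumes "distinct_leaves s" "distinct_leaves t" "conn s = conn t"
  shows "acyc s = acyc t"
proof -
  have "paths s = paths t" using paths_minimal[OF assms(1)] paths_minimal[OF assms(2)] assms(3) by auto
  then show ?thesis using acyc_iff_paths[OF assms(1)] acyc_iff_paths[OF assms(2)] by auto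
qed

lemma conn_imp_acyclic_conn:
  "distinct_leaves t \<Longrightarrow> conn t J \<Longrightarrow> \<exists>I. I \<subseteq> J \<and> I \<subseteq> leaves t \<and> conn t I \<and> acyc t I"
proof (induction t)
  case (Ser s t)
  then obtain I1 I2 where I: "I1 \<subseteq> J" "I1 \<subseteq> leaves s" "conn s I1" "acyc s I1"
    "I2 \<subseteq> J" "I2 \<subseteq> leaves t" "conn t I2" "acyc t I2" by auto
  have *: "leaves s \<inter> (I1 \<union> I2) = leaves s \<inter> I1" "leaves t \<inter> (I1 \<union> I2) = leaves t \<inter> I2"
    using I Ser.prems by auto
  show ?case using I conn_cong[OF *(1)] conn_cong[OF *(2)] acyc_cong[OF *(1)] acyc_cong[OF *(2)]
    by (intro exI[of _ "I1 \<union> I2"]) auto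
next
  case (Par s t)
  then consider "conn s J" | "conn t J" by auto
  then show ?case
  proof cases
    case 1
    then obtain I where I: "I \<subseteq> J" "I \<subseteq> leaves s" "conn s I" "acyc s I" using Par by auto
    then have "leaves t \<inter> I = {}" using Par.prems by auto
    then show ?thesis using I acyc_empty[of t I] not_conn_empty[of t I] by (intro exI[of _ I]) auto
  next
    case 2
    then obtain I where I: "I \<subseteq> J" "I \<subseteq> leaves t" "conn t I" "acyc t I" using Par by auto
    then have "leaves s \<inter> I = {}" using Par.prems by auto
    then show ?thesis using I acyc_empty[of s I] not_conn_empty[of s I] by (intro exI[of _ I]) auto
  qed
next
  case (Leaf e)
  then show ?case by (intro exI[of _ "{e}"]) auto
qed

text \<open>An acyclic connecting set is independent but becomes dependent once \<open>r\<close> is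
  added, and no other independent set of leaves does. The matroid with its root thus recovers
  \<open>conn\<close>.\<close>

lemma conn_iff_tree_indep:
  assumes "distinct_leaves t" "r \<notin> leaves t"
  shows "conn t J \<longleftrightarrow> (\<exists>I\<subseteq>J \<inter> leaves t. I \<in> tree_indep t r \<and> insert r I \<notin> tree_indep t r)"
proof -
  have *: "leaves t \<inter> insert r I = leaves t \<inter> I" for I using assms(2) by auto
  show ?thesis
  proof
    assume "conn t J"
    then obtain I where I: "I \<subseteq> J" "I \<subseteq> leaves t" "conn t I" "acyc t I"
      using conn_imp_acyclic_conn[OF assms(1)] by blast
    moreover have "conn t (insert r I)" using conn_cong[OF *] I by simp
    ultimately show "\<exists>I\<subseteq>J \<inter> leaves t. I \<in> tree_indep t r \<and> insert r I \<notin> tree_indep t r"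
      using assms(2) by (intro exI[of _ I]) (auto simp: tree_indep_def)
  next
    assume "\<exists>I\<subseteq>J \<inter> leaves t. I \<in> tree_indep t r \<and> insert r I \<notin> tree_indep t r"
    then obtain I where I: "I \<subseteq> J" "I \<in> tree_indep t r" "insert r I \<notin> tree_indep t r" by blast
    then have "conn t I" using conn_cong[OF *] acyc_cong[OF *] by (auto simp: tree_indep_def)
    then show "conn t J" using I conn_mono by blast
  qed
qed

lemma tree_indep_eq_iff:
  assumes "distinct_leaves s" "distinct_leaves t" "leaves s = leaves t" "r \<notin> leaves t"
  shows "tree_indep s r = tree_indep t r \<longleftrightarrow> conn s = conn t"
proof
  assume "tree_indep s r = tree_indep t r"
  then show "conn s = conn t"
    using conn_iff_tree_indep[OF assms(1), of r] conn_iff_tree_indep[OF assms(2), of r] assms by auto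
next
  assume "conn s = conn t"
  then show "tree_indep s r = tree_indep t r"
    using acyc_cong_conn[OF assms(1,2)] assms(3) by (simp add: tree_indep_def)
qed

lemma sp_indep_rank_unique: "sp_indep E \<I> k \<Longrightarrow> sp_indep E \<I> l \<Longrightarrow> k = l"
  using sp_indep_rank by (metis le_antisym)

text \<open>With an auxiliary root outside the leaves, equal functions give equal matroids, and
  \<open>tree_rank\<close> is the rank of the matroid.\<close>

lemma tree_rank_unique:
  fixes s t :: "nat sptree"
  assumes "distinct_leaves s" "distinct_leaves t" "leaves s = leaves t" "conn s = conn t"
  shows "tree_rank s = tree_rank t"
proof -
  obtain r where r: "r \<notin> leaves t" using ex_new_if_finite[OF infinite_UNIV_nat finite_leaves] by blast
  have "tree_indep s r = tree_indep t r" using tree_indep_eq_iff[OF assms(1-3) r] assms(4) by simp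
  then show ?thesis
    using tree_imp_sp_indep[OF assms(1), of r] tree_imp_sp_indep[OF assms(2) r] assms(3) r
    by (metis sp_indep_rank_unique)
qed

section \<open>From matroids to connection functions\<close>

definition sp_trees :: "nat set \<Rightarrow> nat sptree set" where
  "sp_trees E = {t. distinct_leaves t \<and> leaves t = E}"

text \<open>Both maps induce the same partition of \<open>A\<close> into fibres.\<close>

lemma card_image_eq_card_image:
  assumes "\<And>x y. x \<in> A \<Longrightarrow> y \<in> A \<Longrightarrow> f x = f y \<longleftrightarrow> g x = g y"
  shows "card (f ` A) = card (g ` A)"
proof (rule bij_betw_same_card)
  have *: "g (inv_into A f (f x)) = g x" if "x \<in> A" for x
    using that assms by (metis f_inv_into_f image_eqI inv_into_into)
  show "bij_betw (g \<circ> inv_into A f) (f ` A) (g ` A)"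
  proof (rule bij_betw_imageI)
    show "inj_on (g \<circ> inv_into A f) (f ` A)"
      by (rule inj_onI) (use * assms in auto)
    have "(\<lambda>x. g (inv_into A f (f x))) ` A = g ` A" by (rule image_cong) (use * in auto)
    then show "(g \<circ> inv_into A f) ` f ` A = g ` A" by (simp add: image_image comp_def)
  qed
qed

text \<open>The element \<open>n\<close> serves as the root, so the trees have the leaves
  \<open>1\<close> to \<open>n - 1\<close>. This is the source of \<open>n - 1\<close> in the final
  formula.\<close>

lemma num_sp_matroids_eq:
  assumes "2 \<le> n"
  shows "num_sp_matroids n l = card (conn ` {t \<in> sp_trees {1..<n}. tree_rank t = l})"
proof -
  have n: "insert n {1..<n} = {1..n}" "{1..n} - {n} = {1..<n}" using assms by auto
  define M where "M = (\<lambda>t. \<lparr>ground = {1..n}, indep = tree_indep t n\<rparr>)"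
  let ?T = "{t \<in> sp_trees {1..<n}. tree_rank t = l}"
  have "{M. series_parallel_matroid M \<and> ground M = {1..n} \<and> rank M = l} = M ` ?T"
  proof (intro equalityI subsetI)
    fix N :: "nat matroid" assume N: "N \<in> {M. series_parallel_matroid M \<and> ground M = {1..n} \<and> rank M = l}"
    then have "2 \<le> card (ground N)" using assms by simp
    then obtain k where k: "sp_indep (ground N) (indep N) k"
      using N series_parallel_matroid_iff by blast
    then have "k = l" using rank_sp_indep[OF k] N by simp
    moreover obtain t where "distinct_leaves t" "leaves t = {1..n} - {n}" "tree_indep t n = indep N" "tree_rank t = k"
      using sp_indep_imp_tree[OF k, of n] N assms by auto
    ultimately show "N \<in> M ` ?T" using N n by (intro image_eqI[of _ _ t]) (auto simp: M_def sp_trees_def)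
  next
    fix N assume "N \<in> M ` ?T"
    then obtain t where t: "N = M t" "distinct_leaves t" "leaves t = {1..<n}" "tree_rank t = l"
      by (auto simp: sp_trees_def)
    then have k: "sp_indep (ground N) (indep N) l" using tree_imp_sp_indep[of t n] n by (simp add: M_def)
    have g: "ground N = {1..n}" using t by (simp add: M_def)
    then show "N \<in> {M. series_parallel_matroid M \<and> ground M = {1..n} \<and> rank M = l}"
      using rank_sp_indep[OF k] k series_parallel_matroid_iff[of N] assms by auto
  qed
  then have "num_sp_matroids n l = card (M ` ?T)" by (simp add: num_sp_matroids_def)
  also have "\<dots> = card (conn ` ?T)"
  proof (rule card_image_eq_card_image)
    fix s t assume "s \<in> ?T" "t \<in> ?T"
    then show "M s = M t \<longleftrightarrow> conn s = conn t"
      using tree_indep_eq_iff[of s t n] by (simp add: M_def sp_trees_def)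
  qed
  finally show ?thesis .
qed

section \<open>Counting by unique factorization\<close>

primrec is_Ser :: "'e sptree \<Rightarrow> bool" where
  "is_Ser (Leaf e) = False" | "is_Ser (Ser s t) = True" | "is_Ser (Par s t) = False"

primrec is_Par :: "'e sptree \<Rightarrow> bool" where
  "is_Par (Leaf e) = False" | "is_Par (Ser s t) = False" | "is_Par (Par s t) = True"

text \<open>Make the remaining branch neutral: take all its leaves in a series composition and none
  of them in a parallel one. Then \<open>e\<close> decides the value as it does in its own
  branch.\<close>

lemma conn_essential:
  "distinct_leaves t \<Longrightarrow> e \<in> leaves t \<Longrightarrow> \<exists>I. conn t (insert e I) \<and> \<not> conn t (I - {e})"
proof (induction t)
  case (Leaf x)
  then show ?case by auto
next
  case (Ser s t)
  have *: "\<exists>I. conn a (insert e I) \<and> conn b (insert e I) \<and> \<not> (conn a (I - {e}) \<and> conn b (I - {e}))"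
    if "conn a (insert e I)" "\<not> conn a (I - {e})" "leaves a \<inter> leaves b = {}" for a b I
  proof -
    let ?J = "(I \<inter> leaves a) \<union> leaves b"
    have "leaves a \<inter> insert e ?J = leaves a \<inter> insert e I" "leaves a \<inter> (?J - {e}) = leaves a \<inter> (I - {e})"
      using that(3) by auto
    then have "conn a (insert e ?J)" "\<not> conn a (?J - {e})" using that conn_cong by metis+
    moreover have "conn b (insert e ?J)" by (rule conn_leaves) auto
    ultimately show ?thesis by blast
  qed
  have disj: "leaves s \<inter> leaves t = {}" "leaves t \<inter> leaves s = {}" using Ser.prems by auto
  from Ser.prems consider "e \<in> leaves s" | "e \<in> leaves t" by auto
  then show ?case
  proof cases
    case 1
    then obtain I where "conn s (insert e I)" "\<not> conn s (I - {e})" using Ser by auto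
    from *[OF this disj(1)] show ?thesis by auto
  next
    case 2
    then obtain I where "conn t (insert e I)" "\<not> conn t (I - {e})" using Ser by auto
    from *[OF this disj(2)] show ?thesis by auto
  qed
next
  case (Par s t)
  have *: "\<exists>I. (conn a (insert e I) \<or> conn b (insert e I)) \<and> \<not> conn a (I - {e}) \<and> \<not> conn b (I - {e})"
    if "conn a (insert e I)" "\<not> conn a (I - {e})" "leaves a \<inter> leaves b = {}" for a b I
  proof -
    let ?J = "I \<inter> leaves a"
    have "leaves a \<inter> insert e ?J = leaves a \<inter> insert e I" "leaves a \<inter> (?J - {e}) = leaves a \<inter> (I - {e})"
      by auto
    then have "conn a (insert e ?J)" "\<not> conn a (?J - {e})" using that conn_cong by metis+
    moreover have "\<not> conn b (?J - {e})" by (rule not_conn_empty) (use that(3) in auto)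
    ultimately show ?thesis by blast
  qed
  have disj: "leaves s \<inter> leaves t = {}" "leaves t \<inter> leaves s = {}" using Par.prems by auto
  from Par.prems consider "e \<in> leaves s" | "e \<in> leaves t" by auto
  then show ?case
  proof cases
    case 1
    then obtain I where "conn s (insert e I)" "\<not> conn s (I - {e})" using Par by auto
    from *[OF this disj(1)] show ?thesis by auto
  next
    case 2
    then obtain I where "conn t (insert e I)" "\<not> conn t (I - {e})" using Par by auto
    from *[OF this disj(2)] show ?thesis by auto
  qed
qed

text \<open>For a monotone \<open>f\<close> this says that \<open>f\<close> is a conjunction of a
  function of \<open>I \<inter> G\<close> and a function of \<open>I - G\<close>: each factor arises
  by filling up the other side. It is a property of the function alone, without reference to a
  tree.\<close>

definition separates :: "'e set \<Rightarrow> ('e set \<Rightarrow> bool) \<Rightarrow> bool" where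
  "separates G f \<longleftrightarrow> (\<forall>I. f I \<longleftrightarrow> f (I \<union> - G) \<and> f (I \<union> G))"

text \<open>A branch all of whose leaves are present is connected and drops out of the conjunction.
  Both factors are thus determined by the product and the leaf set of the first one.\<close>

lemma conn_factor:
  assumes "distinct_leaves (Ser s t)"
  shows "conn s I \<longleftrightarrow> conn (Ser s t) (I \<union> - leaves s)" "conn t I \<longleftrightarrow> conn (Ser s t) (I \<union> leaves s)"
proof -
  have disj: "leaves s \<inter> leaves t = {}" using assms by simp
  have "leaves s \<inter> I = leaves s \<inter> (I \<union> - leaves s)" "leaves t \<inter> I = leaves t \<inter> (I \<union> leaves s)"
    using disj by auto
  then have "conn s (I \<union> - leaves s) = conn s I" "conn t (I \<union> leaves s) = conn t I" using conn_cong by metis+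
  moreover have "conn t (I \<union> - leaves s)" "conn s (I \<union> leaves s)" using disj by (auto intro!: conn_leaves)
  ultimately show "conn s I \<longleftrightarrow> conn (Ser s t) (I \<union> - leaves s)" "conn t I \<longleftrightarrow> conn (Ser s t) (I \<union> leaves s)"
    by simp_all
qed

lemma Ser_separates:
  assumes "distinct_leaves (Ser s t)"
  shows "separates (leaves s) (conn (Ser s t))"
  unfolding separates_def conn_factor[OF assms, symmetric] by simp

text \<open>A disjunction over disjoint sets of essential variables is not a nontrivial conjunction.
  If \<open>G\<close> alone connects, the factor outside \<open>G\<close> is constantly true, so no
  essential leaf lies outside \<open>G\<close>; if \<open>- G\<close> alone connects, no leaf lies
  inside. One of the two must happen.\<close>

lemma separates_not_Ser:
  assumes u: "distinct_leaves u" "\<not> is_Ser u" and sep: "separates G (conn u)"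
  shows "G \<inter> leaves u = {} \<or> leaves u \<subseteq> G"
proof (cases u)
  case (Leaf e)
  then show ?thesis by auto
next
  case (Ser s t)
  then show ?thesis using u by simp
next
  case (Par s t)
  have sep: "conn u I \<longleftrightarrow> conn u (I \<union> - G) \<and> conn u (I \<union> G)" for I
    by (rule sep[unfolded separates_def, rule_format])
  have 1: "leaves u \<subseteq> G" if "conn u G"
  proof
    fix e assume e: "e \<in> leaves u"
    obtain I where I: "conn u (insert e I)" "\<not> conn u (I - {e})" using conn_essential[OF u(1) e] by blast
    have G: "conn u (J \<union> G)" for J by (rule conn_mono[OF that]) simp
    show "e \<in> G"
    proof (rule ccontr)
      assume "e \<notin> G"
      then have eq: "insert e I \<union> - G = (I - {e}) \<union> - G" by auto
      have "conn u (insert e I) = conn u (I - {e})"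
        unfolding sep[of "insert e I"] sep[of "I - {e}"] by (simp only: eq G)
      then show False using I by simp
    qed
  qed
  have 2: "G \<inter> leaves u = {}" if "conn u (- G)"
  proof (rule ccontr)
    assume "G \<inter> leaves u \<noteq> {}"
    then obtain e where e: "e \<in> leaves u" "e \<in> G" by blast
    obtain I where I: "conn u (insert e I)" "\<not> conn u (I - {e})" using conn_essential[OF u(1) e(1)] by blast
    have G: "conn u (J \<union> - G)" for J by (rule conn_mono[OF that]) simp
    have eq: "insert e I \<union> G = (I - {e}) \<union> G" using e by auto
    have "conn u (insert e I) = conn u (I - {e})"
      unfolding sep[of "insert e I"] sep[of "I - {e}"] by (simp only: eq G)
    then show False using I by simp
  qed
  have disj: "leaves s \<inter> leaves t = {}" using u Par by simp
  \<comment> \<open>Adding \<open>- G\<close> completes \<open>s\<close>, and adding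
    \<open>G\<close> completes \<open>t\<close>. Hence separation makes this mixed set connecting,
    so that \<open>s\<close> is connected by \<open>G\<close> or \<open>t\<close> by
    \<open>- G\<close>.\<close>
  let ?I = "(leaves s \<inter> G) \<union> (leaves t - G)"
  have "conn s (?I \<union> - G)" "conn t (?I \<union> G)" by (auto intro!: conn_leaves)
  then have "conn u (?I \<union> - G)" "conn u (?I \<union> G)" by (simp_all add: Par)
  then have "conn u ?I" unfolding sep[of ?I] by simp
  moreover have "leaves s \<inter> ?I = leaves s \<inter> G" "leaves t \<inter> ?I = leaves t \<inter> - G" using disj by auto
  ultimately have "conn s G \<or> conn t (- G)" using Par conn_cong[of s ?I G] conn_cong[of t ?I "- G"] by simp
  then show ?thesis using 1 2 Par by auto
qed

lemma conn_Ser_neq: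
  assumes "distinct_leaves s" "distinct_leaves t" "leaves s = leaves t" "is_Ser s" "\<not> is_Ser t"
  shows "conn s \<noteq> conn t"
proof
  assume eq: "conn s = conn t"
  obtain a b where s: "s = Ser a b" using assms(4) by (cases s) auto
  have "separates (leaves a) (conn t)" using Ser_separates[of a b] assms(1) s eq by simp
  then have "leaves a \<inter> leaves t = {} \<or> leaves t \<subseteq> leaves a"
    using separates_not_Ser assms by blast
  moreover have "leaves a \<inter> leaves t = leaves a" "leaves a \<inter> leaves b = {}" "leaves b \<subseteq> leaves t"
    using assms(1,3) s by auto
  moreover have "leaves a \<noteq> {}" "leaves b \<noteq> {}" by simp_all
  ultimately show False by blast
qed

text \<open>A separator of the product also separates its factor \<open>s\<close>. As
  \<open>s\<close> is irreducible, the separator contains all of its leaves or none, and the common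
  leaf \<open>z\<close> excludes the latter.\<close>

lemma factor_subset:
  assumes "distinct_leaves (Ser s t)" "distinct_leaves (Ser s' t')" "conn (Ser s t) = conn (Ser s' t')"
    and "z \<in> leaves s" "z \<in> leaves s'" "\<not> is_Ser s"
  shows "leaves s \<subseteq> leaves s'"
proof -
  have "separates (leaves s') (conn s)"
    unfolding separates_def
  proof
    fix I
    let ?f = "conn (Ser s t)"
    have "conn s I \<longleftrightarrow> ?f (I \<union> - leaves s)" by (rule conn_factor(1)[OF assms(1)])
    also have "\<dots> \<longleftrightarrow> ?f (I \<union> - leaves s \<union> - leaves s') \<and> ?f (I \<union> - leaves s \<union> leaves s')"
      using Ser_separates[OF assms(2)] unfolding separates_def assms(3) by blast
    also have "I \<union> - leaves s \<union> - leaves s' = (I \<union> - leaves s') \<union> - leaves s" by auto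
    also have "I \<union> - leaves s \<union> leaves s' = (I \<union> leaves s') \<union> - leaves s" by auto
    finally show "conn s I \<longleftrightarrow> conn s (I \<union> - leaves s') \<and> conn s (I \<union> leaves s')"
      unfolding conn_factor(1)[OF assms(1), symmetric] .
  qed
  moreover have "distinct_leaves s" using assms(1) by simp
  ultimately have "leaves s' \<inter> leaves s = {} \<or> leaves s \<subseteq> leaves s'"
    using separates_not_Ser assms(6) by blast
  then show ?thesis using assms(4,5) by blast
qed

text \<open>Only the factor containing the marked leaf \<open>z\<close> has to be irreducible; the
  cofactor may be of any type. This singles out one factorization despite commutativity and
  associativity.\<close>

lemma factor_unique:
  assumes "distinct_leaves (Ser s t)" "distinct_leaves (Ser s' t')" "conn (Ser s t) = conn (Ser s' t')"
    and "z \<in> leaves s" "z \<in> leaves s'" "\<not> is_Ser s" "\<not> is_Ser s'"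
  shows "leaves s = leaves s'" "conn s = conn s'" "conn t = conn t'"
proof -
  show l: "leaves s = leaves s'" using factor_subset[OF assms(1-6)] factor_subset[OF assms(2,1) assms(3)[symmetric] assms(5,4,7)] by blast
  show "conn s = conn s'" "conn t = conn t'"
    by (rule ext, simp only: conn_factor[OF assms(1)] conn_factor[OF assms(2)] l assms(3))+
qed

text \<open>Commutativity brings the branch with \<open>z\<close> to the front, and associativity
  moves its remaining factors to the cofactor until the front is irreducible.\<close>

lemma factor_exists:
  assumes "distinct_leaves t" "is_Ser t" "z \<in> leaves t"
  shows "\<exists>s u. distinct_leaves (Ser s u) \<and> \<not> is_Ser s \<and> z \<in> leaves s \<and> leaves (Ser s u) = leaves t \<and>
    conn (Ser s u) = conn t \<and> tree_rank (Ser s u) = tree_rank t"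
  using assms
proof (induction t)
  case (Ser a b)
  have *: "\<exists>s u. distinct_leaves (Ser s u) \<and> \<not> is_Ser s \<and> z \<in> leaves s \<and> leaves (Ser s u) = leaves (Ser c d) \<and>
    conn (Ser s u) = conn (Ser c d) \<and> tree_rank (Ser s u) = tree_rank (Ser c d)"
    if c: "z \<in> leaves c" "distinct_leaves (Ser c d)"
      and IH: "is_Ser c \<Longrightarrow> \<exists>s u. distinct_leaves (Ser s u) \<and> \<not> is_Ser s \<and> z \<in> leaves s \<and> leaves (Ser s u) = leaves c \<and>
        conn (Ser s u) = conn c \<and> tree_rank (Ser s u) = tree_rank c" for c d
  proof (cases "is_Ser c")
    case True
    obtain s u where su: "distinct_leaves (Ser s u)" "\<not> is_Ser s" "z \<in> leaves s" "leaves (Ser s u) = leaves c"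
        "conn (Ser s u) = conn c" "tree_rank (Ser s u) = tree_rank c" using IH[OF True] by blast
    have "conn c I \<longleftrightarrow> conn s I \<and> conn u I" for I using su(5) by (metis conn.simps(2))
    then have "conn (Ser s (Ser u d)) = conn (Ser c d)" by auto
    moreover have "leaves (Ser s (Ser u d)) = leaves (Ser c d)" using su(4) by auto
    moreover have "tree_rank (Ser s (Ser u d)) = tree_rank (Ser c d)" using su(6) by simp
    moreover have "distinct_leaves (Ser s (Ser u d))" using su(1,4) c(2) by auto
    ultimately show ?thesis using su(2,3) by blast
  next
    case False
    then show ?thesis using c by blast
  qed
  from Ser.prems consider "z \<in> leaves a" | "z \<in> leaves b" by auto
  then show ?case
  proof cases
    case 1
    show ?thesis
      by (rule *[OF 1 Ser.prems(1)]) (rule Ser.IH(1), use Ser.prems(1) 1 in simp_all)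
  next
    case 2
    have eq: "conn (Ser b a) = conn (Ser a b)" "leaves (Ser b a) = leaves (Ser a b)"
      "tree_rank (Ser b a) = tree_rank (Ser a b)" by auto
    have dist: "distinct_leaves (Ser b a)" using Ser.prems by auto
    show ?thesis unfolding eq[symmetric]
      by (rule *[OF 2 dist]) (rule Ser.IH(2), use Ser.prems(1) 2 in simp_all)
  qed
qed auto

section \<open>Weighted counting of connection functions\<close>

definition sig :: "nat sptree \<Rightarrow> (nat set \<Rightarrow> bool) \<times> nat" where
  "sig t = (conn t, tree_rank t)"

lemma sig_eq_iff:
  "s \<in> sp_trees E \<Longrightarrow> t \<in> sp_trees E \<Longrightarrow> sig s = sig t \<longleftrightarrow> conn s = conn t"
  using tree_rank_unique by (auto simp: sig_def sp_trees_def)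

lemma finite_sig: "finite E \<Longrightarrow> finite (sig ` sp_trees E)"
proof -
  assume E: "finite E"
  have "sig ` sp_trees E \<subseteq> (\<lambda>X I. I \<inter> E \<in> X) ` Pow (Pow E) \<times> {..card E}"
  proof
    fix p assume "p \<in> sig ` sp_trees E"
    then obtain t where t: "p = sig t" "distinct_leaves t" "leaves t = E" by (auto simp: sp_trees_def)
    \<comment> \<open>The function depends only on the trace of its argument on \<open>E\<close>, so
      it is coded by a family of subsets of \<open>E\<close>.\<close>
    have "conn t = (\<lambda>I. I \<inter> E \<in> {J \<in> Pow E. conn t J})"
    proof
      fix I
      have "leaves t \<inter> I = leaves t \<inter> (I \<inter> E)" using t by auto
      then show "conn t I \<longleftrightarrow> I \<inter> E \<in> {J \<in> Pow E. conn t J}" using conn_cong by auto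
    qed
    then have "conn t \<in> (\<lambda>X I. I \<inter> E \<in> X) ` Pow (Pow E)" by (rule image_eqI) auto
    then show "p \<in> (\<lambda>X I. I \<inter> E \<in> X) ` Pow (Pow E) \<times> {..card E}"
      using t tree_rank_le[OF t(2)] by (auto simp: sig_def)
  qed
  then show ?thesis by (rule finite_subset) (use E in auto)
qed

text \<open>Each function contributes once, however many trees represent it. Its rank is already
  determined by \<open>conn\<close>; keeping it in \<open>sig\<close> makes the exponent available
  without choosing a tree.\<close>

definition weight :: "real \<Rightarrow> nat sptree set \<Rightarrow> real" where
  "weight y T = (\<Sum>p\<in>sig ` T. y ^ snd p)"

text \<open>Such an \<open>h\<close> acts injectively on classes of trees; the representative chosen
  by \<open>inv_into\<close> only serves to read off the new rank. It is used for relabelling and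
  for duality.\<close>

lemma weight_reindex:
  assumes "\<And>s t. s \<in> T \<Longrightarrow> t \<in> T \<Longrightarrow> sig s = sig t \<longleftrightarrow> sig (h s) = sig (h t)"
  shows "weight y (h ` T) = (\<Sum>p\<in>sig ` T. y ^ tree_rank (h (inv_into T sig p)))"
proof -
  have "bij_betw (\<lambda>p. sig (h (inv_into T sig p))) (sig ` T) (sig ` h ` T)"
  proof (rule bij_betw_imageI)
    have *: "sig (h (inv_into T sig (sig t))) = sig (h t)" if "t \<in> T" for t
      using that assms by (metis f_inv_into_f image_eqI inv_into_into)
    show "inj_on (\<lambda>p. sig (h (inv_into T sig p))) (sig ` T)"
    proof (rule inj_onI)
      fix p q assume "p \<in> sig ` T" "q \<in> sig ` T"
        and eq: "sig (h (inv_into T sig p)) = sig (h (inv_into T sig q))"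
      then obtain s t where "p = sig s" "q = sig t" "s \<in> T" "t \<in> T" by blast
      then show "p = q" using * assms eq by metis
    qed
    have "(\<lambda>t. sig (h (inv_into T sig (sig t)))) ` T = (\<lambda>t. sig (h t)) ` T" by (rule image_cong) (use * in auto)
    then show "(\<lambda>p. sig (h (inv_into T sig p))) ` sig ` T = sig ` h ` T" by (simp add: image_image)
  qed
  from sum.reindex_bij_betw[OF this, of "\<lambda>p. y ^ snd p"] show ?thesis
    by (simp add: weight_def) (simp add: sig_def)
qed

lemma distinct_leaves_map: "inj_on h (leaves t) \<Longrightarrow> distinct_leaves (map_sptree h t) \<longleftrightarrow> distinct_leaves t"
proof (induction t)
  case (Ser s t)
  then have "inj_on h (leaves s)" "inj_on h (leaves t)" by (auto simp: inj_on_Un)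
  moreover have "h ` leaves s \<inter> h ` leaves t = {} \<longleftrightarrow> leaves s \<inter> leaves t = {}"
    using Ser.prems by (metis image_is_empty inj_on_image_Int sptree.set(2) sup_ge1 sup_ge2)
  ultimately show ?case using Ser by (simp add: sptree.set_map)
next
  case (Par s t)
  then have "inj_on h (leaves s)" "inj_on h (leaves t)" by (auto simp: inj_on_Un)
  moreover have "h ` leaves s \<inter> h ` leaves t = {} \<longleftrightarrow> leaves s \<inter> leaves t = {}"
    using Par.prems by (metis image_is_empty inj_on_image_Int sptree.set(3) sup_ge1 sup_ge2)
  ultimately show ?case using Par by (simp add: sptree.set_map)
qed auto

lemma conn_map: "conn (map_sptree h t) I = conn t (h -` I)"
  by (induction t) auto

lemma tree_rank_map [simp]: "tree_rank (map_sptree h t) = tree_rank t"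
  by (induction t) auto

lemma is_Ser_map [simp]: "is_Ser (map_sptree h t) = is_Ser t"
  by (cases t) auto

lemma sp_trees_bij:
  assumes "bij_betw h E E'"
  shows "sp_trees E' = map_sptree h ` sp_trees E"
proof (intro equalityI subsetI)
  fix t assume t: "t \<in> sp_trees E'"
  define g where "g = inv_into E h"
  have g: "bij_betw g E' E" using assms by (simp add: g_def bij_betw_inv_into)
  then have "map_sptree g t \<in> sp_trees E"
    using t distinct_leaves_map[of g t] by (auto simp: sp_trees_def bij_betw_def sptree.set_map)
  moreover have "map_sptree h (map_sptree g t) = t"
    unfolding sptree.map_comp using t assms
    by (intro sptree.map_ident_strong) (auto simp: sp_trees_def g_def bij_betw_def f_inv_into_f)
  ultimately show "t \<in> map_sptree h ` sp_trees E" by (metis image_eqI)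
next
  fix t assume "t \<in> map_sptree h ` sp_trees E"
  then show "t \<in> sp_trees E'" using assms distinct_leaves_map
    by (auto simp: sp_trees_def bij_betw_def sptree.set_map)
qed

lemma sig_map_eq_iff:
  assumes "inj_on h E" "s \<in> sp_trees E" "t \<in> sp_trees E"
  shows "sig s = sig t \<longleftrightarrow> sig (map_sptree h s) = sig (map_sptree h t)"
proof
  assume "sig (map_sptree h s) = sig (map_sptree h t)"
  then have eq: "conn s (h -` I) = conn t (h -` I)" "tree_rank s = tree_rank t" for I
    by (auto simp: sig_def conn_map fun_eq_iff)
  have "conn s J = conn t J" for J
  proof -
    have "E \<inter> h -` (h ` (J \<inter> E)) = E \<inter> J" using assms(1) by (auto simp: inj_on_def)
    then show ?thesis using conn_cong[of s J "h -` (h ` (J \<inter> E))"] conn_cong[of t J "h -` (h ` (J \<inter> E))"] eq(1) assms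
      by (simp add: sp_trees_def)
  qed
  then show "sig s = sig t" using eq(2) by (auto simp: sig_def)
qed (auto simp: sig_def conn_map fun_eq_iff)

definition ser_irred :: "nat set \<Rightarrow> nat sptree set" where
  "ser_irred E = {t \<in> sp_trees E. \<not> is_Ser t}"

definition ser_trees :: "nat set \<Rightarrow> nat sptree set" where
  "ser_trees E = {t \<in> sp_trees E. is_Ser t}"

lemma weight_bij:
  assumes "bij_betw h E E'" "T \<subseteq> sp_trees E"
  shows "weight y (map_sptree h ` T) = weight y T"
proof -
  have "sig s = sig t \<longleftrightarrow> sig (map_sptree h s) = sig (map_sptree h t)" if "s \<in> T" "t \<in> T" for s t
    using sig_map_eq_iff[of h E s t] assms that by (auto simp: bij_betw_def)
  then have "weight y (map_sptree h ` T) = (\<Sum>p\<in>sig ` T. y ^ tree_rank (map_sptree h (inv_into T sig p)))"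
    by (rule weight_reindex)
  also have "\<dots> = weight y T" unfolding weight_def
    by (rule sum.cong) (auto simp: sig_def[of "inv_into _ _ _"] dest!: f_inv_into_f[of _ sig T] simp del: imp_cong)
  finally show ?thesis .
qed

lemma weight_card:
  assumes "finite E" "card E = m"
  shows "weight y (sp_trees E) = weight y (sp_trees {1..m})"
    "weight y (ser_irred E) = weight y (ser_irred {1..m})"
proof -
  obtain h where h: "bij_betw h {1..m} E" using assms ex_bij_betw_nat_finite_1 by blast
  show "weight y (sp_trees E) = weight y (sp_trees {1..m})"
    unfolding sp_trees_bij[OF h] by (rule weight_bij[OF h]) simp
  have "ser_irred E = map_sptree h ` ser_irred {1..m}"
    unfolding ser_irred_def sp_trees_bij[OF h] by auto
  then show "weight y (ser_irred E) = weight y (ser_irred {1..m})"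
    using weight_bij[OF h, of "ser_irred {1..m}"] by (simp add: ser_irred_def)
qed


lemma weight_Un:
  assumes "finite (sig ` S)" "finite (sig ` T)" "sig ` S \<inter> sig ` T = {}"
  shows "weight y (S \<union> T) = weight y S + weight y T"
  unfolding weight_def image_Un using assms by (rule sum.union_disjoint)

lemma sp_trees_empty [simp]: "sp_trees {} = {}"
  by (simp add: sp_trees_def)

lemma finite_sig_subset: "finite E \<Longrightarrow> T \<subseteq> sp_trees E \<Longrightarrow> finite (sig ` T)"
  by (meson finite_sig finite_subset image_mono)

lemma weight_sp_trees_split:
  assumes "finite E"
  shows "weight y (sp_trees E) = weight y (ser_irred E) + weight y (ser_trees E)"
proof -
  have sub: "ser_irred E \<subseteq> sp_trees E" "ser_trees E \<subseteq> sp_trees E"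
    by (auto simp: ser_irred_def ser_trees_def)
  have "sig s \<noteq> sig t" if "s \<in> ser_irred E" "t \<in> ser_trees E" for s t
    using that conn_Ser_neq[of t s] by (auto simp: ser_irred_def ser_trees_def sig_def sp_trees_def)
  then have "sig ` ser_irred E \<inter> sig ` ser_trees E = {}" by blast
  moreover have "sp_trees E = ser_irred E \<union> ser_trees E" by (auto simp: ser_irred_def ser_trees_def)
  ultimately show ?thesis using weight_Un finite_sig_subset[OF assms] sub by metis
qed

text \<open>Unique factorization as a bijection, with \<open>F\<close> the leaf set of the
  irreducible factor containing \<open>z\<close>. The term \<open>F = E\<close> contributes 0,
  because there is no tree without leaves.\<close>

lemma weight_ser_trees:
  assumes E: "finite E" "z \<in> E"
  shows "weight y (ser_trees E) =
    (\<Sum>F | z \<in> F \<and> F \<subseteq> E. weight y (ser_irred F) * weight y (sp_trees (E - F)))"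
proof -
  define \<F> where "\<F> = {F. z \<in> F \<and> F \<subseteq> E}"
  define B where "B = (SIGMA F:\<F>. sig ` ser_irred F \<times> sig ` sp_trees (E - F))"
  define \<phi> :: "nat set \<times> ((nat set \<Rightarrow> bool) \<times> nat) \<times> ((nat set \<Rightarrow> bool) \<times> nat) \<Rightarrow> (nat set \<Rightarrow> bool) \<times> nat"
    where "\<phi> = (\<lambda>(F, p, q). (\<lambda>I. fst p I \<and> fst q I, snd p + snd q))"
  have \<phi>: "\<phi> (F, sig s, sig t) = sig (Ser s t)" for F s t
    by (auto simp: \<phi>_def sig_def)
  have Ser: "Ser s t \<in> ser_trees E" if "F \<in> \<F>" "s \<in> ser_irred F" "t \<in> sp_trees (E - F)" for F s t
    using that by (auto simp: ser_trees_def sp_trees_def ser_irred_def \<F>_def)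
  have "bij_betw \<phi> B (sig ` ser_trees E)"
  proof (rule bij_betw_imageI)
    show "inj_on \<phi> B"
    proof (rule inj_onI)
      fix a b assume "a \<in> B" "b \<in> B" and eq: "\<phi> a = \<phi> b"
      then obtain F s t F' s' t' where a: "a = (F, sig s, sig t)" "F \<in> \<F>" "s \<in> ser_irred F" "t \<in> sp_trees (E - F)"
        and b: "b = (F', sig s', sig t')" "F' \<in> \<F>" "s' \<in> ser_irred F'" "t' \<in> sp_trees (E - F')"
        unfolding B_def by (auto 4 3)
      have 1: "distinct_leaves (Ser s t)" "distinct_leaves (Ser s' t')"
        using Ser[OF a(2-4)] Ser[OF b(2-4)] unfolding ser_trees_def sp_trees_def by simp_all
      have 2: "conn (Ser s t) = conn (Ser s' t')" using eq by (simp only: a(1) b(1) \<phi>) (simp add: sig_def)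
      have 3: "z \<in> leaves s" "z \<in> leaves s'" "\<not> is_Ser s" "\<not> is_Ser s'"
        using a(2,3) b(2,3) by (auto simp: \<F>_def ser_irred_def sp_trees_def)
      note u = factor_unique[OF 1 2 3]
      have F: "F = F'" using u(1) a(3) b(3) by (auto simp: ser_irred_def sp_trees_def)
      have "sig s = sig s'" using u(2) a(3) b(3) sig_eq_iff[of s F s'] F by (auto simp: ser_irred_def)
      moreover have "sig t = sig t'" using u(3) a(4) b(4) sig_eq_iff[of t "E - F" t'] F by simp
      ultimately show "a = b" using a b F by simp
    qed
    show "\<phi> ` B = sig ` ser_trees E"
    proof (intro equalityI subsetI)
      fix x assume "x \<in> \<phi> ` B"
      then obtain F s t where "x = \<phi> (F, sig s, sig t)" "F \<in> \<F>" "s \<in> ser_irred F" "t \<in> sp_trees (E - F)"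
        unfolding B_def by auto
      then show "x \<in> sig ` ser_trees E" using Ser \<phi> by (metis image_eqI)
    next
      fix x assume "x \<in> sig ` ser_trees E"
      then obtain t where t: "x = sig t" "distinct_leaves t" "leaves t = E" "is_Ser t"
        by (auto simp: ser_trees_def sp_trees_def)
      then obtain s u where su: "distinct_leaves (Ser s u)" "\<not> is_Ser s" "z \<in> leaves s" "leaves (Ser s u) = leaves t"
        "conn (Ser s u) = conn t" "tree_rank (Ser s u) = tree_rank t"
        using factor_exists[of t z] E by blast
      then have "x = \<phi> (leaves s, sig s, sig u)" unfolding \<phi> t(1) by (simp add: sig_def del: tree_rank.simps conn.simps)
      moreover have "leaves s \<in> \<F>" "s \<in> ser_irred (leaves s)" "u \<in> sp_trees (E - leaves s)"
        using su t by (auto simp: \<F>_def ser_irred_def sp_trees_def)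
      ultimately show "x \<in> \<phi> ` B" unfolding B_def by blast
    qed
  qed
  then have "weight y (ser_trees E) = (\<Sum>a\<in>B. y ^ snd (\<phi> a))"
    unfolding weight_def by (rule sum.reindex_bij_betw[symmetric])
  also have "\<dots> = (\<Sum>F\<in>\<F>. \<Sum>a\<in>sig ` ser_irred F \<times> sig ` sp_trees (E - F). y ^ snd (\<phi> (F, a)))"
    unfolding B_def
  proof (subst sum.Sigma)
    show "finite \<F>" unfolding \<F>_def using E by simp
    show "\<forall>F\<in>\<F>. finite (sig ` ser_irred F \<times> sig ` sp_trees (E - F))"
    proof
      fix F assume "F \<in> \<F>"
      then have "finite F" using E finite_subset by (auto simp: \<F>_def)
      then show "finite (sig ` ser_irred F \<times> sig ` sp_trees (E - F))"
        using finite_sig_subset[of F "ser_irred F"] finite_sig[of "E - F"] E by (auto simp: ser_irred_def)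
    qed
  qed (simp add: case_prod_unfold)
  also have "\<dots> = (\<Sum>F\<in>\<F>. weight y (ser_irred F) * weight y (sp_trees (E - F)))"
    unfolding weight_def sum_product sum.cartesian_product
    by (simp add: \<phi>_def case_prod_unfold power_add)
  finally show ?thesis by (simp add: \<F>_def)
qed

lemma sum_Pow_card:
  assumes "finite M"
  shows "(\<Sum>G\<in>Pow M. g (card G)) = (\<Sum>i\<le>card M. of_nat (card M choose i) * (g i :: real))"
proof -
  have "(\<Sum>G\<in>Pow M. g (card G)) = (\<Sum>i\<in>{..card M}. \<Sum>G\<in>{G \<in> Pow M. card G = i}. g (card G))"
    by (rule sum.group[symmetric]) (use assms in \<open>auto intro: card_mono\<close>)
  also have "\<dots> = (\<Sum>i\<le>card M. of_nat (card M choose i) * g i)"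
  proof (rule sum.cong)
    fix i
    have "(\<Sum>G\<in>{G \<in> Pow M. card G = i}. g (card G)) = (\<Sum>G\<in>{G \<in> Pow M. card G = i}. g i)"
      by (rule sum.cong) auto
    then show "(\<Sum>G\<in>{G \<in> Pow M. card G = i}. g (card G)) = of_nat (card M choose i) * g i"
      using n_subsets[OF assms, of i] by (simp add: Pow_def)
  qed simp
  finally show ?thesis .
qed

text \<open>The marked label is \<open>Suc m\<close>, and \<open>i\<close> counts the other labels
  of its factor. The summand \<open>i = m\<close> is 0, its cofactor being empty.\<close>

lemma weight_ser_trees_Suc:
  "weight y (ser_trees {1..Suc m}) =
    (\<Sum>i\<le>m. of_nat (m choose i) * (weight y (ser_irred {1..Suc i}) * weight y (sp_trees {1..m - i})))"
proof -
  let ?E = "{1..Suc m}" and ?M = "{1..m}"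
  have E: "?E = insert (Suc m) ?M" by auto
  have bij: "bij_betw (insert (Suc m)) (Pow ?M) {F. Suc m \<in> F \<and> F \<subseteq> ?E}"
  proof (rule bij_betw_byWitness[where f' = "\<lambda>F. F - {Suc m}"])
    show "\<forall>a\<in>Pow ?M. insert (Suc m) a - {Suc m} = a" by force
    show "\<forall>a'\<in>{F. Suc m \<in> F \<and> F \<subseteq> ?E}. insert (Suc m) (a' - {Suc m}) = a'" by auto
    show "insert (Suc m) ` Pow ?M \<subseteq> {F. Suc m \<in> F \<and> F \<subseteq> ?E}" by auto
    show "(\<lambda>F. F - {Suc m}) ` {F. Suc m \<in> F \<and> F \<subseteq> ?E} \<subseteq> Pow ?M" unfolding E by auto
  qed
  have "weight y (ser_trees ?E) =
    (\<Sum>F | Suc m \<in> F \<and> F \<subseteq> ?E. weight y (ser_irred F) * weight y (sp_trees (?E - F)))"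
    by (rule weight_ser_trees) auto
  also have "\<dots> = (\<Sum>G\<in>Pow ?M. weight y (ser_irred (insert (Suc m) G)) * weight y (sp_trees (?E - insert (Suc m) G)))"
    by (rule sum.reindex_bij_betw[OF bij, symmetric])
  also have "\<dots> = (\<Sum>G\<in>Pow ?M. weight y (ser_irred {1..Suc (card G)}) * weight y (sp_trees {1..m - card G}))"
  proof (rule sum.cong)
    fix G assume "G \<in> Pow ?M"
    then have G: "G \<subseteq> ?M" "finite G" "Suc m \<notin> G" using finite_subset by auto
    have "?E - insert (Suc m) G = ?M - G" using G unfolding E by auto
    moreover have "card (?M - G) = m - card G" using G by (simp add: card_Diff_subset)
    ultimately have "weight y (sp_trees (?E - insert (Suc m) G)) = weight y (sp_trees {1..m - card G})"
      using weight_card(1)[of "?M - G"] by simp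
    moreover have "weight y (ser_irred (insert (Suc m) G)) = weight y (ser_irred {1..Suc (card G)})"
      using G by (intro weight_card(2)) auto
    ultimately show "weight y (ser_irred (insert (Suc m) G)) * weight y (sp_trees (?E - insert (Suc m) G)) =
      weight y (ser_irred {1..Suc (card G)}) * weight y (sp_trees {1..m - card G})" by simp
  qed simp
  also have "\<dots> = (\<Sum>i\<le>m. of_nat (m choose i) * (weight y (ser_irred {1..Suc i}) * weight y (sp_trees {1..m - i})))"
    using sum_Pow_card[of ?M "\<lambda>i. weight y (ser_irred {1..Suc i}) * weight y (sp_trees {1..m - i})"] by simp
  finally show ?thesis .
qed

section \<open>Duality of series and parallel composition\<close>

primrec dual :: "'e sptree \<Rightarrow> 'e sptree" where
  "dual (Leaf e) = Leaf e" | "dual (Ser s t) = Par (dual s) (dual t)" | "dual (Par s t) = Ser (dual s) (dual t)"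

lemma dual_dual [simp]: "dual (dual t) = t"
  by (induction t) auto

lemma leaves_dual [simp]: "leaves (dual t) = leaves t"
  by (induction t) auto

lemma distinct_leaves_dual [simp]: "distinct_leaves (dual t) = distinct_leaves t"
  by (induction t) auto

lemma is_Ser_dual [simp]: "is_Ser (dual t) = is_Par t" "is_Par (dual t) = is_Ser t"
  by (cases t; simp)+

text \<open>De Morgan: \<open>conn\<close> of the dual tree is the Boolean dual, whose true points
  are the sets meeting every path, that is, the cuts.\<close>

lemma conn_dual: "conn (dual t) I \<longleftrightarrow> \<not> conn t (- I)"
  by (induction t) auto

text \<open>The ranks of a matroid and its dual add up to the size of the ground set, here the
  leaves together with the root.\<close>

lemma tree_rank_dual: "distinct_leaves t \<Longrightarrow> tree_rank (dual t) + tree_rank t = Suc (card (leaves t))"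
proof (induction t)
  case (Ser s t)
  have "0 < tree_rank (dual s)" "0 < tree_rank (dual t)" by simp_all
  moreover have "tree_rank (dual s) + tree_rank s = Suc (card (leaves s))"
    "tree_rank (dual t) + tree_rank t = Suc (card (leaves t))" using Ser by simp_all
  moreover have "card (leaves (Ser s t)) = card (leaves s) + card (leaves t)"
    using Ser.prems by (simp add: card_Un_disjoint)
  ultimately show ?case unfolding dual.simps tree_rank.simps by linarith
next
  case (Par s t)
  have "0 < tree_rank s" "0 < tree_rank t" by simp_all
  moreover have "tree_rank (dual s) + tree_rank s = Suc (card (leaves s))"
    "tree_rank (dual t) + tree_rank t = Suc (card (leaves t))" using Par by simp_all
  moreover have "card (leaves (Par s t)) = card (leaves s) + card (leaves t)"
    using Par.prems by (simp add: card_Un_disjoint)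
  ultimately show ?case unfolding dual.simps tree_rank.simps by linarith
qed simp

lemma weight_dual:
  assumes T: "T \<subseteq> sp_trees E" and y: "y \<noteq> 0"
  shows "weight y (dual ` T) = y ^ Suc (card E) * weight (1 / y) T"
proof -
  have "sig s = sig t \<longleftrightarrow> sig (dual s) = sig (dual t)" if "s \<in> T" "t \<in> T" for s t
  proof -
    have st: "s \<in> sp_trees E" "t \<in> sp_trees E" "dual s \<in> sp_trees E" "dual t \<in> sp_trees E"
      using that T by (auto simp: sp_trees_def)
    have "conn s = conn t \<longleftrightarrow> conn (dual s) = conn (dual t)"
      unfolding fun_eq_iff conn_dual by (metis double_complement)
    then show ?thesis using sig_eq_iff st by metis
  qed
  then have "weight y (dual ` T) = (\<Sum>p\<in>sig ` T. y ^ tree_rank (dual (inv_into T sig p)))"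
    by (rule weight_reindex)
  also have "\<dots> = (\<Sum>p\<in>sig ` T. y ^ Suc (card E) * (1 / y) ^ snd p)"
  proof (rule sum.cong)
    fix p assume p: "p \<in> sig ` T"
    define t where "t = inv_into T sig p"
    have t: "t \<in> T" "sig t = p" using p by (auto simp: t_def inv_into_into f_inv_into_f)
    then have "tree_rank (dual t) + snd p = Suc (card E)"
      using tree_rank_dual[of t] T by (auto simp: sig_def sp_trees_def)
    then have "y ^ Suc (card E) = y ^ tree_rank (dual t) * y ^ snd p" by (metis power_add)
    then show "y ^ tree_rank (dual (inv_into T sig p)) = y ^ Suc (card E) * (1 / y) ^ snd p"
      using y by (simp add: t_def[symmetric] power_one_over del: power_Suc)
  qed simp
  also have "\<dots> = y ^ Suc (card E) * weight (1 / y) T" by (simp add: weight_def sum_distrib_left)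
  finally show ?thesis .
qed

definition par_irred :: "nat set \<Rightarrow> nat sptree set" where
  "par_irred E = {t \<in> sp_trees E. \<not> is_Par t}"

definition par_trees :: "nat set \<Rightarrow> nat sptree set" where
  "par_trees E = {t \<in> sp_trees E. is_Par t}"

lemma dual_image:
  "sp_trees E = dual ` sp_trees E" "par_irred E = dual ` ser_irred E" "par_trees E = dual ` ser_trees E"
proof -
  have d: "dual t \<in> sp_trees E \<longleftrightarrow> t \<in> sp_trees E" for t by (simp add: sp_trees_def)
  show "sp_trees E = dual ` sp_trees E" "par_irred E = dual ` ser_irred E" "par_trees E = dual ` ser_trees E"
    unfolding par_irred_def ser_irred_def par_trees_def ser_trees_def
    by (auto simp: d intro!: image_eqI[of _ dual "dual _"])
qed

lemma ser_par_subsets: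
  "ser_irred E \<subseteq> sp_trees E" "ser_trees E \<subseteq> sp_trees E" "par_irred E \<subseteq> sp_trees E" "par_trees E \<subseteq> sp_trees E"
  by (auto simp: ser_irred_def ser_trees_def par_irred_def par_trees_def)

lemma weight_sp_trees_dual: "y \<noteq> 0 \<Longrightarrow> weight y (sp_trees E) = y ^ Suc (card E) * weight (1 / y) (sp_trees E)"
  using weight_dual[OF subset_refl, of y E] dual_image(1)[of E] by simp

lemma weight_par_irred: "y \<noteq> 0 \<Longrightarrow> weight y (par_irred E) = y ^ Suc (card E) * weight (1 / y) (ser_irred E)"
  unfolding dual_image(2) by (rule weight_dual[OF ser_par_subsets(1)])

lemma weight_par_trees: "y \<noteq> 0 \<Longrightarrow> weight y (par_trees E) = y ^ Suc (card E) * weight (1 / y) (ser_trees E)"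
  unfolding dual_image(3) by (rule weight_dual[OF ser_par_subsets(2)])

lemma weight_sp_trees_split':
  assumes "finite E" "y \<noteq> 0"
  shows "weight y (sp_trees E) = weight y (par_irred E) + weight y (par_trees E)"
proof -
  have "weight y (sp_trees E) = y ^ Suc (card E) * (weight (1 / y) (ser_irred E) + weight (1 / y) (ser_trees E))"
    using weight_sp_trees_dual[OF assms(2)] weight_sp_trees_split[OF assms(1), of "1 / y"] by simp
  then show ?thesis unfolding weight_par_irred[OF assms(2)] weight_par_trees[OF assms(2)] by (simp add: distrib_left)
qed

text \<open>The series convolution at \<open>1 / y\<close>, transported by duality. The additional
  \<open>y\<close> on the left makes up for the rank lost in a parallel composition.\<close>

lemma weight_par_trees_Suc:
  assumes "y \<noteq> 0"
  shows "y * weight y (par_trees {1..Suc m}) =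
    (\<Sum>i\<le>m. of_nat (m choose i) * (weight y (par_irred {1..Suc i}) * weight y (sp_trees {1..m - i})))"
proof -
  have "y * weight y (par_trees {1..Suc m}) = (\<Sum>i\<le>m. y ^ (m + 3) * (of_nat (m choose i) *
    (weight (1 / y) (ser_irred {1..Suc i}) * weight (1 / y) (sp_trees {1..m - i}))))"
    unfolding weight_par_trees[OF assms] weight_ser_trees_Suc
    by (simp add: sum_distrib_left power_add eval_nat_numeral algebra_simps)
  also have "\<dots> = (\<Sum>i\<le>m. of_nat (m choose i) * (weight y (par_irred {1..Suc i}) * weight y (sp_trees {1..m - i})))"
  proof (rule sum.cong)
    fix i assume "i \<in> {..m}"
    \<comment> \<open>Dualizing \<open>i + 1\<close> and \<open>m - i\<close> leaves produces the
      exponents \<open>i + 2\<close> and \<open>m - i + 1\<close>; their sum is one more than the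
      exponent \<open>m + 2\<close> for the whole, whence the factor \<open>y\<close>.\<close>
    then have "m + 3 = Suc (Suc i) + Suc (m - i)" by simp
    then have "y ^ (m + 3) = y ^ Suc (Suc i) * y ^ Suc (m - i)" by (metis power_add)
    then show "y ^ (m + 3) * (of_nat (m choose i) *
      (weight (1 / y) (ser_irred {1..Suc i}) * weight (1 / y) (sp_trees {1..m - i}))) =
      of_nat (m choose i) * (weight y (par_irred {1..Suc i}) * weight y (sp_trees {1..m - i}))"
      unfolding weight_par_irred[OF assms] weight_sp_trees_dual[OF assms, of "{1..m - i}"] by simp
  qed simp
  finally show ?thesis .
qed

lemma ser_irred_cases:
  "weight y (ser_irred {1..m}) = weight y (par_trees {1..m}) + (if m = 1 then y else 0)"
proof (cases "m = 1")
  case True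
  have leaf: "sp_trees {1::nat} = {Leaf 1}"
  proof -
    have "t = Leaf 1" if "distinct_leaves t" "leaves t = {1::nat}" for t
    proof (cases t)
      case (Ser a b)
      then have "leaves a \<inter> leaves b = {}" "leaves a \<subseteq> {1}" "leaves b \<subseteq> {1}" using that by auto
      then show ?thesis using leaves_nonempty[of a] leaves_nonempty[of b] by (metis inf.idem subset_singletonD)
    next
      case (Par a b)
      then have "leaves a \<inter> leaves b = {}" "leaves a \<subseteq> {1}" "leaves b \<subseteq> {1}" using that by auto
      then show ?thesis using leaves_nonempty[of a] leaves_nonempty[of b] by (metis inf.idem subset_singletonD)
    qed (use that in auto)
    then show ?thesis by (auto simp: sp_trees_def)
  qed
  have "ser_irred {1} = {Leaf 1}" "par_trees {1} = {}" unfolding ser_irred_def par_trees_def leaf by auto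
  then show ?thesis using True by (simp add: weight_def sig_def)
next
  case False
  have "is_Par t \<longleftrightarrow> \<not> is_Ser t" if "t \<in> sp_trees {1..m}" for t
  proof (cases t)
    case (Leaf e)
    then have "card {1..m} = 1" using that by (metis (mono_tags, lifting) mem_Collect_eq sp_trees_def sptree.set(1) is_singletonI is_singleton_altdef)
    then show ?thesis using False by simp
  qed auto
  then have "ser_irred {1..m} = par_trees {1..m}" by (auto simp: ser_irred_def par_trees_def)
  then show ?thesis using False by simp
qed

section \<open>Exponential generating functions of networks\<close>

definition egf :: "(nat \<Rightarrow> real) \<Rightarrow> real fps" where
  "egf a = Abs_fps (\<lambda>m. a m / fact m)"

lemma egf_deriv_nth: "fps_deriv (egf a) $ m = a (Suc m) / fact m"
  by (simp add: egf_def divide_simps)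

text \<open>Marking a label shifts the index, which differentiates the series. The marked label lies
  in the first factor, so \<open>u\<close> is differentiated and \<open>a\<close> is not.\<close>

lemma egf_product:
  assumes "\<And>m. s (Suc m) = (\<Sum>i\<le>m. of_nat (m choose i) * (u (Suc i) * a (m - i)))"
  shows "fps_deriv (egf s) = fps_deriv (egf u) * egf a"
proof (rule fps_ext)
  fix m
  have "fps_deriv (egf s) $ m = (\<Sum>i\<le>m. of_nat (m choose i) * (u (Suc i) * a (m - i))) / fact m"
    by (simp only: egf_deriv_nth assms)
  also have "\<dots> = (\<Sum>i\<le>m. (u (Suc i) / fact i) * (a (m - i) / fact (m - i)))"
    unfolding sum_divide_distrib by (rule sum.cong) (auto simp: binomial_fact field_simps)
  also have "\<dots> = (fps_deriv (egf u) * egf a) $ m"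
    unfolding fps_mult_nth egf_deriv_nth atLeast0AtMost by (simp add: egf_def)
  finally show "fps_deriv (egf s) $ m = (fps_deriv (egf u) * egf a) $ m" .
qed

lemma weight_egf:
  fixes y :: real
  assumes "y \<noteq> 0"
  defines "N \<equiv> egf (\<lambda>m. weight y (sp_trees {1..m}))"
    and "S \<equiv> egf (\<lambda>m. weight y (ser_trees {1..m}))"
    and "P \<equiv> egf (\<lambda>m. weight y (par_trees {1..m}))"
  shows "N = fps_const y * fps_X + S + P"
    and "fps_deriv S = fps_deriv (N - S) * N"
    and "fps_const y * fps_deriv P = fps_deriv (N - P) * N"
    and "N $ 0 = 0" "S $ 0 = 0" "P $ 0 = 0"
proof -
  have U: "N - S = egf (\<lambda>m. weight y (ser_irred {1..m}))"
    unfolding N_def S_def egf_def by (rule fps_ext) (simp add: weight_sp_trees_split diff_divide_distrib[symmetric])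
  have V: "N - P = egf (\<lambda>m. weight y (par_irred {1..m}))"
    unfolding N_def P_def egf_def using assms(1)
    by (intro fps_ext) (simp add: weight_sp_trees_split' diff_divide_distrib[symmetric])
  have "N - S = P + fps_const y * fps_X"
    unfolding U P_def egf_def ser_irred_cases by (rule fps_ext) (auto simp: fps_X_def)
  then show "N = fps_const y * fps_X + S + P" by (simp add: algebra_simps)
  show "fps_deriv S = fps_deriv (N - S) * N"
    unfolding U unfolding S_def N_def by (rule egf_product) (rule weight_ser_trees_Suc)
  have "fps_const y * fps_deriv P = fps_deriv (egf (\<lambda>m. y * weight y (par_trees {1..m})))"
    by (rule fps_ext) (simp add: P_def egf_def)
  also have "\<dots> = fps_deriv (N - P) * N"
    unfolding V unfolding N_def by (rule egf_product) (rule weight_par_trees_Suc[OF assms(1)])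
  finally show "fps_const y * fps_deriv P = fps_deriv (N - P) * N" .
  show "N $ 0 = 0" "S $ 0 = 0" "P $ 0 = 0"
    by (simp_all add: N_def S_def P_def egf_def weight_def ser_trees_def par_trees_def)
qed

lemma weight_eq_sum_card:
  "weight y (sp_trees {1..m}) = (\<Sum>l\<le>m. of_nat (card (conn ` {t \<in> sp_trees {1..m}. tree_rank t = l})) * y ^ l)"
proof -
  let ?T = "sp_trees {1..m}"
  have fin: "finite (sig ` ?T)" by (rule finite_sig) simp
  have "weight y ?T = (\<Sum>l\<in>{..m}. \<Sum>p\<in>{p \<in> sig ` ?T. snd p = l}. y ^ snd p)"
    unfolding weight_def
    by (rule sum.group[symmetric, OF fin]) (auto simp: sig_def sp_trees_def dest: tree_rank_le)
  also have "\<dots> = (\<Sum>l\<le>m. of_nat (card (conn ` {t \<in> ?T. tree_rank t = l})) * y ^ l)"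
  proof (rule sum.cong)
    fix l
    have "{p \<in> sig ` ?T. snd p = l} = (\<lambda>f. (f, l)) ` conn ` {t \<in> ?T. tree_rank t = l}"
      by (auto simp: sig_def image_iff)
    then have "card {p \<in> sig ` ?T. snd p = l} = card (conn ` {t \<in> ?T. tree_rank t = l})"
      by (simp add: card_image inj_on_def)
    moreover have "(\<Sum>p\<in>{p \<in> sig ` ?T. snd p = l}. y ^ snd p) = (\<Sum>p\<in>{p \<in> sig ` ?T. snd p = l}. y ^ l)"
      by (rule sum.cong) auto
    ultimately show "(\<Sum>p\<in>{p \<in> sig ` ?T. snd p = l}. y ^ snd p) =
      of_nat (card (conn ` {t \<in> ?T. tree_rank t = l})) * y ^ l" by simp
  qed simp
  finally show ?thesis .
qed

section \<open>Derangements by number of cycles\<close>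

text \<open>The recurrence for associated Stirling numbers: the last of \<open>n + 2\<close> points
  has \<open>n + 1\<close> possible successors, and removing it leaves a derangement of the other
  points or, if it lay in a 2-cycle, a derangement of \<open>n\<close> points with one cycle
  fewer.\<close>

fun derangement_num :: "nat \<Rightarrow> nat \<Rightarrow> nat" where
  "derangement_num 0 0 = 1"
| "derangement_num 0 (Suc k) = 0"
| "derangement_num (Suc 0) k = 0"
| "derangement_num (Suc (Suc n)) 0 = Suc n * derangement_num (Suc n) 0"
| "derangement_num (Suc (Suc n)) (Suc k) = Suc n * (derangement_num (Suc n) (Suc k) + derangement_num n k)"

lemma derangement_num_eq_0: "n < 2 * k \<Longrightarrow> derangement_num n k = 0"
  by (induction n k rule: derangement_num.induct) auto

lemma derangement_num_0_right: "0 < n \<Longrightarrow> derangement_num n 0 = 0"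
  by (induction n "0::nat" rule: derangement_num.induct) auto

text \<open>\<open>X\<close> is the exact set of fixed points. Besides \<open>X = {}\<close> a
  singleton is needed, for the permutation left after cutting a point out of a 2-cycle.\<close>

definition perms_fixing :: "nat set \<Rightarrow> nat set \<Rightarrow> nat \<Rightarrow> (nat \<Rightarrow> nat) set" where
  "perms_fixing A X k = {p. p permutes A \<and> {i\<in>A. p i = i} = X \<and> card (orbit p ` A) = k}"

context
  fixes A :: "nat set" and z b q p
  assumes A: "finite A" "z \<notin> A" "b \<in> A" and q: "q permutes A" and p_def: "p = transpose z b \<circ> q"
begin

lemma insert_cycle_permutes: "p permutes insert z A"
  unfolding p_def using q A by (intro permutes_compose permutes_swap_id) (auto intro: permutes_subset)

text \<open>Composing with the transposition inserts \<open>z\<close> into the cycle of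
  \<open>b\<close>, immediately in front of \<open>b\<close>.\<close>

lemma insert_cycle_apply: "p z = b" "x \<in> A \<Longrightarrow> p x = (if q x = b then z else q x)"
proof -
  have "q z = z" using q A by (simp add: permutes_not_in)
  then show "p z = b" by (simp add: p_def)
  assume "x \<in> A"
  then have "q x \<in> A" using q by (simp add: permutes_in_image)
  then have "q x \<noteq> z" using A(2) by blast
  then show "p x = (if q x = b then z else q x)" unfolding p_def comp_apply transpose_def by presburger
qed

lemma insert_cycle_fixed: "{i \<in> insert z A. p i = i} = {i \<in> A. q i = i} - {b}"
proof -
  have "p i = i \<longleftrightarrow> q i = i \<and> i \<noteq> b" if "i \<in> A" for i
  proof -
    have "i \<noteq> z" using that A(2) by blast
    then show ?thesis unfolding insert_cycle_apply(2)[OF that] by simp metis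
  qed
  moreover have "p z \<noteq> z" unfolding insert_cycle_apply(1) using A by metis
  ultimately show ?thesis by blast
qed

text \<open>One step of \<open>q\<close> is one step of \<open>p\<close>, or two steps if the detour
  through \<open>z\<close> is taken.\<close>

lemma orbit_subset_insert_cycle: "y \<in> A \<Longrightarrow> x \<in> orbit q y \<Longrightarrow> x \<in> A \<and> x \<in> orbit p y"
proof -
  assume y: "y \<in> A" and x: "x \<in> orbit q y"
  have advance: "q v \<in> A \<and> q v \<in> orbit p y" if "v \<in> A" "p v \<in> orbit p y" for v
  proof
    show "q v \<in> A" using that(1) q by (simp add: permutes_in_image)
    show "q v \<in> orbit p y"
    proof (cases "q v = b")
      case True
      then have "p (p v) = q v" using insert_cycle_apply that(1) by metis
      then show ?thesis using orbit.step[OF that(2)] by metis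
    next
      case False
      then show ?thesis using that insert_cycle_apply(2) by metis
    qed
  qed
  from x show ?thesis
  proof (induction rule: orbit.induct)
    case base
    then show ?case by (rule advance[OF y orbit.base])
  next
    case (step v)
    then show ?case by (intro advance orbit.step) simp_all
  qed
qed

text \<open>At the detour point \<open>z\<close>, which \<open>q\<close> does not visit, the
  induction has to remember that the next point \<open>b\<close> already lies in the orbit of
  \<open>q\<close>; hence the second conjunct.\<close>

lemma orbit_insert_cycle_subset: "y \<in> A \<Longrightarrow> x \<in> orbit p y \<Longrightarrow> (x \<in> A \<longrightarrow> x \<in> orbit q y) \<and> (x = z \<longrightarrow> b \<in> orbit q y) \<and> x \<in> insert z A"
proof -
  assume y: "y \<in> A" and x: "x \<in> orbit p y"
  have *: "(p v \<in> A \<longrightarrow> p v \<in> orbit q y) \<and> (p v = z \<longrightarrow> b \<in> orbit q y) \<and> p v \<in> insert z A"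
    if "v \<in> A" "q v \<in> orbit q y" for v
  proof -
    have "q v \<in> A" using that(1) q by (simp add: permutes_in_image)
    then show ?thesis using that(2) A insert_cycle_apply(2)[OF that(1)] by auto
  qed
  from x show ?thesis
  proof (induction rule: orbit.induct)
    case base
    then show ?case using *[OF y orbit.base] by simp
  next
    case (step v)
    show ?case
    proof (cases "v = z")
      case True
      then have "p v = b" using insert_cycle_apply(1) by simp
      then show ?thesis using step True A by auto
    next
      case False
      then have "v \<in> A" "v \<in> orbit q y" using step by auto
      then show ?thesis by (intro * orbit.step)
    qed
  qed
qed

lemma card_orbits_insert_cycle: "card (orbit p ` insert z A) = card (orbit q ` A)"
proof -
  have p: "permutation p" unfolding permutation_permutes
    by (rule exI[of _ "insert z A"]) (simp add: A(1) insert_cycle_permutes)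
  have pq: "permutation q" unfolding permutation_permutes by (rule exI[of _ A]) (simp add: A(1) q)
  have eqI: "orbit f x = orbit f y" if "permutation f" "x \<in> orbit f y" for f :: "nat \<Rightarrow> nat" and x y
    by (rule orbit_cyclic_eq3[OF cyclic_on_orbit'[OF that(1)] that(2)])
  have "b \<in> orbit p z" using orbit.base[of p z] insert_cycle_apply(1) by simp
  then have "orbit p z = orbit p b" using eqI[OF p] by simp
  then have "orbit p ` insert z A = orbit p ` A" using A by auto
  moreover have "card (orbit p ` A) = card (orbit q ` A)"
  proof (rule card_image_eq_card_image)
    fix x y assume xy: "x \<in> A" "y \<in> A"
    show "orbit p x = orbit p y \<longleftrightarrow> orbit q x = orbit q y"
    proof
      assume "orbit p x = orbit p y"
      then have "x \<in> orbit p y" using permutation_self_in_orbit[OF p, of x] by simp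
      then have "x \<in> orbit q y" using orbit_insert_cycle_subset[OF xy(2)] xy by blast
      then show "orbit q x = orbit q y" by (rule eqI[OF pq])
    next
      assume "orbit q x = orbit q y"
      then have "x \<in> orbit q y" using permutation_self_in_orbit[OF pq, of x] by simp
      then have "x \<in> orbit p y" using orbit_subset_insert_cycle[OF xy(2)] by blast
      then show "orbit p x = orbit p y" by (rule eqI[OF p])
    qed
  qed
  ultimately show ?thesis by simp
qed

end

lemma finite_perms_fixing: "finite A \<Longrightarrow> finite (perms_fixing A X k)"
  unfolding perms_fixing_def by (rule finite_subset[OF _ finite_permutations]) auto

text \<open>
  Cutting \<open>z\<close> out of its cycle leaves a permutation that can only fix the successor \<open>b\<close> of \<open>z\<close>, and it
  does so if \<open>z\<close> lies in a 2-cycle.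
\<close>

lemma perms_fixing_insert:
  assumes A: "finite A" "z \<notin> A"
  shows "perms_fixing (insert z A) {} k =
    (\<lambda>(b, q). transpose z b \<circ> q) ` (SIGMA b:A. perms_fixing A {} k \<union> perms_fixing A {b} k)"
proof (intro equalityI subsetI)
  fix p assume p: "p \<in> perms_fixing (insert z A) {} k"
  then have "p permutes insert z A" "p z \<noteq> z" by (auto simp: perms_fixing_def)
  then obtain b q where bq: "p = transpose z b \<circ> q" "b \<in> insert z A" "q permutes A"
  proof -
    have "p \<in> (\<lambda>(b, q). transpose z b \<circ> q) ` {(b, q). b \<in> insert z A \<and> q \<in> {q. q permutes A}}"
      using \<open>p permutes insert z A\<close> unfolding permutes_insert[symmetric] by simp
    then show ?thesis using that by auto
  qed
  have "q z = z" using bq(3) A by (simp add: permutes_not_in)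
  then have b: "b \<in> A" using bq \<open>p z \<noteq> z\<close> by auto
  note facts = insert_cycle_fixed[OF A b bq(3,1)] card_orbits_insert_cycle[OF A b bq(3,1)]
  have "{i \<in> A. q i = i} - {b} = {}" "card (orbit q ` A) = k"
    using facts p by (auto simp: perms_fixing_def)
  then have "q \<in> perms_fixing A {} k \<union> perms_fixing A {b} k"
    using bq(3) by (auto simp: perms_fixing_def)
  then show "p \<in> (\<lambda>(b, q). transpose z b \<circ> q) ` (SIGMA b:A. perms_fixing A {} k \<union> perms_fixing A {b} k)"
    using bq b by (intro image_eqI[of _ _ "(b, q)"]) auto
next
  fix p assume "p \<in> (\<lambda>(b, q). transpose z b \<circ> q) ` (SIGMA b:A. perms_fixing A {} k \<union> perms_fixing A {b} k)"
  then obtain b q where bq: "p = transpose z b \<circ> q" "b \<in> A" "q \<in> perms_fixing A {} k \<union> perms_fixing A {b} k"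
    by auto
  then have q: "q permutes A" by (auto simp: perms_fixing_def)
  show "p \<in> perms_fixing (insert z A) {} k"
    using insert_cycle_fixed[OF A bq(2) q bq(1)] card_orbits_insert_cycle[OF A bq(2) q bq(1)]
      insert_cycle_permutes[OF A bq(2) q bq(1)] bq(3)
    unfolding perms_fixing_def by auto
qed

lemma inj_on_insert_cycle:
  fixes A :: "nat set"
  assumes "z \<notin> A"
  shows "inj_on (\<lambda>(b, q). transpose z b \<circ> q) (A \<times> {q. q permutes A})"
proof (rule inj_onI, clarsimp)
  fix b q b' q' assume q: "q permutes A" "q' permutes A" and eq: "transpose z b \<circ> q = transpose z b' \<circ> q'"
  have "q z = z" "q' z = z" using q assms by (auto simp: permutes_not_in)
  then have b: "b = b'" using fun_cong[OF eq, of z] by simp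
  have inv: "transpose z b \<circ> (transpose z b \<circ> r) = r" for r :: "nat \<Rightarrow> nat" by (simp add: fun_eq_iff)
  have "q = q'" using inv[of q] inv[of q'] eq b by metis
  then show "b = b' \<and> q = q'" using b by simp
qed

text \<open>Discarding the fixed point \<open>b\<close> removes exactly the orbit
  \<open>{b}\<close>, so the number of cycles drops by one and cannot have been 0.\<close>

lemma perms_fixing_one:
  assumes "finite A" "b \<in> A"
  shows "perms_fixing A {b} k = (case k of 0 \<Rightarrow> {} | Suc j \<Rightarrow> perms_fixing (A - {b}) {} j)"
proof -
  have eq: "p permutes A \<and> {i\<in>A. p i = i} = {b} \<longleftrightarrow> p permutes (A - {b}) \<and> {i\<in>A - {b}. p i = i} = {}" for p
  proof (intro iffI conjI)
    assume p: "p permutes A \<and> {i\<in>A. p i = i} = {b}"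
    then have "p b = b" by blast
    then have "p x = x" if "x \<in> A - (A - {b})" for x using that by simp
    with conjunct1[OF p] show "p permutes (A - {b})" by (rule permutes_superset)
    show "{i\<in>A - {b}. p i = i} = {}" using conjunct2[OF p] by blast
  next
    assume p: "p permutes (A - {b}) \<and> {i\<in>A - {b}. p i = i} = {}"
    show "p permutes A" by (rule permutes_subset[OF conjunct1[OF p]]) blast
    have "p b = b" by (rule permutes_not_in[OF conjunct1[OF p]]) simp
    then show "{i\<in>A. p i = i} = {b}" using conjunct2[OF p] assms(2) by blast
  qed
  have card: "card (orbit p ` A) = Suc (card (orbit p ` (A - {b})))" if p: "p permutes (A - {b})" for p
  proof -
    have "orbit p b = {b}" using p by (simp add: orbit_eq_singleton_iff permutes_not_in)
    then have "orbit p ` A = insert {b} (orbit p ` (A - {b}))" using assms by (auto simp: image_iff)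
    moreover have "{b} \<notin> orbit p ` (A - {b})"
    proof
      assume "{b} \<in> orbit p ` (A - {b})"
      then obtain x where "x \<in> A - {b}" "orbit p x = {b}" by auto
      moreover have "x \<in> orbit p x"
        using p assms by (intro permutation_self_in_orbit) (meson finite_Diff permutation_permutes)
      ultimately show False by auto
    qed
    ultimately show ?thesis using assms by simp
  qed
  have "p \<in> perms_fixing A {b} k \<longleftrightarrow> p \<in> (case k of 0 \<Rightarrow> {} | Suc j \<Rightarrow> perms_fixing (A - {b}) {} j)" for p
  proof -
    have "p \<in> perms_fixing A {b} k \<longleftrightarrow> (p permutes A \<and> {i\<in>A. p i = i} = {b}) \<and> card (orbit p ` A) = k"
      unfolding perms_fixing_def mem_Collect_eq by (rule conj_assoc[symmetric])
    also have "\<dots> \<longleftrightarrow> (p permutes (A - {b}) \<and> {i\<in>A - {b}. p i = i} = {}) \<and> Suc (card (orbit p ` (A - {b}))) = k"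
      unfolding eq using card[of p] by metis
    also have "\<dots> \<longleftrightarrow> p \<in> (case k of 0 \<Rightarrow> {} | Suc j \<Rightarrow> perms_fixing (A - {b}) {} j)"
      unfolding perms_fixing_def by (cases k) simp_all
    finally show ?thesis .
  qed
  then show ?thesis by blast
qed

lemma card_perms_fixing:
  assumes "finite A"
  shows "card (perms_fixing A {} k) = derangement_num (card A) k"
  using assms
proof (induction "card A" arbitrary: A k rule: less_induct)
  case less
  show ?case
  proof (cases "A = {}")
    case True
    then have "perms_fixing A {} k = (if k = 0 then {id} else {})" by (auto simp: perms_fixing_def)
    then show ?thesis using True by (cases k) auto
  next
    case False
    then obtain z B where A: "A = insert z B" "z \<notin> B" "finite B" using less.prems by (metis Set.set_insert ex_in_conv finite_insert)
    let ?S = "\<lambda>b. perms_fixing B {} k \<union> perms_fixing B {b} k"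
    have B: "card B < card A" using A by simp
    have "inj_on (\<lambda>(b, q). transpose z b \<circ> q) (SIGMA b:B. ?S b)"
      by (rule inj_on_subset[OF inj_on_insert_cycle[OF A(2)]]) (auto simp: perms_fixing_def)
    then have "card (perms_fixing A {} k) = card (SIGMA b:B. ?S b)"
      unfolding A(1) perms_fixing_insert[OF A(3,2)] by (rule card_image)
    also have "\<dots> = (\<Sum>b\<in>B. card (?S b))"
      using A(3) by (intro card_SigmaI) (simp_all add: finite_perms_fixing)
    also have "\<dots> = (\<Sum>b\<in>B. derangement_num (card B) k + (case k of 0 \<Rightarrow> 0 | Suc j \<Rightarrow> derangement_num (card B - 1) j))"
    proof (rule sum.cong)
      fix b assume b: "b \<in> B"
      have "perms_fixing B {} k \<inter> perms_fixing B {b} k = {}" by (auto simp: perms_fixing_def)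
      then have "card (?S b) = card (perms_fixing B {} k) + card (perms_fixing B {b} k)"
        by (intro card_Un_disjoint finite_perms_fixing A(3))
      moreover have "card (perms_fixing B {} k) = derangement_num (card B) k" using less.hyps[OF B A(3)] .
      moreover have "card (perms_fixing B {b} k) = (case k of 0 \<Rightarrow> 0 | Suc j \<Rightarrow> derangement_num (card B - 1) j)"
      proof (cases k)
        case 0
        then show ?thesis by (simp add: perms_fixing_one[OF A(3) b])
      next
        case (Suc j)
        have "card (B - {b}) < card A" using B b A(3) by (simp add: card_Diff_singleton)
        then have "card (perms_fixing (B - {b}) {} j) = derangement_num (card (B - {b})) j"
          using less.hyps A(3) by simp
        then show ?thesis using Suc b A(3) by (simp add: perms_fixing_one[OF A(3) b])
      qed
      ultimately show "card (?S b) = derangement_num (card B) k + (case k of 0 \<Rightarrow> 0 | Suc j \<Rightarrow> derangement_num (card B - 1) j)"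
        by simp
    qed simp
    \<comment> \<open>For \<open>card B = 0\<close> the sum over \<open>B\<close> is empty and
      agrees with the vanishing \<open>derangement_num 1 k\<close>; otherwise
      \<open>card B - 1\<close> is not truncated.\<close>
    also have "\<dots> = derangement_num (Suc (card B)) k"
      by (cases "card B"; cases k) (auto simp: algebra_simps)
    finally show ?thesis using A by simp
  qed
qed

lemma assoc_stirling_eq: "assoc_stirling n k = derangement_num n k"
proof -
  have "{p. p permutes {1..n} \<and> (\<forall>i\<in>{1..n}. p i \<noteq> i) \<and> card (orbit p ` {1..n}) = k} = perms_fixing {1..n} {} k"
    by (auto simp: perms_fixing_def)
  then show ?thesis using card_perms_fixing[of "{1..n}" k] by (simp add: assoc_stirling_def)
qed

section \<open>Lagrange inversion\<close>

text \<open>Since \<open>b ^ i\<close> has no coefficients below \<open>i\<close>, the composition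
  can be cut off at the same bound \<open>n\<close> for all coefficients entering the
  product.\<close>

lemma fps_compose_mult_nth:
  fixes a b c :: "'a :: idom fps"
  assumes "b $ 0 = 0"
  shows "((a oo b) * c) $ n = (\<Sum>i\<le>n. a $ i * (b ^ i * c) $ n)"
proof -
  have "(a oo b) $ j = (\<Sum>i\<le>n. a $ i * (b ^ i) $ j)" if "j \<le> n" for j
  proof -
    have "(a oo b) $ j = (\<Sum>i\<in>{0..j}. a $ i * (b ^ i) $ j)" by (rule fps_compose_nth)
    also have "\<dots> = (\<Sum>i\<in>{..n}. a $ i * (b ^ i) $ j)"
      by (rule sum.mono_neutral_left) (use that startsby_zero_power_prefix[OF assms] in auto)
    finally show ?thesis .
  qed
  then have "((a oo b) * c) $ n = (\<Sum>j\<in>{0..n}. (\<Sum>i\<le>n. a $ i * (b ^ i) $ j) * c $ (n - j))"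
    unfolding fps_mult_nth by (intro sum.cong) auto
  also have "\<dots> = (\<Sum>j\<in>{0..n}. \<Sum>i\<le>n. a $ i * ((b ^ i) $ j * c $ (n - j)))"
    by (simp add: sum_distrib_right mult.assoc)
  also have "\<dots> = (\<Sum>i\<le>n. \<Sum>j\<in>{0..n}. a $ i * ((b ^ i) $ j * c $ (n - j)))" by (rule sum.swap)
  also have "\<dots> = (\<Sum>i\<le>n. a $ i * (b ^ i * c) $ n)" by (simp add: fps_mult_nth sum_distrib_left)
  finally show ?thesis .
qed

text \<open>By linearity in \<open>g \<circ> w\<close> it suffices to treat \<open>g = f ^ i\<close>, where the coefficient of \<open>f' * p ^ Suc j\<close> at
  \<open>j\<close> vanishes for \<open>j > 0\<close> because \<open>f' * p = 1 - f * p'\<close>.\<close>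

lemma lagrange_inversion:
  fixes f g p w :: "'a :: field_char_0 fps"
  assumes fw: "f oo w = fps_X" "w oo f = fps_X" "f $ 0 = 0" "w $ 0 = 0" and fp: "f * p = fps_X"
  shows "of_nat (Suc n) * (g oo w) $ Suc n = (fps_deriv g * p ^ Suc n) $ n"
proof -
  define H where "H = g oo w"
  have "H oo f = g oo (w oo f)" unfolding H_def using fps_compose_assoc[OF fw(3,4), of g] by simp
  then have g: "g = H oo f" by (simp add: fw)
  have d: "fps_deriv f * p = 1 - f * fps_deriv p"
  proof -
    have "fps_deriv f * p + f * fps_deriv p = 1"
      using arg_cong[OF fp, of fps_deriv] by (simp add: algebra_simps)
    then show ?thesis by (simp add: algebra_simps)
  qed
  have res: "(fps_deriv f * p ^ Suc j) $ j = (if j = 0 then 1 else 0)" for j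
  proof (cases j)
    case 0
    then show ?thesis using d fw(3) by simp
  next
    case (Suc k)
    have "fps_deriv f * p ^ Suc j = (fps_deriv f * p) * p ^ j" by (simp add: algebra_simps)
    also have "\<dots> = p ^ j - (f * p) * (fps_deriv p * p ^ k)" unfolding d Suc by (simp add: algebra_simps)
    finally have "fps_deriv f * p ^ Suc j = p ^ j - fps_X * (fps_deriv p * p ^ k)" unfolding fp .
    then have "(fps_deriv f * p ^ Suc j) $ j = (p ^ j) $ j - (fps_deriv p * p ^ k) $ k"
      by (simp only: fps_sub_nth) (simp add: Suc del: power_Suc)
    then have "of_nat j * (fps_deriv f * p ^ Suc j) $ j = of_nat j * (p ^ j) $ j - of_nat j * (fps_deriv p * p ^ k) $ k"
      by (simp only: right_diff_distrib)
    also have "of_nat j * (fps_deriv p * p ^ k) $ k = (fps_deriv (p ^ j)) $ k"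
      unfolding fps_deriv_power Suc diff_Suc_1 mult.assoc by (rule fps_mult_left_const_nth[symmetric])
    also have "\<dots> = of_nat j * (p ^ j) $ j" by (simp add: Suc del: power_Suc of_nat_Suc)
    finally show ?thesis using Suc by (simp del: of_nat_Suc power_Suc)
  qed
  have "fps_deriv g * p ^ Suc n = (fps_deriv H oo f) * (fps_deriv f * p ^ Suc n)"
    unfolding g fps_compose_deriv[OF fw(3)] by (simp add: mult.assoc)
  then have "(fps_deriv g * p ^ Suc n) $ n = (\<Sum>i\<le>n. fps_deriv H $ i * (f ^ i * (fps_deriv f * p ^ Suc n)) $ n)"
    using fps_compose_mult_nth[OF fw(3), of "fps_deriv H" "fps_deriv f * p ^ Suc n" n] by (simp only:)
  also have "\<dots> = (\<Sum>i\<le>n. if i = n then fps_deriv H $ i else 0)"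
  proof (rule sum.cong)
    fix i assume "i \<in> {..n}"
    then have i: "i \<le> n" "Suc n = i + Suc (n - i)" by auto
    have "p ^ Suc n = p ^ i * p ^ Suc (n - i)" by (subst i(2)) (rule power_add)
    then have "f ^ i * (fps_deriv f * p ^ Suc n) = (f * p) ^ i * (fps_deriv f * p ^ Suc (n - i))"
      by (simp only: power_mult_distrib mult_ac)
    then have "(f ^ i * (fps_deriv f * p ^ Suc n)) $ n = (fps_deriv f * p ^ Suc (n - i)) $ (n - i)"
      unfolding fp by (simp only: fps_X_power_mult_nth) (use i(1) in simp)
    then show "fps_deriv H $ i * (f ^ i * (fps_deriv f * p ^ Suc n)) $ n = (if i = n then fps_deriv H $ i else 0)"
      unfolding res using i(1) by auto
  qed simp
  also have "\<dots> = of_nat (Suc n) * H $ Suc n" by simp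
  finally show ?thesis by (simp add: H_def)
qed

text \<open>Lagrange inversion for \<open>f = X - \<phi>\<close>. Writing
  \<open>\<phi> = X \<psi>\<close> gives \<open>p = 1 / (1 - \<psi>)\<close>, whose power
  \<open>n + 1\<close> expands by the negative binomial series. Returning from
  \<open>\<psi> ^ k\<close> to \<open>\<phi> ^ k\<close> moves the coefficient from \<open>n\<close>
  to \<open>n + k\<close>. As \<open>\<psi>\<close> vanishes at 0, the sum stops at
  \<open>k = n\<close>.\<close>

lemma lagrange_perturbation:
  fixes \<phi> g w :: "real fps"
  assumes \<phi>: "\<phi> $ 0 = 0" "\<phi> $ 1 = 0" and w: "w = fps_X + (\<phi> oo w)" "w $ 0 = 0"
  shows "fact (Suc n) * (g oo w) $ Suc n = (\<Sum>k\<le>n. fact (n + k) / fact k * (fps_deriv g * \<phi> ^ k) $ (n + k))"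
proof -
  define f where "f = fps_X - \<phi>"
  have f: "f $ 0 = 0" "f $ 1 \<noteq> 0" using \<phi> by (auto simp: f_def)
  have fw: "f oo w = fps_X" using w by (simp add: f_def fps_compose_sub_distrib algebra_simps)
  \<comment> \<open>The left inverse \<open>fps_inv f\<close> and the right inverse \<open>w\<close>
    of \<open>f\<close> coincide, so \<open>w\<close> is two-sided.\<close>
  have "w = fps_X oo w" using w by simp
  also have "\<dots> = (fps_inv f oo f) oo w" using fps_inv[OF f] by simp
  also have "\<dots> = fps_inv f oo (f oo w)" by (rule fps_compose_assoc[OF w(2) f(1), symmetric])
  also have "\<dots> = fps_inv f" by (simp add: fw)
  finally have wf: "w oo f = fps_X" using fps_inv[OF f] by simp
  define \<psi> where "\<psi> = fps_shift 1 \<phi>"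
  have \<phi>\<psi>: "\<phi> = fps_X * \<psi>" using \<phi> by (intro fps_ext) (simp add: \<psi>_def fps_X_mult_nth)
  have \<psi>0: "\<psi> $ 0 = 0" using \<phi> by (simp add: \<psi>_def)
  define p where "p = inverse (1 - \<psi>)"
  have "f * p = fps_X"
  proof -
    have "(1 - \<psi>) * p = 1" unfolding p_def by (rule inverse_mult_eq_1') (simp add: \<psi>0)
    moreover have "f = fps_X * (1 - \<psi>)" by (simp add: f_def \<phi>\<psi> algebra_simps)
    ultimately show ?thesis by (metis mult.assoc mult.right_neutral)
  qed
  note inversion = lagrange_inversion[OF fw wf f(1) w(2) this, where n = n and g = g]
  define a :: "real fps" where "a = Abs_fps (\<lambda>k. of_nat ((Suc n + k - 1) choose k))"
  have a: "a = inverse (1 - fps_X) ^ Suc n"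
    using one_minus_const_fps_X_neg_power'[of "Suc n" "1::real"]
    by (simp add: a_def fps_inverse_power del: power_Suc)
  have p: "p ^ Suc n = a oo \<psi>"
  proof -
    have "inverse (1 - fps_X) oo \<psi> = p"
      unfolding p_def using \<psi>0 by (simp add: fps_inverse_compose fps_compose_sub_distrib)
    then show ?thesis unfolding a using fps_compose_power[OF \<psi>0] by metis
  qed
  have "(fps_deriv g * p ^ Suc n) $ n = (\<Sum>k\<le>n. a $ k * (\<psi> ^ k * fps_deriv g) $ n)"
    unfolding p by (subst mult.commute) (rule fps_compose_mult_nth[OF \<psi>0])
  also have "\<dots> = (\<Sum>k\<le>n. of_nat ((n + k) choose k) * (fps_deriv g * \<phi> ^ k) $ (n + k))"
  proof (rule sum.cong)
    fix k
    have "fps_deriv g * \<phi> ^ k = fps_X ^ k * (\<psi> ^ k * fps_deriv g)"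
      by (simp add: \<phi>\<psi> power_mult_distrib algebra_simps)
    then have "(fps_deriv g * \<phi> ^ k) $ (n + k) = (\<psi> ^ k * fps_deriv g) $ n"
      by (simp only: fps_X_power_mult_nth) simp
    then show "a $ k * (\<psi> ^ k * fps_deriv g) $ n = of_nat ((n + k) choose k) * (fps_deriv g * \<phi> ^ k) $ (n + k)"
      by (simp add: a_def)
  qed simp
  finally have "fact (Suc n) * (g oo w) $ Suc n =
      fact n * (\<Sum>k\<le>n. of_nat ((n + k) choose k) * (fps_deriv g * \<phi> ^ k) $ (n + k))"
    using inversion by simp
  also have "\<dots> = (\<Sum>k\<le>n. fact (n + k) / fact k * (fps_deriv g * \<phi> ^ k) $ (n + k))"
    unfolding sum_distrib_left by (rule sum.cong) (auto simp: binomial_fact)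
  finally show ?thesis .
qed

section \<open>Powers of \<open>X - ln (1 + X)\<close> and of \<open>exp - 1\<close>\<close>

definition x_minus_ln :: "real fps" where
  "x_minus_ln = fps_X - fps_ln 1"

lemma x_minus_ln_deriv: "(1 + fps_X) * fps_deriv x_minus_ln = fps_X"
proof -
  have "(1 + fps_X) * inverse (1 + fps_X :: real fps) = 1" by (rule inverse_mult_eq_1') simp
  then show ?thesis by (simp add: x_minus_ln_def fps_ln_deriv right_diff_distrib)
qed

lemma x_minus_ln_nth_0 [simp]: "x_minus_ln $ 0 = 0"
  by (simp add: x_minus_ln_def fps_ln_def)

lemma x_minus_ln_nth_1 [simp]: "x_minus_ln $ Suc 0 = 0"
  by (simp add: x_minus_ln_def fps_ln_def)

lemma one_plus_mult_cancel:
  fixes N :: "real fps"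
  assumes "(1 + N) * a = (1 + N) * b" "N $ 0 = 0"
  shows "a = b"
proof -
  have "(1 + N) $ 0 \<noteq> 0" using assms(2) by simp
  then have "1 + N \<noteq> 0" by (metis fps_zero_nth)
  then show ?thesis using assms(1) by simp
qed

text \<open>At \<open>-X\<close> the series \<open>x_minus_ln\<close> counts cycles of length at
  least 2, so its powers count derangements and the sign is \<open>(-1) ^ n\<close>. In the proof,
  the recurrence of \<open>derangement_num\<close> becomes \<open>(1 + X) E' = X F\<close> for
  consecutive \<open>k\<close>, which the powers divided by \<open>fact k\<close> satisfy as well;
  the constant terms agree.\<close>

lemma x_minus_ln_power: "x_minus_ln ^ k = fps_const (fact k) * Abs_fps (\<lambda>n. of_nat (derangement_num n k) * (-1) ^ n / fact n)"
proof (induction k)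
  case 0
  have "derangement_num n 0 = (if n = 0 then 1 else 0)" for n by (simp add: derangement_num_0_right)
  then show ?case by (intro fps_ext) simp
next
  case (Suc k)
  define E where "E = (\<lambda>k. Abs_fps (\<lambda>n. of_nat (derangement_num n k) * (-1) ^ n / fact n :: real))"
  have E: "(1 + fps_X) * fps_deriv (E (Suc k)) = fps_X * E k"
  proof (rule fps_ext)
    fix n
    show "((1 + fps_X) * fps_deriv (E (Suc k))) $ n = (fps_X * E k) $ n"
    proof (cases n)
      case 0
      then show ?thesis by (simp add: E_def distrib_right)
    next
      case (Suc m)
      have c: "real (Suc i) / fact (Suc i) = 1 / fact i" for i by (simp del: of_nat_Suc)
      have d1: "fps_deriv (E (Suc k)) $ i = of_nat (derangement_num (Suc i) (Suc k)) * (-1) ^ Suc i / fact i" for i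
        using c[of i] by (simp add: E_def field_simps del: of_nat_Suc fact_Suc)
      have "((1 + fps_X) * fps_deriv (E (Suc k))) $ n =
        fps_deriv (E (Suc k)) $ Suc m + fps_deriv (E (Suc k)) $ m"
        using Suc by (simp only: distrib_right mult_1_left fps_add_nth) simp
      also have "\<dots> = of_nat (derangement_num m k) * (-1) ^ m / fact m"
        unfolding d1 derangement_num.simps by (simp add: field_simps del: of_nat_Suc mult_Suc)
      finally show ?thesis using Suc by (simp add: E_def)
    qed
  qed
  have IH: "x_minus_ln ^ k = fps_const (fact k) * E k" using Suc by (simp add: E_def)
  have "(1 + fps_X) * fps_deriv (x_minus_ln ^ Suc k) = of_nat (Suc k) * ((1 + fps_X) * fps_deriv x_minus_ln) * x_minus_ln ^ k"
    unfolding fps_deriv_power' by (simp add: algebra_simps del: power_Suc)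
  also have "\<dots> = of_nat (Suc k) * fps_const (fact k) * (fps_X * E k)"
    unfolding x_minus_ln_deriv IH by (simp add: algebra_simps)
  also have "\<dots> = (1 + fps_X) * fps_deriv (fps_const (fact (Suc k)) * E (Suc k))"
    unfolding E[symmetric] by (simp add: fps_of_nat[symmetric] algebra_simps del: of_nat_Suc)
  finally have "fps_deriv (x_minus_ln ^ Suc k) = fps_deriv (fps_const (fact (Suc k)) * E (Suc k))"
    by (rule one_plus_mult_cancel) simp
  then have "x_minus_ln ^ Suc k = fps_const ((x_minus_ln ^ Suc k) $ 0 - (fps_const (fact (Suc k)) * E (Suc k)) $ 0) + fps_const (fact (Suc k)) * E (Suc k)"
    unfolding fps_deriv_eq_iff .
  also have "(x_minus_ln ^ Suc k) $ 0 - (fps_const (fact (Suc k)) * E (Suc k)) $ 0 = 0" by (simp add: E_def)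
  finally show ?case by (simp add: E_def)
qed

text \<open>The recurrence of \<open>Stirling\<close> becomes a linear differential equation. The
  difference \<open>D\<close> of the two sides satisfies \<open>D' = (j + 1) D\<close> with constant
  term 0, hence vanishes.\<close>

lemma exp_minus_one_power:
  "(fps_exp 1 - 1) ^ j = fps_const (fact j) * Abs_fps (\<lambda>m. of_nat (Stirling m j) / fact m :: real)"
proof (induction j)
  case 0
  have "Stirling m 0 = (if m = 0 then 1 else 0)" for m by (cases m) auto
  then show ?case by (intro fps_ext) simp
next
  case (Suc j)
  define F where "F = (\<lambda>j. Abs_fps (\<lambda>m. of_nat (Stirling m j) / fact m :: real))"
  define D where "D = (fps_exp 1 - 1) ^ Suc j - fps_const (fact (Suc j)) * F (Suc j)"
  have F: "fps_deriv (F (Suc j)) = of_nat (Suc j) * F (Suc j) + F j"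
  proof (rule fps_ext)
    fix m
    have "fps_deriv (F (Suc j)) $ m = of_nat (Stirling (Suc m) (Suc j)) / fact m"
      by (simp add: F_def divide_simps del: Stirling.simps)
    also have "\<dots> = of_nat (Suc j) * (of_nat (Stirling m (Suc j)) / fact m) + of_nat (Stirling m j) / fact m"
      unfolding Stirling.simps of_nat_add of_nat_mult by (simp add: add_divide_distrib)
    also have "\<dots> = (of_nat (Suc j) * F (Suc j) + F j) $ m"
      by (simp add: F_def fps_of_nat[symmetric] del: of_nat_Suc)
    finally show "fps_deriv (F (Suc j)) $ m = (of_nat (Suc j) * F (Suc j) + F j) $ m" .
  qed
  have IH: "(fps_exp 1 - 1) ^ j = fps_const (fact j) * F j" using Suc by (simp add: F_def)
  have "fps_deriv ((fps_exp 1 - 1 :: real fps) ^ Suc j) = of_nat (Suc j) * fps_exp 1 * (fps_exp 1 - 1) ^ j"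
    unfolding fps_deriv_power' by simp
  also have "\<dots> = of_nat (Suc j) * (fps_exp 1 - 1) ^ Suc j + of_nat (Suc j) * (fps_exp 1 - 1) ^ j"
    by (simp add: algebra_simps)
  finally have "fps_deriv D = of_nat (Suc j) * D"
    unfolding D_def IH by (simp add: F fps_of_nat[symmetric] algebra_simps del: of_nat_Suc power_Suc)
  then have "fps_deriv D = fps_const (real (Suc j)) * D" by (simp only: fps_of_nat)
  then have "D = fps_const (D $ 0) * fps_exp (real (Suc j))" by (simp only: fps_exp_unique_ODE)
  moreover have "D $ 0 = 0" by (simp add: D_def F_def)
  ultimately have "D = 0" by simp
  then show ?case by (simp add: D_def F_def)
qed

text \<open>Up to the factor \<open>i + 1\<close> the product is the derivative of the next power,
  which accounts for the shift of both Stirling arguments.\<close>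

lemma exp_times_exp_minus_one_power:
  "(fps_exp 1 * (fps_exp 1 - 1) ^ i) $ m = (fact i * of_nat (Stirling (Suc m) (Suc i)) / fact m :: real)"
proof -
  have "fps_deriv ((fps_exp 1 - 1 :: real fps) ^ Suc i) = of_nat (Suc i) * (fps_exp 1 * (fps_exp 1 - 1) ^ i)"
    unfolding fps_deriv_power' by simp
  then have "of_nat (Suc i) * (fps_exp 1 * (fps_exp 1 - 1) ^ i) $ m = fps_deriv ((fps_exp 1 - 1 :: real fps) ^ Suc i) $ m"
    by (simp add: fps_of_nat[symmetric] del: of_nat_Suc)
  also have "\<dots> = of_nat (Suc m) * (fact (Suc i) * (of_nat (Stirling (Suc m) (Suc i)) / fact (Suc m)))"
    unfolding exp_minus_one_power by (simp del: of_nat_Suc fact_Suc Stirling.simps)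
  also have "\<dots> = of_nat (Suc i) * (fact i * of_nat (Stirling (Suc m) (Suc i)) / fact m)"
    by (simp add: field_simps del: of_nat_Suc Stirling.simps)
  finally show ?thesis unfolding mult_cancel_left by (simp del: of_nat_Suc Stirling.simps)
qed

lemma weight_formula:
  assumes y: "y \<noteq> 0"
  shows "weight y (sp_trees {1..Suc n}) = (\<Sum>k\<le>n. \<Sum>i\<le>n + k.
    y ^ Suc i / y ^ k * ((-1) ^ i * of_nat (derangement_num i k) * of_nat (Stirling (Suc (n + k)) (Suc i))))"
proof -
  define N where "N = egf (\<lambda>m. weight y (sp_trees {1..m}))"
  define S where "S = egf (\<lambda>m. weight y (ser_trees {1..m}))"
  define P where "P = egf (\<lambda>m. weight y (par_trees {1..m}))"
  note eqs = weight_egf[OF y, folded N_def S_def P_def]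
  define w where "w = fps_const (1 / y) * (N - P)"
  define g :: "real fps" where "g = fps_const y * (fps_exp 1 - 1)"
  \<comment> \<open>Inserting \<open>N = g oo w\<close> and \<open>S = x_minus_ln oo N\<close> into
    \<open>w = X + S / y\<close> gives \<open>w = X + (\<phi> oo w)\<close>.\<close>
  define \<phi> where "\<phi> = fps_const (1 / y) * (x_minus_ln oo g)"
  have g0: "g $ 0 = 0" by (simp add: g_def)
  have w0: "w $ 0 = 0" using eqs by (simp add: w_def)
  have cy: "fps_const y * fps_const (1 / y) = 1" using y by simp
  have yw: "fps_const y * w = N - P" unfolding w_def using cy by (simp add: mult.assoc[symmetric])
  have Ng: "N = g oo w"
  proof -
    have dw: "fps_const y * fps_deriv w = fps_deriv N - fps_deriv P"
      using arg_cong[OF yw, of fps_deriv] by simp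
    have "fps_const y * fps_deriv P = fps_const y * (fps_deriv w * N)"
      using eqs(3) dw by (simp add: mult.assoc[symmetric])
    then have "fps_deriv P = fps_deriv w * N" using y by simp
    then have dN: "fps_deriv N = fps_deriv w * (fps_const y + N)" using dw by (simp add: algebra_simps)
    \<comment> \<open>From \<open>N' = w' (y + N)\<close> the quotient of \<open>y + N\<close> by
      \<open>exp w\<close> has derivative 0. \<open>Z\<close> is this quotient, with the reciprocal
      of \<open>exp w\<close> written as \<open>exp (- w)\<close>.\<close>
    define Z where "Z = (fps_const y + N) * (fps_exp (-1) oo w)"
    have m1: "fps_const (- 1) * q = - q" for q :: "real fps" by (rule fps_ext) simp
    then have "fps_deriv Z = 0"
      unfolding Z_def by (simp add: m1 fps_compose_uminus dN fps_compose_deriv[OF w0] fps_compose_mult_distrib[OF w0] algebra_simps)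
    then have "Z = fps_const (Z $ 0)" by (simp add: fps_deriv_eq_0_iff)
    moreover have "Z $ 0 = y" using eqs by (simp add: Z_def)
    ultimately have Z: "Z = fps_const y" by simp
    have "(fps_exp (-1) oo w) * (fps_exp 1 oo w) = (fps_exp (-1) * fps_exp (1::real)) oo w"
      by (rule fps_compose_mult_distrib[OF w0, symmetric])
    also have "fps_exp (-1) * fps_exp (1::real) = 1" by (simp flip: fps_exp_add_mult)
    finally have "(fps_exp (-1) oo w) * (fps_exp 1 oo w) = 1" by simp
    then have "fps_const y + N = Z * (fps_exp 1 oo w)" by (simp add: Z_def mult.assoc)
    then show ?thesis unfolding Z g_def
      by (simp add: fps_compose_mult_distrib[OF w0] fps_compose_sub_distrib algebra_simps)
  qed
  have SL: "S = x_minus_ln oo N"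
  proof -
    have N0: "N $ 0 = 0" using eqs by simp
    \<comment> \<open>The derivative of \<open>x_minus_ln\<close> is \<open>X / (1 + X)\<close>, so
      \<open>S\<close> and \<open>x_minus_ln oo N\<close> have equal derivatives; both have constant
      term 0.\<close>
    have "(1 + N) * fps_deriv S = N * fps_deriv N" using eqs(2) by (simp add: algebra_simps)
    also have "N * fps_deriv N = (fps_X oo N) * fps_deriv N" using N0 by simp
    also have "fps_X oo N = (1 + N) * (fps_deriv x_minus_ln oo N)"
    proof -
      have "fps_X oo N = ((1 + fps_X) * fps_deriv x_minus_ln) oo N" by (simp only: x_minus_ln_deriv)
      then show ?thesis using N0 by (simp add: fps_compose_mult_distrib[OF N0] fps_compose_add_distrib)
    qed
    also have "(1 + N) * (fps_deriv x_minus_ln oo N) * fps_deriv N = (1 + N) * fps_deriv (x_minus_ln oo N)"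
      by (simp add: fps_compose_deriv[OF N0])
    finally have "fps_deriv S = fps_deriv (x_minus_ln oo N)" by (rule one_plus_mult_cancel) (rule N0)
    then have "S = fps_const (S $ 0 - (x_minus_ln oo N) $ 0) + (x_minus_ln oo N)" unfolding fps_deriv_eq_iff .
    then show ?thesis using eqs by simp
  qed
  have "w = fps_X + fps_const (1 / y) * S"
  proof -
    have "N - P = fps_const y * fps_X + S" using eqs(1) by (simp add: algebra_simps)
    then have "w = (fps_const y * fps_const (1 / y)) * fps_X + fps_const (1 / y) * S"
      unfolding w_def by (simp only: distrib_left mult_ac)
    then show ?thesis unfolding cy by simp
  qed
  also have "S = (x_minus_ln oo g) oo w" unfolding SL Ng by (rule fps_compose_assoc[OF w0 g0])
  finally have w: "w = fps_X + (\<phi> oo w)"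
    unfolding \<phi>_def by (simp add: fps_compose_mult_distrib[OF w0])
  have \<phi>0: "\<phi> $ 0 = 0" "\<phi> $ 1 = 0" by (simp_all add: \<phi>_def fps_compose_nth)
  have "weight y (sp_trees {1..Suc n}) = fact (Suc n) * N $ Suc n" by (simp add: N_def egf_def)
  also have "\<dots> = (\<Sum>k\<le>n. fact (n + k) / fact k * (fps_deriv g * \<phi> ^ k) $ (n + k))"
    unfolding Ng by (rule lagrange_perturbation[OF \<phi>0 w w0])
  also have "\<dots> = (\<Sum>k\<le>n. \<Sum>i\<le>n + k.
    y ^ Suc i / y ^ k * ((-1) ^ i * of_nat (derangement_num i k) * of_nat (Stirling (Suc (n + k)) (Suc i))))"
  proof (rule sum.cong)
    fix k
    let ?m = "n + k"
    have "\<phi> ^ k = fps_const (1 / y ^ k) * (x_minus_ln ^ k oo g)"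
      by (simp add: \<phi>_def power_mult_distrib fps_compose_power[OF g0, symmetric] power_one_over)
    then have "fps_deriv g * \<phi> ^ k = fps_const (1 / y ^ k) * ((x_minus_ln ^ k oo g) * fps_deriv g)"
      by (simp add: algebra_simps)
    then have "(fps_deriv g * \<phi> ^ k) $ ?m = 1 / y ^ k * (\<Sum>i\<le>?m. x_minus_ln ^ k $ i * (g ^ i * fps_deriv g) $ ?m)"
      using fps_compose_mult_nth[OF g0, of "x_minus_ln ^ k" "fps_deriv g" ?m] by (simp only: fps_mult_left_const_nth)
    also have "(\<Sum>i\<le>?m. x_minus_ln ^ k $ i * (g ^ i * fps_deriv g) $ ?m) =
      (\<Sum>i\<le>?m. fact k * (of_nat (derangement_num i k) * (-1) ^ i / fact i) *
        (y ^ Suc i * (fact i * of_nat (Stirling (Suc ?m) (Suc i)) / fact ?m)))"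
    proof (rule sum.cong)
      fix i
      have "g ^ i * fps_deriv g = fps_const (y ^ Suc i) * (fps_exp 1 * (fps_exp 1 - 1) ^ i)"
      proof -
        have "g ^ i = fps_const (y ^ i) * (fps_exp 1 - 1) ^ i"
          by (simp only: g_def power_mult_distrib fps_const_power)
        moreover have "fps_deriv g = fps_const y * fps_exp 1" by (simp add: g_def)
        moreover have "fps_const (y ^ Suc i) = fps_const y * fps_const (y ^ i)" by simp
        ultimately show ?thesis by (simp only: mult_ac)
      qed
      then have "(g ^ i * fps_deriv g) $ ?m = y ^ Suc i * (fact i * of_nat (Stirling (Suc ?m) (Suc i)) / fact ?m)"
        using exp_times_exp_minus_one_power[of i ?m] by (simp del: power_Suc Stirling.simps)
      then show "x_minus_ln ^ k $ i * (g ^ i * fps_deriv g) $ ?m = fact k * (of_nat (derangement_num i k) * (-1) ^ i / fact i) *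
        (y ^ Suc i * (fact i * of_nat (Stirling (Suc ?m) (Suc i)) / fact ?m))"
        unfolding x_minus_ln_power by simp
    qed simp
    finally show "fact ?m / fact k * (fps_deriv g * \<phi> ^ k) $ ?m = (\<Sum>i\<le>?m.
      y ^ Suc i / y ^ k * ((-1) ^ i * of_nat (derangement_num i k) * of_nat (Stirling (Suc ?m) (Suc i))))"
      by (simp add: sum_distrib_left field_simps del: power_Suc Stirling.simps)
  qed simp
  finally show ?thesis .
qed


section \<open>Comparison of coefficients in \<open>y\<close>\<close>

lemma sum_powers_eqD:
  fixes a b :: "nat \<Rightarrow> real"
  assumes "\<And>y. y \<noteq> 0 \<Longrightarrow> (\<Sum>l\<le>n. a l * y ^ l) = (\<Sum>l\<le>n. b l * y ^ l)" "l \<le> n"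
  shows "a l = b l"
proof -
  define q where "q = (\<Sum>l\<le>n. monom (a l - b l) l)"
  \<comment> \<open>The factor \<open>[:0, 1:]\<close> supplies the root 0, where the hypothesis
    gives no information.\<close>
  have "poly (q * [:0, 1:]) y = 0" for y
    using assms(1)[of y] by (cases "y = 0") (auto simp: q_def poly_sum poly_monom left_diff_distrib sum_subtractf)
  then have "q * [:0, 1:] = 0" using poly_all_0_iff_0 by blast
  then have "q = 0" by simp
  then have "coeff q l = 0" by simp
  then show ?thesis using assms(2) by (simp add: q_def coeff_sum)
qed

lemma card_conn_eq:
  assumes "1 \<le> m"
  shows "int (card (conn ` {t \<in> sp_trees {1..m}. tree_rank t = l})) =
    (\<Sum>k<l. (-1) ^ (k + l - 1) * int (derangement_num (k + l - 1) k) * int (Stirling (m + k) (k + l)))"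
    (is "int ?c = ?r l")
proof (cases "l \<le> m")
  case False
  then have "{t \<in> sp_trees {1..m}. tree_rank t = l} = {}"
    by (auto simp: sp_trees_def dest!: tree_rank_le)
  \<comment> \<open>More than \<open>m + k\<close> parts are required of \<open>m + k\<close>
    elements, so every Stirling number in the sum vanishes.\<close>
  moreover have "?r l = 0" using False by (intro sum.neutral) simp
  ultimately show ?thesis by (simp only: image_empty card.empty of_nat_0)
next
  case True
  obtain n where m: "m = Suc n" using assms by (cases m) auto
  define c where "c = (\<lambda>l. card (conn ` {t \<in> sp_trees {1..m}. tree_rank t = l}))"
  define h where "h = (\<lambda>k i. (-1) ^ i * real (derangement_num i k) * real (Stirling (m + k) (Suc i)))"
  have h0: "h k i = 0" if "i < 2 * k" for k i using derangement_num_eq_0[OF that] by (simp add: h_def)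
  have "real (c l) = of_int (?r l)"
  proof (rule sum_powers_eqD[OF _ True])
    fix y :: real assume y: "y \<noteq> 0"
    have "(\<Sum>l\<le>m. real (c l) * y ^ l) = weight y (sp_trees {1..m})"
      unfolding weight_eq_sum_card c_def ..
    also have "\<dots> = (\<Sum>k\<le>n. \<Sum>i\<le>n + k. y ^ Suc i / y ^ k * h k i)"
      unfolding m weight_formula[OF y] by (simp add: h_def m del: Stirling.simps power_Suc)
    also have "\<dots> = (\<Sum>k\<le>n. \<Sum>l\<le>m. if k < l then y ^ l * h k (k + l - 1) else 0)"
    proof (rule sum.cong)
      fix k assume "k \<in> {..n}"
      \<comment> \<open>A derangement with \<open>k\<close> cycles needs at least
        \<open>2 * k\<close> points, so only \<open>i >= 2 * k\<close> survives. Then the exponent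
        \<open>l = Suc i - k\<close> exceeds \<open>k\<close>: this is the origin of the range
        \<open>k < l\<close>, and no negative power of \<open>y\<close> remains.\<close>
      have "(\<Sum>i\<le>n + k. y ^ Suc i / y ^ k * h k i) = (\<Sum>i\<in>{2 * k..n + k}. y ^ Suc i / y ^ k * h k i)"
        by (rule sum.mono_neutral_right) (auto simp: h0)
      also have "\<dots> = (\<Sum>l\<in>{Suc k..m}. y ^ l * h k (k + l - 1))"
      proof (rule sum.reindex_bij_witness[where i = "\<lambda>l. k + l - 1" and j = "\<lambda>i. Suc i - k"])
        fix i assume i: "i \<in> {2 * k..n + k}"
        then have "k + (Suc i - k) - 1 = i" by auto
        moreover have "y ^ Suc i = y ^ (Suc i - k) * y ^ k" using i by (simp flip: power_add del: power_Suc)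
        ultimately show "y ^ (Suc i - k) * h k (k + (Suc i - k) - 1) = y ^ Suc i / y ^ k * h k i" using y by simp
      qed (auto simp: m)
      also have "\<dots> = (\<Sum>l\<le>m. if k < l then y ^ l * h k (k + l - 1) else 0)"
        by (rule sum.mono_neutral_cong_left) auto
      finally show "(\<Sum>i\<le>n + k. y ^ Suc i / y ^ k * h k i) = (\<Sum>l\<le>m. if k < l then y ^ l * h k (k + l - 1) else 0)" .
    qed simp
    also have "\<dots> = (\<Sum>l\<le>m. \<Sum>k\<le>n. if k < l then y ^ l * h k (k + l - 1) else 0)" by (rule sum.swap)
    also have "\<dots> = (\<Sum>l\<le>m. of_int (?r l) * y ^ l)"
    proof (rule sum.cong)
      fix l assume l: "l \<in> {..m}"
      \<comment> \<open>As \<open>l \<le> Suc n\<close>, the condition \<open>k < l\<close> already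
        implies \<open>k \<le> n\<close>.\<close>
      have "(\<Sum>k\<le>n. if k < l then y ^ l * h k (k + l - 1) else 0) = (\<Sum>k<l. y ^ l * h k (k + l - 1))"
        by (rule sum.mono_neutral_cong_right) (use l m in auto)
      also have "\<dots> = (\<Sum>k<l. y ^ l * ((-1) ^ (k + l - 1) * real (derangement_num (k + l - 1) k) * real (Stirling (m + k) (k + l))))"
        by (rule sum.cong) (auto simp: h_def)
      also have "\<dots> = of_int (?r l) * y ^ l" by (simp add: sum_distrib_left mult.commute)
      finally show "(\<Sum>k\<le>n. if k < l then y ^ l * h k (k + l - 1) else 0) = of_int (?r l) * y ^ l" .
    qed simp
    finally show "(\<Sum>l\<le>m. real (c l) * y ^ l) = (\<Sum>l\<le>m. of_int (?r l) * y ^ l)" .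
  qed
  then have "real_of_int (int (c l)) = of_int (?r l)" by (simp only: of_int_of_nat_eq)
  then show ?thesis by (simp only: of_int_eq_iff c_def)
qed

theorem corollary4p4:
  fixes n l :: nat
  assumes "n \<ge> 2"
  shows "int (num_sp_matroids n l) =
    (\<Sum>k<l. (-1) ^ (k + l - 1) * int (assoc_stirling (k + l - 1) k) * int (Stirling (n - 1 + k) (k + l)))"
proof -
  have "{1..<n} = {1..n - 1}" "1 \<le> n - 1" using assms by auto
  then show ?thesis
    using num_sp_matroids_eq[OF assms] card_conn_eq[of "n - 1" l] by (simp add: assoc_stirling_eq)
qed

end
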